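(* The GMRES iteration for the equation $(\mathcal I+\mathbb K)\boldsymbol W=\boldsymbol b$ of multiple scattering in homogeneous media, where $$(\mathbb K\boldsymbol W)_{ij}=\sum_{(\ell,k)\neq(i,j)}\mathscr B_{ij}\,\mathscr K_{\ell k}\,\widetilde{\mathscr K}_{\ell k}^{-1}W_{\ell k}\quad\text{on }\partial\Omega_{ij},$$ converges, in the following sense. The operator $\mathcal I+\mathbb K$ on $\boldsymbol L^2(\partial\Omega)$ has a countable sequence of eigenvalues with $1$ as the only possible accumulation point; number them so that $|\lambda_j-1|\ge|\lambda_{j+1}-1|$ for $j\ge1$. Given $\rho>0$, determine $0\le M<\infty$ so that $\{\lambda_j\}_{j=1}^M\subset\{z:|z-1|>\rho\}$ (the outliers) and $\{\lambda_j\}_{j\ge M+1}\subset\{z:|z-1|<\rho\}$ (the cluster), and define $$\delta=\max_{|z-1|=\rho}\ \max_{1\le j\le M}\frac{|\lambda_j-z|}{|\lambda_j|}.$$ Then for any $\boldsymbol b$ and any initial guess $\boldsymbol W^{(0)}$ the GMRES residuals satisfy $$\|\boldsymbol r_{d+k}\|\le C_\delta\,\rho^k\,\|\boldsymbol r_0\|,$$ where $\boldsymbol r_m$ is the residual at the $m$-th GMRES step, $d\ge0$ is an integer determined by the outliers, and the constant $C_\delta$ is independent of $k$. (For any $\rho<1$ the set of eigenvalues with $|\lambda_j-1|>\rho$ is finite.)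
   Context: There are finitely many mutually separated bounded scatterers $\Omega_{ij}\subset\mathbb R^2$, $1\le j\le M_i$, $i=1,2,3$ ($i=1$: Dirichlet, $i=2$: Neumann, $i=3$: Robin), with $C^2$ boundaries; $\boldsymbol n$ is the unit outward normal. The wave number $\kappa$ satisfies $\operatorname{Im}\kappa\ge0$; $h$ is a given function on the boundaries of the type-$3$ scatterers with $\operatorname{Im}(\bar\kappa h)\ge0$; $\eta$ is a given constant with $\eta\operatorname{Re}\kappa\ge0$. $\boldsymbol L^2(\partial\Omega)=\prod_{i,j}L^2(\partial\Omega_{ij})$ with inner product $(\boldsymbol u,\boldsymbol v)=\sum_{i,j}(u_{ij},v_{ij})_{L^2(\partial\Omega_{ij})}$. In the scattering problem with incident field $u^{\rm in}$ the right-hand side is $\boldsymbol b=(-\mathscr B_{ij}u^{\rm in})_{ij}$. Let $G_\kappa(\boldsymbol x,\boldsymbol y)=\frac{\mathrm i}{4}H_0^{(1)}(\kappa|\boldsymbol x-\boldsymbol y|)$, $H_0^{(1)}$ being the Hankel function of the first kind of order $0$. For a density $\phi$ on $\partial\Omega_{\ell k}$ and $\boldsymbol x\notin\partial\Omega_{\ell k}$ let $\mathcal S_{\ell k}\phi(\boldsymbol x)=\int_{\partial\Omega_{\ell k}}G_\kappa(\boldsymbol x,\boldsymbol y)\phi(\boldsymbol y)\,dS_{\boldsymbol y}$ and $\mathcal D_{\ell k}\phi(\boldsymbol x)=\int_{\partial\Omega_{\ell k}}\frac{\partial G_\kappa(\boldsymbol x,\boldsymbol y)}{\partial\boldsymbol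 n(\boldsymbol y)}\phi(\boldsymbol y)\,dS_{\boldsymbol y}$. Mixed potentials: $\mathscr K_{1k}=\mathcal D_{1k}+\mathrm i\eta\mathcal S_{1k}$, and $\mathscr K_{\ell k}=-\mathrm i\eta\mathcal D_{\ell k}-\mathcal S_{\ell k}$ for $\ell=2,3$. Boundary operators on $\partial\Omega_{ij}$: $\mathscr B_{1j}v=v$, $\mathscr B_{2j}v=\partial v/\partial\boldsymbol n$, $\mathscr B_{3j}v=\partial v/\partial\boldsymbol n+hv$. On $\Gamma=\partial\Omega_{\ell k}$ let $S,D,D^*,N$ be the boundary integral operators with kernels $G_\kappa$, $\partial G_\kappa/\partial\boldsymbol n(\boldsymbol y)$, $\partial G_\kappa/\partial\boldsymbol n(\boldsymbol x)$ (Cauchy principal values) and $\partial^2G_\kappa/\partial\boldsymbol n(\boldsymbol x)\partial\boldsymbol n(\boldsymbol y)$ (Hadamard finite part), and let $$\widetilde{\mathscr K}_{1k}=\tfrac12\mathcal I+D+\mathrm i\eta S,\quad \widetilde{\mathscr K}_{2k}=\tfrac12\mathcal I-\mathrm i\eta N-D^*,\quad \widetilde{\mathscr K}_{3k}=\tfrac12\mathcal I-\mathrm i\eta(hD+N)-(hS+D^* )-\tfrac{\mathrm i}{2}\eta h\mathcal I .$$ $\widetilde{\mathscr K}_{\ell k}^{-1}$ is the solution operator $W\mapsto\phi$ of the boundary integral equation $\widetilde{\mathscr K}_{\ell k}\phi=W$ on $\partial\Omega_{\ell k}$, which the paper takes to exist and be bounded on $L^2(\partial\Omega_{\ell k})$.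 GMRES for $A\boldsymbol W=\boldsymbol b$ in a Hilbert space with initial guess $\boldsymbol W^{(0)}$ and $\boldsymbol r_0=\boldsymbol b-A\boldsymbol W^{(0)}$: the $m$-th iterate $\boldsymbol W^{(m)}$ minimizes $\|\boldsymbol b-A\boldsymbol W\|$ over $\boldsymbol W^{(0)}+\operatorname{span}\{\boldsymbol r_0,A\boldsymbol r_0,\dots,A^{m-1}\boldsymbol r_0\}$, and $\boldsymbol r_m=\boldsymbol b-A\boldsymbol W^{(m)}$. *)

theory Defs
  imports "HOL-Analysis.Analysis"
begin

section \<open>Fundamental solution\<close>

definition bessel_J0 :: "complex \<Rightarrow> complex" where
  "bessel_J0 z = (\<Sum>k. (-1) ^ k * (z / 2) ^ (2 * k) / (fact k)\<^sup>2)"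

definition bessel_Y0 :: "complex \<Rightarrow> complex" where
  "bessel_Y0 z = 2 / of_real pi * (Ln (z / 2) + of_real euler_mascheroni) * bessel_J0 z
     - 2 / of_real pi * (\<Sum>k. (-1) ^ k * harm k * (z / 2) ^ (2 * k) / (fact k)\<^sup>2)"

text \<open>The principal branch of the logarithm is used; it is continuous on the closed upper
  half plane without 0, which is where the arguments lie when the wave number satisfies
  \<open>Im \<kappa> \<ge> 0\<close>.\<close>

definition hankel_H0 :: "complex \<Rightarrow> complex" where
  "hankel_H0 z = bessel_J0 z + \<i> * bessel_Y0 z"

definition green :: "complex \<Rightarrow> real^2 \<Rightarrow> real^2 \<Rightarrow> complex" where
  "green \<kappa> x y = \<i> / 4 * hankel_H0 (\<kappa> * of_real (dist x y))"

definition dir_deriv :: "(real^2 \<Rightarrow> complex) \<Rightarrow> real^2 \<Rightarrow> real^2 \<Rightarrow> complex" where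
  "dir_deriv f x v = vector_derivative (\<lambda>t. f (x + t *\<^sub>R v)) (at 0)"

section \<open>Boundaries of class C2\<close>

definition perp :: "real^2 \<Rightarrow> real^2" where
  "perp v = vector [- (v $ 2), v $ 1]"

definition C2_function :: "(real \<Rightarrow> real) \<Rightarrow> bool" where
  "C2_function f \<longleftrightarrow> (\<exists>f' f''. (\<forall>s. (f has_real_derivative f' s) (at s)) \<and>
     (\<forall>s. (f' has_real_derivative f'' s) (at s)) \<and> continuous_on UNIV f'')"

text \<open>In the orthonormal coordinates \<open>(perp e \<bullet> x, e \<bullet> x)\<close> the set lies, near \<open>x0\<close>, strictly
  below the graph of \<open>f\<close>.\<close>

definition boundary_chart ::
    "(real^2) set \<Rightarrow> real^2 \<Rightarrow> real \<Rightarrow> real^2 \<Rightarrow> (real \<Rightarrow> real) \<Rightarrow> bool" where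
  "boundary_chart \<Omega> x0 r e f \<longleftrightarrow> r > 0 \<and> norm e = 1 \<and> C2_function f \<and>
     \<Omega> \<inter> ball x0 r = {x \<in> ball x0 r. e \<bullet> x < f (perp e \<bullet> x)}"

definition C2_boundary :: "(real^2) set \<Rightarrow> bool" where
  "C2_boundary \<Omega> \<longleftrightarrow> (\<forall>x0 \<in> frontier \<Omega>. \<exists>r e f. boundary_chart \<Omega> x0 r e f)"

text \<open>The outward normal is the normalised gradient of \<open>e \<bullet> x - f (perp e \<bullet> x)\<close>; it does not
  depend on the chart.\<close>

definition outward_normal :: "(real^2) set \<Rightarrow> real^2 \<Rightarrow> real^2" where
  "outward_normal \<Omega> x = (THE n. \<exists>r e f. boundary_chart \<Omega> x r e f \<and>
     n = sgn (e - deriv f (perp e \<bullet> x) *\<^sub>R perp e))"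

text \<open>Arc length is the one-dimensional Hausdorff measure.\<close>

definition hausdorff1 :: "(real^2) measure" where
  "hausdorff1 = measure_of UNIV (sets borel)
     (\<lambda>A. SUP \<epsilon>\<in>{0<..}.
        INF C\<in>{C :: nat \<Rightarrow> (real^2) set. A \<subseteq> (\<Union>i. C i) \<and> (\<forall>i. bounded (C i) \<and> diameter (C i) \<le> \<epsilon>)}.
          (\<Sum>i. ennreal (diameter (C i))))"

definition bdry :: "(real^2) set \<Rightarrow> (real^2) measure" where
  "bdry \<Omega> = restrict_space hausdorff1 (frontier \<Omega>)"

definition L2 :: "(real^2) measure \<Rightarrow> (real^2 \<Rightarrow> complex) set" where
  "L2 \<mu> = {f \<in> borel_measurable \<mu>. integrable \<mu> (\<lambda>x. (cmod (f x))\<^sup>2)}"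

text \<open>The Sobolev space of densities with a square-integrable weak tangential derivative.\<close>

definition H1 :: "(real^2) set \<Rightarrow> (real^2 \<Rightarrow> complex) set" where
  "H1 \<Omega> = {\<phi> \<in> L2 (bdry \<Omega>). \<exists>\<psi> \<in> L2 (bdry \<Omega>).
     \<forall>(v :: real^2 \<Rightarrow> real) (v' :: real^2 \<Rightarrow> ((real^2) \<Rightarrow>\<^sub>L real)).
       (\<forall>x. (v has_derivative blinfun_apply (v' x)) (at x)) \<and> continuous_on UNIV v' \<longrightarrow>
       (LINT y|bdry \<Omega>. \<phi> y * of_real (blinfun_apply (v' y) (perp (outward_normal \<Omega> y)))) =
       - (LINT y|bdry \<Omega>. \<psi> y * of_real (v y))}"

section \<open>Layer potentials off the boundary\<close>

definition green_dy :: "complex \<Rightarrow> (real^2) set \<Rightarrow> real^2 \<Rightarrow> real^2 \<Rightarrow> complex" where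
  "green_dy \<kappa> \<Omega> x y = dir_deriv (\<lambda>y'. green \<kappa> x y') y (outward_normal \<Omega> y)"

definition green_dx :: "complex \<Rightarrow> (real^2) set \<Rightarrow> real^2 \<Rightarrow> real^2 \<Rightarrow> complex" where
  "green_dx \<kappa> \<Omega> x y = dir_deriv (\<lambda>x'. green \<kappa> x' y) x (outward_normal \<Omega> x)"

definition green_dxdy :: "complex \<Rightarrow> (real^2) set \<Rightarrow> real^2 \<Rightarrow> real^2 \<Rightarrow> complex" where
  "green_dxdy \<kappa> \<Omega> x y = dir_deriv (\<lambda>x'. green_dy \<kappa> \<Omega> x' y) x (outward_normal \<Omega> x)"

definition single_layer :: "complex \<Rightarrow> (real^2) set \<Rightarrow> (real^2 \<Rightarrow> complex) \<Rightarrow> real^2 \<Rightarrow> complex" where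
  "single_layer \<kappa> \<Omega> \<phi> x = (LINT y|bdry \<Omega>. green \<kappa> x y * \<phi> y)"

definition double_layer :: "complex \<Rightarrow> (real^2) set \<Rightarrow> (real^2 \<Rightarrow> complex) \<Rightarrow> real^2 \<Rightarrow> complex" where
  "double_layer \<kappa> \<Omega> \<phi> x = (LINT y|bdry \<Omega>. green_dy \<kappa> \<Omega> x y * \<phi> y)"

datatype bc = Dirichlet | Neumann | Robin

fun mixed_potential ::
    "complex \<Rightarrow> real \<Rightarrow> bc \<Rightarrow> (real^2) set \<Rightarrow> (real^2 \<Rightarrow> complex) \<Rightarrow> real^2 \<Rightarrow> complex" where
  "mixed_potential \<kappa> \<eta> Dirichlet \<Omega> \<phi> x =
     double_layer \<kappa> \<Omega> \<phi> x + \<i> * of_real \<eta> * single_layer \<kappa> \<Omega> \<phi> x"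
| "mixed_potential \<kappa> \<eta> Neumann \<Omega> \<phi> x =
     - \<i> * of_real \<eta> * double_layer \<kappa> \<Omega> \<phi> x - single_layer \<kappa> \<Omega> \<phi> x"
| "mixed_potential \<kappa> \<eta> Robin \<Omega> \<phi> x =
     - \<i> * of_real \<eta> * double_layer \<kappa> \<Omega> \<phi> x - single_layer \<kappa> \<Omega> \<phi> x"

fun boundary_op ::
    "(real^2 \<Rightarrow> complex) \<Rightarrow> bc \<Rightarrow> (real^2) set \<Rightarrow> (real^2 \<Rightarrow> complex) \<Rightarrow> real^2 \<Rightarrow> complex" where
  "boundary_op h Dirichlet \<Omega> v x = v x"
| "boundary_op h Neumann \<Omega> v x = dir_deriv v x (outward_normal \<Omega> x)"
| "boundary_op h Robin \<Omega> v x = dir_deriv v x (outward_normal \<Omega> x) + h x * v x"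

section \<open>Boundary integral equations\<close>

definition truncated_integral ::
    "(real^2) set \<Rightarrow> (real^2 \<Rightarrow> real^2 \<Rightarrow> complex) \<Rightarrow> (real^2 \<Rightarrow> complex) \<Rightarrow> real^2 \<Rightarrow> real \<Rightarrow> complex" where
  "truncated_integral \<Omega> k \<phi> x \<epsilon> =
     (LINT y|bdry \<Omega>. indicator {y. \<epsilon> < dist x y} y *\<^sub>R (k x y * \<phi> y))"

text \<open>\<open>L\<close> is the Cauchy principal value, respectively the Hadamard finite part, at \<open>x\<close>. For a
  kernel with a singularity of order 2 on a curve the divergent term is a multiple of
  \<open>1/\<epsilon>\<close>.\<close>

definition has_principal_value ::
    "(real^2) set \<Rightarrow> (real^2 \<Rightarrow> real^2 \<Rightarrow> complex) \<Rightarrow> (real^2 \<Rightarrow> complex) \<Rightarrow> real^2 \<Rightarrow> complex \<Rightarrow> bool" where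
  "has_principal_value \<Omega> k \<phi> x L \<longleftrightarrow> (truncated_integral \<Omega> k \<phi> x \<longlongrightarrow> L) (at_right 0)"

definition has_finite_part ::
    "(real^2) set \<Rightarrow> (real^2 \<Rightarrow> real^2 \<Rightarrow> complex) \<Rightarrow> (real^2 \<Rightarrow> complex) \<Rightarrow> real^2 \<Rightarrow> complex \<Rightarrow> bool" where
  "has_finite_part \<Omega> k \<phi> x L \<longleftrightarrow>
     (\<exists>c. ((\<lambda>\<epsilon>. truncated_integral \<Omega> k \<phi> x \<epsilon> - c / of_real \<epsilon>) \<longlongrightarrow> L) (at_right 0))"

text \<open>The hypersingular operator is unbounded on \<open>L2\<close>; wherever it occurs (coupling parameter
  nonzero, not of Dirichlet type) densities are taken in its domain \<open>H1\<close>. On all of \<open>L2\<close> the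
  pointwise finite part would admit spurious null solutions with logarithmic singularities.\<close>

definition density_space :: "real \<Rightarrow> bc \<Rightarrow> (real^2) set \<Rightarrow> (real^2 \<Rightarrow> complex) set" where
  "density_space \<eta> i \<Omega> = (if i = Dirichlet \<or> \<eta> = 0 then L2 (bdry \<Omega>) else H1 \<Omega>)"

text \<open>\<open>boundary_eq \<dots> \<phi> W x\<close>: the boundary integrals exist at \<open>x\<close> and the boundary integral
  equation with density \<open>\<phi>\<close> and right-hand side \<open>W\<close> holds there.  The values of the operators
  with kernels \<open>green\<close>, \<open>green_dy\<close>, \<open>green_dx\<close>, \<open>green_dxdy\<close> are called \<open>s\<close>, \<open>d\<close>, \<open>d'\<close>, \<open>n\<close>.\<close>

fun boundary_eq ::
    "complex \<Rightarrow> real \<Rightarrow> (real^2 \<Rightarrow> complex) \<Rightarrow> bc \<Rightarrow> (real^2) set \<Rightarrow>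
     (real^2 \<Rightarrow> complex) \<Rightarrow> (real^2 \<Rightarrow> complex) \<Rightarrow> real^2 \<Rightarrow> bool" where
  "boundary_eq \<kappa> \<eta> h Dirichlet \<Omega> \<phi> W x \<longleftrightarrow>
     (\<exists>s d. has_principal_value \<Omega> (green \<kappa>) \<phi> x s \<and>
            has_principal_value \<Omega> (green_dy \<kappa> \<Omega>) \<phi> x d \<and>
            1 / 2 * \<phi> x + d + \<i> * of_real \<eta> * s = W x)"
| "boundary_eq \<kappa> \<eta> h Neumann \<Omega> \<phi> W x \<longleftrightarrow>
     (\<exists>d' n. has_principal_value \<Omega> (green_dx \<kappa> \<Omega>) \<phi> x d' \<and>
            (\<eta> \<noteq> 0 \<longrightarrow> has_finite_part \<Omega> (green_dxdy \<kappa> \<Omega>) \<phi> x n) \<and>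
            1 / 2 * \<phi> x - \<i> * of_real \<eta> * n - d' = W x)"
| "boundary_eq \<kappa> \<eta> h Robin \<Omega> \<phi> W x \<longleftrightarrow>
     (\<exists>s d d' n. has_principal_value \<Omega> (green \<kappa>) \<phi> x s \<and>
            has_principal_value \<Omega> (green_dy \<kappa> \<Omega>) \<phi> x d \<and>
            has_principal_value \<Omega> (green_dx \<kappa> \<Omega>) \<phi> x d' \<and>
            (\<eta> \<noteq> 0 \<longrightarrow> has_finite_part \<Omega> (green_dxdy \<kappa> \<Omega>) \<phi> x n) \<and>
            1 / 2 * \<phi> x - \<i> * of_real \<eta> * (h x * d + n) - (h x * s + d')
              - \<i> / 2 * of_real \<eta> * h x * \<phi> x = W x)"

definition solves_bie ::
    "complex \<Rightarrow> real \<Rightarrow> (real^2 \<Rightarrow> complex) \<Rightarrow> bc \<Rightarrow> (real^2) set \<Rightarrow>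
     (real^2 \<Rightarrow> complex) \<Rightarrow> (real^2 \<Rightarrow> complex) \<Rightarrow> bool" where
  "solves_bie \<kappa> \<eta> h i \<Omega> W \<phi> \<longleftrightarrow>
     \<phi> \<in> density_space \<eta> i \<Omega> \<and> (AE x in bdry \<Omega>. boundary_eq \<kappa> \<eta> h i \<Omega> \<phi> W x)"

definition solution_op ::
    "complex \<Rightarrow> real \<Rightarrow> (real^2 \<Rightarrow> complex) \<Rightarrow> bc \<Rightarrow> (real^2) set \<Rightarrow>
     (real^2 \<Rightarrow> complex) \<Rightarrow> (real^2 \<Rightarrow> complex)" where
  "solution_op \<kappa> \<eta> h i \<Omega> W = (SOME \<phi>. solves_bie \<kappa> \<eta> h i \<Omega> W \<phi>)"

definition norm_L2 :: "(real^2) measure \<Rightarrow> (real^2 \<Rightarrow> complex) \<Rightarrow> real" where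
  "norm_L2 \<mu> f = sqrt (LINT x|\<mu>. (cmod (f x))\<^sup>2)"

text \<open>The solution operator exists (unique solvability up to null sets) and is bounded.\<close>

definition bounded_solution_op ::
    "complex \<Rightarrow> real \<Rightarrow> (real^2 \<Rightarrow> complex) \<Rightarrow> bc \<Rightarrow> (real^2) set \<Rightarrow> bool" where
  "bounded_solution_op \<kappa> \<eta> h i \<Omega> \<longleftrightarrow>
     (\<forall>W \<in> L2 (bdry \<Omega>). \<exists>\<phi>. solves_bie \<kappa> \<eta> h i \<Omega> W \<phi>) \<and>
     (\<forall>W \<in> L2 (bdry \<Omega>). \<forall>\<phi> \<psi>. solves_bie \<kappa> \<eta> h i \<Omega> W \<phi> \<and> solves_bie \<kappa> \<eta> h i \<Omega> W \<psi> \<longrightarrow>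
        (AE x in bdry \<Omega>. \<phi> x = \<psi> x)) \<and>
     (\<exists>B. \<forall>W \<in> L2 (bdry \<Omega>).
        norm_L2 (bdry \<Omega>) (solution_op \<kappa> \<eta> h i \<Omega> W) \<le> B * norm_L2 (bdry \<Omega>) W)"

section \<open>Multiple scattering\<close>

type_synonym fields = "bc \<times> nat \<Rightarrow> real^2 \<Rightarrow> complex"

definition scatterers :: "(bc \<Rightarrow> nat) \<Rightarrow> (bc \<times> nat) set" where
  "scatterers m = {(i, j). 1 \<le> j \<and> j \<le> m i}"

text \<open>Elements of the product space are represented by families of functions; equality is
  equality almost everywhere on each boundary.\<close>

definition prod_L2 :: "(bc \<Rightarrow> nat) \<Rightarrow> (bc \<times> nat \<Rightarrow> (real^2) set) \<Rightarrow> fields set" where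
  "prod_L2 m \<Omega> = {u. \<forall>p \<in> scatterers m. u p \<in> L2 (bdry (\<Omega> p))}"

definition prod_eq :: "(bc \<Rightarrow> nat) \<Rightarrow> (bc \<times> nat \<Rightarrow> (real^2) set) \<Rightarrow> fields \<Rightarrow> fields \<Rightarrow> bool" where
  "prod_eq m \<Omega> u v \<longleftrightarrow> (\<forall>p \<in> scatterers m. AE x in bdry (\<Omega> p). u p x = v p x)"

definition prod_inner :: "(bc \<Rightarrow> nat) \<Rightarrow> (bc \<times> nat \<Rightarrow> (real^2) set) \<Rightarrow> fields \<Rightarrow> fields \<Rightarrow> complex" where
  "prod_inner m \<Omega> u v = (\<Sum>p\<in>scatterers m. LINT x|bdry (\<Omega> p). u p x * cnj (v p x))"

definition prod_norm :: "(bc \<Rightarrow> nat) \<Rightarrow> (bc \<times> nat \<Rightarrow> (real^2) set) \<Rightarrow> fields \<Rightarrow> real" where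
  "prod_norm m \<Omega> u = sqrt (Re (prod_inner m \<Omega> u u))"

definition coupling_op ::
    "(bc \<Rightarrow> nat) \<Rightarrow> (bc \<times> nat \<Rightarrow> (real^2) set) \<Rightarrow> complex \<Rightarrow> real \<Rightarrow> (real^2 \<Rightarrow> complex) \<Rightarrow>
     fields \<Rightarrow> fields" where
  "coupling_op m \<Omega> \<kappa> \<eta> h W p x =
     (\<Sum>q \<in> scatterers m - {p}.
        boundary_op h (fst p) (\<Omega> p)
          (mixed_potential \<kappa> \<eta> (fst q) (\<Omega> q) (solution_op \<kappa> \<eta> h (fst q) (\<Omega> q) (W q))) x)"

definition scattering_op ::
    "(bc \<Rightarrow> nat) \<Rightarrow> (bc \<times> nat \<Rightarrow> (real^2) set) \<Rightarrow> complex \<Rightarrow> real \<Rightarrow> (real^2 \<Rightarrow> complex) \<Rightarrow>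
     fields \<Rightarrow> fields" where
  "scattering_op m \<Omega> \<kappa> \<eta> h W p x = W p x + coupling_op m \<Omega> \<kappa> \<eta> h W p x"

definition eigenvalues ::
    "(bc \<Rightarrow> nat) \<Rightarrow> (bc \<times> nat \<Rightarrow> (real^2) set) \<Rightarrow> (fields \<Rightarrow> fields) \<Rightarrow> complex set" where
  "eigenvalues m \<Omega> A = {z. \<exists>u \<in> prod_L2 m \<Omega>. \<not> prod_eq m \<Omega> u (\<lambda>p x. 0) \<and>
     prod_eq m \<Omega> (A u) (\<lambda>p x. z * u p x)}"

text \<open>A numbering \<open>\<Lambda> 1, \<Lambda> 2, \<dots>\<close> of length \<open>N\<close> (possibly infinite), with repetitions allowed.
  The eigenvalue 1 need not be listed: when there are infinitely many other ones, it has no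
  place in a sequence ordered by distance from 1.\<close>

definition eigenvalue_numbering :: "complex set \<Rightarrow> enat \<Rightarrow> (nat \<Rightarrow> complex) \<Rightarrow> bool" where
  "eigenvalue_numbering E N \<Lambda> \<longleftrightarrow>
     E - {1} \<subseteq> \<Lambda> ` {j. 1 \<le> j \<and> enat j \<le> N} \<and> \<Lambda> ` {j. 1 \<le> j \<and> enat j \<le> N} \<subseteq> E \<and>
     (\<forall>j. 1 \<le> j \<and> enat (Suc j) \<le> N \<longrightarrow> cmod (\<Lambda> (Suc j) - 1) \<le> cmod (\<Lambda> j - 1))"

definition residual :: "(fields \<Rightarrow> fields) \<Rightarrow> fields \<Rightarrow> fields \<Rightarrow> fields" where
  "residual A b W p x = b p x - A W p x"

definition krylov_affine :: "(fields \<Rightarrow> fields) \<Rightarrow> fields \<Rightarrow> fields \<Rightarrow> nat \<Rightarrow> fields set" where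
  "krylov_affine A b W0 n =
     {V. \<exists>c :: nat \<Rightarrow> complex. V = (\<lambda>p x. W0 p x + (\<Sum>i<n. c i * (A ^^ i) (residual A b W0) p x))}"

definition gmres_iterates ::
    "(fields \<Rightarrow> real) \<Rightarrow> (fields \<Rightarrow> fields) \<Rightarrow> fields \<Rightarrow> fields \<Rightarrow> (nat \<Rightarrow> fields) \<Rightarrow> bool" where
  "gmres_iterates nrm A b W0 W \<longleftrightarrow>
     (\<forall>n. W n \<in> krylov_affine A b W0 n \<and>
          (\<forall>V \<in> krylov_affine A b W0 n. nrm (residual A b (W n)) \<le> nrm (residual A b V)))"

end

theory Submission
  imports Defs "HOL-Complex_Analysis.Complex_Analysis"
begin

text \<open>The coupling operator \<open>K\<close> is, on each boundary, a sum of integral operators with continuous kernels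
  applied to bounded solution operators, so it is a norm limit of operators of finite rank: for every
  \<open>\<epsilon>\<close>, \<open>K = S + \<Sum>\<^sub>i a\<^sub>i \<otimes> \<beta>\<^sub>i\<close> with \<open>\<parallel>S\<parallel> \<le> \<epsilon>\<close>.  Adding the terms of rank one successively yields a
  scalar power series \<open>D\<close>, a substitute for the Fredholm determinant, such that \<open>D(t) \<Sum>\<^sub>k t\<^sup>k K\<^sup>k u\<close> converges for
  \<open>|t| < 1/\<epsilon>\<close>.  Dividing out the nonvanishing factor of \<open>D\<close> gives finitely many roots \<open>\<mu>\<^sub>i\<close> with
  \<open>\<parallel>K\<^sup>k \<Prod>\<^sub>i (K - \<mu>\<^sub>i) u\<parallel> \<le> C \<epsilon>\<^sup>k \<parallel>u\<parallel>\<close>.  A root that is neither small nor an eigenvalue of \<open>K\<close> can be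
  cancelled, hence only the outliers survive.  With \<open>A = 1 + K\<close> and \<open>\<lambda>\<^sub>i = 1 + \<mu>\<^sub>i\<close>, the polynomial
  \<open>(1 - z)\<^sup>k \<Prod>\<^sub>i (1 - z/\<lambda>\<^sub>i)\<close> has value 1 at 0, so it competes with the GMRES residual polynomial
  of degree \<open>d + k\<close>, where \<open>d\<close> is the number of the remaining roots.\<close>

section \<open>Zeros of power series\<close>

text \<open>The variable t is the reciprocal of the spectral parameter: an eigenvalue \<mu> of
  \<open>K\<close> shows up as the zero 1/\<mu> of a denominator of the Neumann series. Multiplying
  that series by a scalar series turns questions about the resolvent into decay of coefficients, so
  the orbits of \<open>K\<close> are controlled directly, without contour integrals or spectral
  projections. The price is that \<open>D\<close> depends on the chosen approximation and may have
  zeros that belong to no eigenvalue; cancelling them is where completeness enters, and it enters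
  only through the range of \<open>K\<close>. A second obstacle is that the solution operators are
  choices, linear only almost everywhere. Working with representatives and a seminorm is possible
  because potentials ignore null sets, so that the coupling operator can be replaced by one that is
  linear at every point. Finally, d may depend on the outliers but not on \<rho>, whereas the
  construction yields some list of roots for each \<rho>; a list found for one separating circle is
  therefore shown to serve all others.\<close>

definition root_poly :: "complex list \<Rightarrow> complex fps" where
  "root_poly ms = (\<Prod>\<mu>\<leftarrow>ms. 1 - fps_const \<mu> * fps_X)"

lemma root_poly_Nil [simp]: "root_poly [] = 1"
  by (simp add: root_poly_def)

lemma root_poly_Cons: "root_poly (\<mu> # ms) = (1 - fps_const \<mu> * fps_X) * root_poly ms"
  by (simp add: root_poly_def)

lemma has_fps_expansion_root_poly:
  "(\<lambda>t. \<Prod>\<mu>\<leftarrow>ms. 1 - \<mu> * t) has_fps_expansion root_poly ms"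
  by (induction ms) (auto simp: root_poly_Cons intro!: fps_expansion_intros)

text \<open>Zeros are divided out one at a time, multiple ones repeatedly. Since the number of
  removals is bounded, a list of maximal length exists, and its cofactor can have no further zero in
  the small disc.\<close>

lemma root_removal:
  fixes f :: "complex \<Rightarrow> complex"
  assumes holf: "f holomorphic_on ball 0 R" and f0: "f 0 = 1"
    and r: "0 < r" "3 * r \<le> q" "q < R"
  obtains ms g where "g holomorphic_on ball 0 R"
    "\<And>t. t \<in> ball 0 R \<Longrightarrow> f t = (\<Prod>\<mu>\<leftarrow>ms. 1 - \<mu> * t) * g t"
    "\<And>t. t \<in> cball 0 r \<Longrightarrow> g t \<noteq> 0" "g 0 = 1"
proof -
  define good where "good ms g \<longleftrightarrow> (\<forall>\<mu>\<in>set ms. 1 / r \<le> norm \<mu>) \<and> g holomorphic_on ball 0 R \<and>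
      (\<forall>t\<in>ball 0 R. f t = (\<Prod>\<mu>\<leftarrow>ms. 1 - \<mu> * t) * g t)" for ms g
  have g0: "g 0 = 1" if "good ms g" for ms g
  proof -
    have "0 \<in> ball (0::complex) R" using r by auto
    with that have "f 0 = (\<Prod>\<mu>\<leftarrow>ms. 1 - \<mu> * 0) * g 0" unfolding good_def by blast
    moreover have "(\<Prod>\<mu>\<leftarrow>ms. 1 - \<mu> * 0) = (1::complex)" by (induction ms) auto
    ultimately show ?thesis using f0 by simp
  qed
  have "continuous_on (cball 0 q) f"
    using holf r by (intro holomorphic_on_imp_continuous_on holomorphic_on_subset[OF holf]) auto
  then have "compact (f ` cball 0 q)"
    by (intro compact_continuous_image) auto
  then obtain B where B: "\<And>t. t \<in> cball 0 q \<Longrightarrow> norm (f t) \<le> B"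
    by (metis bounded_iff compact_imp_bounded imageI)
  have len: "2 ^ length ms \<le> B" if "good ms g" for ms g
  proof -
    \<comment> \<open>On the circle of radius \<open>q\<close> every factor has modulus at least 2, so by the maximum
      principle each removed root halves the bound on a function with value 1 at 0.\<close>
    have two: "2 ^ length ms \<le> norm (\<Prod>\<mu>\<leftarrow>ms. 1 - \<mu> * t)" if "norm t = q" for t
    proof -
      have "\<forall>\<mu>\<in>set ms. 1 / r \<le> norm \<mu>" using \<open>good ms g\<close> by (simp add: good_def)
      then show ?thesis
      proof (induction ms)
        case (Cons \<mu> ms)
        have "3 \<le> norm \<mu> * q"
        proof -
          have "3 = 1 / r * (3 * r)" using r by simp
          also have "\<dots> \<le> norm \<mu> * q" using Cons.prems r by (intro mult_mono) auto
          finally show ?thesis .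
        qed
        then have "2 \<le> norm (1 - \<mu> * t)"
          using norm_triangle_ineq2[of "\<mu> * t" 1] that by (simp add: norm_mult norm_minus_commute)
        moreover have "2 ^ length ms \<le> norm (\<Prod>\<mu>\<leftarrow>ms. 1 - \<mu> * t)"
          using Cons by simp
        ultimately show ?case
          by (auto simp: norm_mult intro!: mult_mono)
      qed simp
    qed
    have bd: "norm (g t) \<le> B / 2 ^ length ms" if "t \<in> frontier (cball 0 q)" for t
    proof -
      have t: "norm t = q" using that r by auto
      then have "t \<in> ball 0 R" "t \<in> cball 0 q" using r by auto
      with \<open>good ms g\<close> have "norm (\<Prod>\<mu>\<leftarrow>ms. 1 - \<mu> * t) * norm (g t) \<le> B"
        using B[of t] by (simp add: good_def norm_mult)
      moreover have "2 ^ length ms * norm (g t) \<le> norm (\<Prod>\<mu>\<leftarrow>ms. 1 - \<mu> * t) * norm (g t)"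
        using two[OF t] by (intro mult_right_mono) auto
      ultimately show ?thesis by (simp add: field_simps)
    qed
    have hg: "g holomorphic_on cball 0 q"
      using \<open>good ms g\<close> r unfolding good_def by (elim conjE holomorphic_on_subset) auto
    have "norm (g 0) \<le> B / 2 ^ length ms"
    proof (rule maximum_modulus_frontier[where f = g and \<xi> = 0 and S = "cball 0 q"])
      show "g holomorphic_on interior (cball 0 q)"
        using hg by (rule holomorphic_on_subset) auto
      show "continuous_on (closure (cball 0 q)) g"
        using holomorphic_on_imp_continuous_on[OF hg] by simp
    qed (use bd r in auto)
    then show ?thesis using g0[OF that] by (simp add: field_simps)
  qed
  obtain n0 :: nat where n0: "B < 2 ^ n0" by (meson one_less_numeral_iff real_arch_pow semiring_norm(76))
  have bounded: "length ms \<le> n0" if "good ms g" for ms g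
  proof (rule ccontr)
    assume "\<not> length ms \<le> n0"
    then have "(2::real) ^ n0 \<le> 2 ^ length ms" by (intro power_increasing) auto
    with len[OF that] n0 show False by linarith
  qed
  have good0: "\<exists>ms g. good ms g \<and> length ms = 0"
    using holf by (intro exI[of _ "[]"] exI[of _ f]) (auto simp: good_def)
  define P where "P k \<longleftrightarrow> (\<exists>ms g. good ms g \<and> length ms = k)" for k
  have "P 0" "\<forall>k. P k \<longrightarrow> k \<le> n0"
    using good0 bounded by (auto simp: P_def)
  then obtain k where k: "P k" and kmax: "\<And>k'. P k' \<Longrightarrow> k' \<le> k"
    using GreatestI_nat[of P 0 n0] Greatest_le_nat[of P _ n0] by blast
  from k obtain ms g where msg: "good ms g" "length ms = k" by (auto simp: P_def)
  have nz: "g t \<noteq> 0" if t: "t \<in> cball 0 r" for t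
  proof
    assume gt: "g t = 0"
    then have t0: "t \<noteq> 0" using g0[OF msg(1)] by auto
    have tR: "t \<in> ball 0 R" using t r by auto
    \<comment> \<open>The zero t of \<open>g\<close> makes z = t a removable singularity of the
      quotient. As 1 - z/t = -(z - t)/t, the new cofactor is -t times the quotient.\<close>
    define G where "G z = (if z = t then deriv g t else g z / (z - t))" for z
    have "G holomorphic_on ball 0 R"
      using msg(1) gt by (rule_tac pole_theorem_open_0[of g _ t]) (auto simp: good_def G_def)
    moreover have "f z = (1 - 1 / t * z) * (\<Prod>\<mu>\<leftarrow>ms. 1 - \<mu> * z) * (- t * G z)"
      if "z \<in> ball 0 R" for z
      using msg(1) that t0 gt by (auto simp: good_def G_def field_simps)
    moreover have "1 / r \<le> norm (1 / t)"
      using t t0 r by (auto simp: norm_divide divide_simps)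
    ultimately have "good (1 / t # ms) (\<lambda>z. - t * G z)"
      using msg(1) unfolding good_def by (auto intro!: holomorphic_intros)
    then have "P (Suc k)" unfolding P_def using msg(2) by (metis length_Cons)
    then have "Suc k \<le> k" by (rule kmax)
    then show False by simp
  qed
  show thesis
    using msg(1) nz g0[OF msg(1)] by (intro that[of g ms]) (auto simp: good_def)
qed

lemma Cauchy_inequality_fps:
  fixes F :: "complex fps"
  assumes "f has_fps_expansion F" "f holomorphic_on ball 0 r" "continuous_on (cball 0 r) f" "0 < r"
  obtains C where "0 \<le> C" "\<And>k. norm (F $ k) \<le> C * (1 / r) ^ k"
proof -
  have "compact (f ` cball 0 r)"
    using assms by (intro compact_continuous_image) auto
  then obtain B where B: "\<And>t. t \<in> cball 0 r \<Longrightarrow> norm (f t) \<le> B"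
    by (metis bounded_iff compact_imp_bounded imageI)
  have "norm (F $ k) \<le> B * (1 / r) ^ k" for k
  proof -
    have "norm ((deriv ^^ k) f 0) \<le> fact k * B / r ^ k"
      using assms B by (intro Cauchy_inequality) auto
    then show ?thesis
      by (simp add: fps_nth_fps_expansion[OF assms(1)] norm_divide field_simps)
  qed
  moreover have "0 \<le> B" using B[of 0] assms(4) norm_ge_zero[of "f 0"] by (smt (verit) centre_in_cball)
  ultimately show thesis using that by blast
qed

text \<open>The series \<open>D\<close> converges for |t| < 1/\<epsilon>. On a quarter of this disc
  the cofactor left by \<open>root_removal\<close> has no zeros, so its reciprocal is holomorphic
  there and Cauchy's inequality yields the rate 4 \<epsilon>. The quarter leaves room for the factor
  3 in \<open>root_removal\<close>.\<close>

lemma fps_root_factorization: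
  fixes D :: "complex fps"
  assumes D0: "D $ 0 = 1" and D: "\<And>k. norm (D $ k) \<le> C * \<epsilon> ^ k" and \<epsilon>: "0 < \<epsilon>"
  obtains ms H C' where "root_poly ms = D * H" "\<And>k. norm (H $ k) \<le> C' * (4 * \<epsilon>) ^ k" "0 \<le> C'"
proof -
  define R where "R = 1 / \<epsilon>"
  have rad: "ereal R \<le> fps_conv_radius D"
    unfolding fps_conv_radius_def
  proof (rule conv_radius_geI_ex')
    fix r assume r: "0 < r" "ereal r < ereal R"
    have q: "r * \<epsilon> < 1" using r \<epsilon> by (simp add: R_def field_simps)
    have "summable (\<lambda>n. C * (r * \<epsilon>) ^ n)"
      using r \<epsilon> q by (intro summable_mult summable_geometric) auto
    then show "summable (\<lambda>n. D $ n * of_real r ^ n)"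
    proof (rule summable_comparison_test'[where N = 0])
      fix n show "norm (D $ n * of_real r ^ n) \<le> C * (r * \<epsilon>) ^ n"
        using mult_right_mono[OF D[of n], of "r ^ n"] r
        by (simp add: norm_mult norm_power power_mult_distrib mult_ac)
    qed
  qed
  define f where "f = eval_fps D"
  have R: "0 < R" using \<epsilon> by (simp add: R_def)
  have holf: "f holomorphic_on ball 0 R"
    unfolding f_def
  proof (rule holomorphic_on_eval_fps)
    show "ball 0 R \<subseteq> eball 0 (fps_conv_radius D)"
      using rad by (rule ball_eball_mono)
  qed
  have fD: "f has_fps_expansion D"
    unfolding f_def using rad R
    by (intro eval_fps_has_fps_expansion) (metis ereal_less(2) less_le_trans)
  have "f 0 = 1" by (simp add: f_def eval_fps_at_0 D0)
  moreover have q: "0 < R / 4" "3 * (R / 4) \<le> 3 * R / 4" "3 * R / 4 < R" using R by auto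
  ultimately obtain ms g where g: "g holomorphic_on ball 0 R"
    "\<And>t. t \<in> ball 0 R \<Longrightarrow> f t = (\<Prod>\<mu>\<leftarrow>ms. 1 - \<mu> * t) * g t"
    "\<And>t. t \<in> cball 0 (R/4) \<Longrightarrow> g t \<noteq> 0" "g 0 = 1"
    using root_removal[OF holf _ q(1,2,3)] by metis
  have gF: "g has_fps_expansion fps_expansion g 0"
    using g(1) R by (intro has_fps_expansion_fps_expansion[of "ball 0 R"]) auto
  define G where "G = fps_expansion g 0"
  have "f has_fps_expansion root_poly ms * G"
  proof -
    have *: "(\<lambda>t. (\<Prod>\<mu>\<leftarrow>ms. 1 - \<mu> * t) * g t) has_fps_expansion root_poly ms * G"
      using gF by (intro fps_expansion_intros has_fps_expansion_root_poly) (simp add: G_def)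
    have "\<forall>\<^sub>F t in nhds 0. t \<in> ball 0 R"
      using R by (intro eventually_nhds_in_open) auto
    then have ev: "\<forall>\<^sub>F t in nhds 0. (\<Prod>\<mu>\<leftarrow>ms. 1 - \<mu> * t) * g t = f t"
      by eventually_elim (use g(2) in auto)
    show ?thesis
      using iffD1[OF has_fps_expansion_cong[OF ev refl] *] .
  qed
  then have DG: "D = root_poly ms * G" using fD fps_expansion_unique_complex by blast
  have G0: "G $ 0 = 1"
    using g(4) fps_nth_fps_expansion[OF gF, of 0] by (simp add: G_def)
  have i1: "(\<lambda>t. inverse (g t)) has_fps_expansion inverse G"
    using gF G0 unfolding G_def by (intro fps_expansion_intros) auto
  have i2: "(\<lambda>t. inverse (g t)) holomorphic_on ball 0 (R/4)"
    using g(3) R by (intro holomorphic_intros holomorphic_on_subset[OF g(1)]) auto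
  have i3: "continuous_on (cball 0 (R/4)) (\<lambda>t. inverse (g t))"
    using g(3) R
    by (intro continuous_intros holomorphic_on_imp_continuous_on holomorphic_on_subset[OF g(1)]) auto
  obtain C' where "0 \<le> C'" "\<And>k. norm (inverse G $ k) \<le> C' * (1 / (R/4)) ^ k"
    using Cauchy_inequality_fps[OF i1 i2 i3 q(1)] by blast
  moreover have "D * inverse G = root_poly ms"
    using inverse_mult_eq_1'[of G] G0 by (simp add: DG mult.assoc)
  moreover have "1 / (R/4) = 4 * \<epsilon>" by (simp add: R_def)
  ultimately show thesis by (metis that)
qed

text \<open>A Cauchy product of two sequences of order r^k has k + 1 terms of that size; their
  number is absorbed by any larger rate.\<close>

lemma convolution_decay:
  fixes r s :: real
  assumes "0 < r" "r < s"
  obtains C where "0 \<le> C" "\<And>k. (real k + 1) * r ^ k \<le> C * s ^ k"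
proof -
  have "(\<lambda>k. (real k + 1) * (r / s) ^ k) \<longlonglongrightarrow> 0"
  proof -
    have *: "norm (r / s) < 1" using assms by simp
    have "(\<lambda>k. real k * (r / s) ^ k + (r / s) ^ k) \<longlonglongrightarrow> 0 + 0"
      using * by (intro tendsto_add powser_times_n_limit_0 LIMSEQ_power_zero) (auto)
    then show ?thesis by (simp add: algebra_simps)
  qed
  then have "Bseq (\<lambda>k. (real k + 1) * (r / s) ^ k)"
    by (intro convergent_imp_Bseq) (auto simp: convergent_def)
  then obtain C where "0 < C" "\<And>k. norm ((real k + 1) * (r / s) ^ k) \<le> C"
    unfolding Bseq_def by blast
  then have "0 \<le> C" "\<And>k. (real k + 1) * r ^ k \<le> C * s ^ k"
    using assms by (auto simp: power_divide field_simps)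
  then show thesis using that by blast
qed

section \<open>Norm limits of operators of finite rank\<close>

type_synonym ('i, 'j) family = "'i \<Rightarrow> 'j \<Rightarrow> complex"

text \<open>Vectors are functions of two arguments and the norm is only a seminorm, so that the
  representatives of the elements of the product space can be used without passing to
  classes.\<close>

unbundle no vec_syntax

locale function_space =
  fixes V :: "('i, 'j) family set" and nrm :: "('i, 'j) family \<Rightarrow> real"
  assumes zero_mem: "(\<lambda>p x. 0) \<in> V"
    and lin_mem: "u \<in> V \<Longrightarrow> v \<in> V \<Longrightarrow> (\<lambda>p x. a * u p x + v p x) \<in> V"
    and nrm_nonneg: "0 \<le> nrm u"
    and nrm_zero: "nrm (\<lambda>p x. 0) = 0"
    and nrm_lin: "u \<in> V \<Longrightarrow> v \<in> V \<Longrightarrow> nrm (\<lambda>p x. a * u p x + v p x) \<le> norm a * nrm u + nrm v"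
begin

lemma scale_mem: "u \<in> V \<Longrightarrow> (\<lambda>p x. a * u p x) \<in> V"
  using lin_mem[OF _ zero_mem, of u a] by simp

lemma add_mem: "u \<in> V \<Longrightarrow> v \<in> V \<Longrightarrow> (\<lambda>p x. u p x + v p x) \<in> V"
  using lin_mem[of u v 1] by simp

lemma diff_mem: "u \<in> V \<Longrightarrow> v \<in> V \<Longrightarrow> (\<lambda>p x. u p x - v p x) \<in> V"
  using lin_mem[of v u "-1"] by simp

lemma sum_mem: "(\<And>i. i \<in> I \<Longrightarrow> u i \<in> V) \<Longrightarrow> (\<lambda>p x. \<Sum>i\<in>I. c i * u i p x) \<in> V"
  by (induction I rule: infinite_finite_induct) (auto simp: zero_mem intro: lin_mem)

lemma nrm_scale_le: "u \<in> V \<Longrightarrow> nrm (\<lambda>p x. a * u p x) \<le> norm a * nrm u"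
  using nrm_lin[OF _ zero_mem, of u a] by (simp add: nrm_zero)

lemma nrm_add: "u \<in> V \<Longrightarrow> v \<in> V \<Longrightarrow> nrm (\<lambda>p x. u p x + v p x) \<le> nrm u + nrm v"
  using nrm_lin[of u v 1] by simp

lemma nrm_diff: "u \<in> V \<Longrightarrow> v \<in> V \<Longrightarrow> nrm (\<lambda>p x. u p x - v p x) \<le> nrm u + nrm v"
  using nrm_lin[of v u "-1"] by simp

lemma nrm_scale:
  assumes "u \<in> V" shows "nrm (\<lambda>p x. a * u p x) = norm a * nrm u"
proof (cases "a = 0")
  case False
  have "nrm (\<lambda>p x. inverse a * (a * u p x)) \<le> norm (inverse a) * nrm (\<lambda>p x. a * u p x)"
    using assms by (intro nrm_scale_le scale_mem)
  moreover have "(\<lambda>p x. inverse a * (a * u p x)) = u" using False by (simp add: field_simps)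
  ultimately show ?thesis
    using nrm_scale_le[OF assms, of a] False by (simp add: norm_inverse norm_divide field_simps)
qed (simp add: nrm_zero)

lemma nrm_sum:
  "(\<And>i. i \<in> I \<Longrightarrow> u i \<in> V) \<Longrightarrow> nrm (\<lambda>p x. \<Sum>i\<in>I. c i * u i p x) \<le> (\<Sum>i\<in>I. norm (c i) * nrm (u i))"
proof (induction I rule: infinite_finite_induct)
  case (insert i I)
  then have "nrm (\<lambda>p x. c i * u i p x + (\<Sum>i\<in>I. c i * u i p x)) \<le>
      norm (c i) * nrm (u i) + nrm (\<lambda>p x. \<Sum>i\<in>I. c i * u i p x)"
    by (intro nrm_lin sum_mem) auto
  also have "\<dots> \<le> norm (c i) * nrm (u i) + (\<Sum>i\<in>I. norm (c i) * nrm (u i))"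
    using insert by auto
  finally show ?case using insert by simp
qed (auto simp: nrm_zero)

text \<open>Linearity is an equality of representatives, not merely an equality up to seminorm 0, so
  that powers and sums can be rewritten pointwise.\<close>

definition lin_op :: "(('i, 'j) family \<Rightarrow> ('i, 'j) family) \<Rightarrow> bool" where
  "lin_op K \<longleftrightarrow> (\<forall>u\<in>V. K u \<in> V) \<and>
     (\<forall>u\<in>V. \<forall>v\<in>V. \<forall>a. K (\<lambda>p x. a * u p x + v p x) = (\<lambda>p x. a * K u p x + K v p x))"

definition functional :: "(('i, 'j) family \<Rightarrow> complex) \<Rightarrow> bool" where
  "functional \<beta> \<longleftrightarrow> (\<forall>u\<in>V. \<forall>v\<in>V. \<forall>a. \<beta> (\<lambda>p x. a * u p x + v p x) = a * \<beta> u + \<beta> v) \<and>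
     (\<exists>B\<ge>0. \<forall>u\<in>V. norm (\<beta> u) \<le> B * nrm u)"

lemma lin_opD:
  assumes "lin_op K"
  shows "u \<in> V \<Longrightarrow> K u \<in> V"
    and "u \<in> V \<Longrightarrow> v \<in> V \<Longrightarrow> K (\<lambda>p x. a * u p x + v p x) = (\<lambda>p x. a * K u p x + K v p x)"
  using assms by (auto simp: lin_op_def)

lemma lin_op_zero:
  assumes "lin_op K" shows "K (\<lambda>p x. 0) = (\<lambda>p x. 0)"
  using lin_opD(2)[OF assms zero_mem zero_mem, of 1] by (simp add: fun_eq_iff)

lemma lin_op_scale:
  assumes "lin_op K" "u \<in> V" shows "K (\<lambda>p x. a * u p x) = (\<lambda>p x. a * K u p x)"
  using lin_opD(2)[OF assms zero_mem, of a] by (simp add: lin_op_zero[OF assms(1)])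

lemma lin_op_diff:
  assumes "lin_op K" "u \<in> V" "v \<in> V"
  shows "K (\<lambda>p x. u p x - v p x) = (\<lambda>p x. K u p x - K v p x)"
  using lin_opD(2)[OF assms(1,3,2), of "-1"] by simp

lemma lin_op_sum:
  assumes "lin_op K" "\<And>i. i \<in> I \<Longrightarrow> u i \<in> V"
  shows "K (\<lambda>p x. \<Sum>i\<in>I. c i * u i p x) = (\<lambda>p x. \<Sum>i\<in>I. c i * K (u i) p x)"
  using assms(2)
  by (induction I rule: infinite_finite_induct)
     (auto simp: lin_op_zero[OF assms(1)] lin_opD[OF assms(1)] sum_mem)

lemma funpow_mem: "lin_op K \<Longrightarrow> u \<in> V \<Longrightarrow> (K ^^ k) u \<in> V"
  by (induction k) (auto simp: lin_opD)

lemma funpow_lin: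
  assumes "lin_op K" "u \<in> V" "v \<in> V"
  shows "(K ^^ k) (\<lambda>p x. a * u p x + v p x) = (\<lambda>p x. a * (K ^^ k) u p x + (K ^^ k) v p x)"
  by (induction k) (auto simp: lin_opD[OF assms(1)] funpow_mem assms)

lemma functional_sum:
  assumes "functional \<beta>" "\<And>i. i \<in> I \<Longrightarrow> u i \<in> V"
  shows "\<beta> (\<lambda>p x. \<Sum>i\<in>I. c i * u i p x) = (\<Sum>i\<in>I. c i * \<beta> (u i))"
proof -
  have lin: "u \<in> V \<Longrightarrow> v \<in> V \<Longrightarrow> \<beta> (\<lambda>p x. a * u p x + v p x) = a * \<beta> u + \<beta> v" for u v a
    using assms(1) by (simp add: functional_def)
  have "\<beta> (\<lambda>p x. 0) = 0" using lin[OF zero_mem zero_mem, of 1] by simp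
  with assms(2) show ?thesis
    by (induction I rule: infinite_finite_induct) (auto simp: lin sum_mem)
qed

subsection \<open>Orbits as power series\<close>

text \<open>The Neumann series of \<open>K\<close> at \<open>u\<close>, read off at one point.
  Taking it pointwise makes multiplication by a scalar series the ordinary product of formal power
  series.\<close>

definition orb :: "(('i, 'j) family \<Rightarrow> ('i, 'j) family) \<Rightarrow> ('i, 'j) family \<Rightarrow>
    'i \<Rightarrow> 'j \<Rightarrow> complex fps" where
  "orb K u p x = Abs_fps (\<lambda>k. (K ^^ k) u p x)"

lemma conv_orb: "(D * orb K u p x) $ k = (\<Sum>i=0..k. D $ i * (K ^^ (k - i)) u p x)"
  by (simp add: fps_mult_nth orb_def)

lemma conv_orb_mem: "lin_op K \<Longrightarrow> u \<in> V \<Longrightarrow> (\<lambda>p x. (D * orb K u p x) $ k) \<in> V"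
  unfolding conv_orb by (intro sum_mem funpow_mem)

text \<open>\<open>D\<close> plays the role of the Fredholm determinant: \<open>D(t)\<close> times the Neumann series of \<open>K\<close>
  converges for \<open>|t| < 1/r\<close>.\<close>

definition decays :: "(('i, 'j) family \<Rightarrow> ('i, 'j) family) \<Rightarrow> real \<Rightarrow> bool" where
  "decays K r \<longleftrightarrow> (\<exists>D C. D $ 0 = 1 \<and> 0 \<le> C \<and> (\<forall>k. norm (D $ k) \<le> C * r ^ k) \<and>
     (\<forall>u\<in>V. \<forall>k. nrm (\<lambda>p x. (D * orb K u p x) $ k) \<le> C * r ^ k * nrm u))"

text \<open>All k + 1 summands of the Cauchy product have the common bound
  \<open>a * b * r ^ k\<close>; \<open>M\<close>, which comes from \<open>convolution_decay\<close>,
  trades their number for the larger rate \<open>s\<close>.\<close>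

lemma conv_bound:
  assumes r: "0 < r" "r < s" and F: "\<And>k. norm (F $ k) \<le> a * r ^ k" and a: "0 \<le> a"
    and Y: "\<And>k. Y k \<in> V" "\<And>k. nrm (Y k) \<le> b * r ^ k" and b: "0 \<le> b"
    and M: "\<And>k. (real k + 1) * r ^ k \<le> M * s ^ k"
  shows "nrm (\<lambda>p x. \<Sum>i=0..k. F $ i * Y (k - i) p x) \<le> a * b * M * s ^ k"
proof -
  have "nrm (\<lambda>p x. \<Sum>i=0..k. F $ i * Y (k - i) p x) \<le> (\<Sum>i=0..k. norm (F $ i) * nrm (Y (k - i)))"
    using Y by (intro nrm_sum)
  also have "\<dots> \<le> (\<Sum>i=0..k. (a * r ^ i) * (b * r ^ (k - i)))"
    using F Y a r by (intro sum_mono mult_mono) (auto simp: nrm_nonneg)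
  also have "\<dots> = (\<Sum>i=0..k. a * b * r ^ k)"
    by (intro sum.cong) (auto simp: power_add[symmetric])
  also have "\<dots> = a * b * ((real k + 1) * r ^ k)" by simp
  also have "\<dots> \<le> a * b * (M * s ^ k)"
    using M a b by (intro mult_left_mono) auto
  finally show ?thesis by simp
qed

text \<open>Let c be the series of the numbers \<beta>(K^k u) and f the same series for K'. The
  Neumann series satisfy orb K u = orb K' u + t c orb K' a, and applying \<beta> gives c = f + t c
  f_a, where f_a is f for u = a. Multiplication by 1 - t f_a, the perturbation determinant of the
  rank one term, eliminates the unknown c, about whose growth nothing is known. One factor
  \<open>D\<close> makes f and f_a decay, a second one does the same for orb K' a.\<close>

lemma decays_rank_one:
  assumes K': "lin_op K'" and a: "a \<in> V" and \<beta>: "functional \<beta>"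
    and K: "\<And>u. u \<in> V \<Longrightarrow> K u = (\<lambda>p x. K' u p x + \<beta> u * a p x)"
    and dec: "decays K' r" and r: "0 < r" "r < s"
  shows "decays K s"
proof -
  have lin\<beta>: "u \<in> V \<Longrightarrow> v \<in> V \<Longrightarrow> \<beta> (\<lambda>p x. a * u p x + v p x) = a * \<beta> u + \<beta> v" for u v a
    using \<beta> by (simp add: functional_def)
  have Klin: "K (\<lambda>p x. c * u p x + v p x) = (\<lambda>p x. c * K u p x + K v p x)"
    if "u \<in> V" "v \<in> V" for u v c
    using that
    by (simp add: K lin_mem lin_opD(2)[OF K'] lin\<beta>) (simp add: algebra_simps)
  have Kmem: "K u \<in> V" if "u \<in> V" for u
    using that a by (simp add: K add_mem scale_mem lin_opD(1)[OF K'])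
  have linK: "lin_op K"
    unfolding lin_op_def using Klin Kmem by blast
  obtain B where B: "0 \<le> B" "\<And>u. u \<in> V \<Longrightarrow> norm (\<beta> u) \<le> B * nrm u"
    using \<beta> by (auto simp: functional_def)
  obtain D C where D0: "D $ 0 = 1" and C: "0 \<le> C" and D: "\<And>k. norm (D $ k) \<le> C * r ^ k"
    and DK: "\<And>u k. u \<in> V \<Longrightarrow> nrm (\<lambda>p x. (D * orb K' u p x) $ k) \<le> C * r ^ k * nrm u"
    using dec by (auto simp: decays_def)
  obtain M where M: "0 \<le> M" "\<And>k. (real k + 1) * r ^ k \<le> M * s ^ k"
    using convolution_decay[OF r] by blast
  define c where "c u = Abs_fps (\<lambda>k. \<beta> ((K ^^ k) u))" for u
  define f where "f u = Abs_fps (\<lambda>k. \<beta> ((K' ^^ k) u))" for u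
  \<comment> \<open>Discrete Duhamel formula: the perturbation acts at time j, and K' propagates its
    effect for the remaining k - 1 - j steps.\<close>
  have pow: "(K ^^ k) u = (\<lambda>p x. (K' ^^ k) u p x + (\<Sum>j<k. c u $ j * (K' ^^ (k - 1 - j)) a p x))"
    if u: "u \<in> V" for u k
  proof (induction k)
    case (Suc k)
    have "(K ^^ Suc k) u = (\<lambda>p x. K' ((K ^^ k) u) p x + c u $ k * a p x)"
      using K[OF funpow_mem[OF linK u]] by (simp add: c_def)
    also have "K' ((K ^^ k) u) =
        K' (\<lambda>p x. 1 * (\<Sum>j<k. c u $ j * (K' ^^ (k - 1 - j)) a p x) + (K' ^^ k) u p x)"
      using Suc by (simp add: add.commute)
    also have "\<dots> = (\<lambda>p x. (\<Sum>j<k. c u $ j * (K' ^^ (Suc k - 1 - j)) a p x) + (K' ^^ Suc k) u p x)"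
    proof -
      have "K' ((K' ^^ (k - 1 - j)) a) = (K' ^^ (Suc k - 1 - j)) a" if "j < k" for j
      proof -
        have "Suc k - 1 - j = Suc (k - 1 - j)" using that by simp
        then show ?thesis by simp
      qed
      then show ?thesis
        using u a by (subst lin_opD(2)[OF K']) (auto simp: lin_op_sum[OF K'] funpow_mem[OF K'] sum_mem)
    qed
    finally show ?case by (simp add: algebra_simps)
  qed simp
  have orbK: "orb K u p x = orb K' u p x + fps_X * (c u * orb K' a p x)" if "u \<in> V" for u p x
  proof (rule fps_ext)
    fix k show "orb K u p x $ k = (orb K' u p x + fps_X * (c u * orb K' a p x)) $ k"
      by (cases k) (auto simp: orb_def pow[OF that] fps_mult_nth[of "c u"] atLeast0AtMost lessThan_Suc_atMost)
  qed
  have cf: "c u = f u + fps_X * (c u * f a)" if u: "u \<in> V" for u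
  proof (rule fps_ext)
    fix k
    have "c u $ k = \<beta> (\<lambda>p x. 1 * (K' ^^ k) u p x + (\<Sum>j<k. c u $ j * (K' ^^ (k - 1 - j)) a p x))"
      by (subst c_def) (simp add: pow[OF u])
    also have "\<dots> = f u $ k + (\<Sum>j<k. c u $ j * f a $ (k - 1 - j))"
      using u a by (simp only: lin\<beta> functional_sum[OF \<beta>] funpow_mem[OF K'] sum_mem) (simp add: f_def)
    finally show "c u $ k = (f u + fps_X * (c u * f a)) $ k"
      by (cases k) (auto simp: fps_mult_nth[of "c u"] atLeast0AtMost lessThan_Suc_atMost)
  qed
  \<comment> \<open>Up to sign and shift these are the only scalar series that remain after c is
    gone; being \<beta> applied to \<open>D * orb K' u\<close>, they inherit its decay.\<close>
  have Df: "norm ((D * f u) $ k) \<le> B * C * nrm u * r ^ k" if u: "u \<in> V" for u k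
  proof -
    have "(D * f u) $ k = \<beta> (\<lambda>p x. (D * orb K' u p x) $ k)"
      unfolding conv_orb using u
      by (simp add: functional_sum[OF \<beta>] funpow_mem[OF K'] fps_mult_nth f_def)
    also have "norm \<dots> \<le> B * nrm (\<lambda>p x. (D * orb K' u p x) $ k)"
      using u by (intro B conv_orb_mem K')
    also have "\<dots> \<le> B * (C * r ^ k * nrm u)"
      using u B by (intro mult_left_mono DK)
    finally show ?thesis by (simp add: mult_ac)
  qed
  define D1 where "D1 = D - fps_X * (D * f a)"
  \<comment> \<open>Multiplication by \<open>fps_X\<close> moves the coefficient from index k - 1 to
    k, which costs the factor 1/r.\<close>
  define C1 where "C1 = C + B * C * nrm a / r"
  have C1: "0 \<le> C1" using C B r by (simp add: C1_def nrm_nonneg)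
  have D1: "norm (D1 $ k) \<le> C1 * r ^ k" for k
  proof (cases k)
    case 0 then show ?thesis using D[of 0] B C r by (simp add: D1_def C1_def nrm_nonneg add_increasing2)
  next
    case (Suc j)
    have "norm (D1 $ k) \<le> norm (D $ k) + norm ((D * f a) $ j)"
      unfolding D1_def Suc by (simp add: norm_triangle_ineq4)
    also have "\<dots> \<le> C * r ^ k + B * C * nrm a * r ^ j"
      using D Df[OF a] by (intro add_mono)
    also have "\<dots> = C1 * r ^ k" using r by (simp add: Suc C1_def field_simps)
    finally show ?thesis .
  qed
  have D1c: "D1 * c u = D * f u" if "u \<in> V" for u
  proof -
    have "D * c u = D * (f u + fps_X * (c u * f a))" using cf[OF that] by (rule arg_cong)
    then show ?thesis by (simp add: D1_def algebra_simps)
  qed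
  define D2 where "D2 = D1 * D"
  \<comment> \<open>Both products on the right consist of two series of order r^k, so
    \<open>conv_bound\<close> applies to each.\<close>
  have key: "(D2 * orb K u p x) = D1 * (D * orb K' u p x) + fps_X * ((D * f u) * (D * orb K' a p x))"
    if u: "u \<in> V" for u p x
  proof -
    have "D2 * orb K u p x = D1 * (D * orb K' u p x) + fps_X * ((D1 * c u) * (D * orb K' a p x))"
      by (simp add: D2_def orbK[OF u] algebra_simps)
    then show ?thesis by (simp add: D1c[OF u])
  qed
  define C2 where "C2 = C1 * C * M + B * C * (C * nrm a) * M / s"
  have s: "0 < s" using r by simp
  have C2: "0 \<le> C2" unfolding C2_def using C1 C B M s by (simp add: nrm_nonneg)
  have bound: "nrm (\<lambda>p x. (D2 * orb K u p x) $ k) \<le> C2 * s ^ k * nrm u" if u: "u \<in> V" for u k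
  proof -
    define Y where "Y v k = (\<lambda>p x. (D * orb K' v p x) $ k)" for v k
    have Yin: "Y v k \<in> V" if "v \<in> V" for v k
      using that by (simp add: Y_def conv_orb_mem[OF K'])
    have Yb: "nrm (Y v k) \<le> C * nrm v * r ^ k" if "v \<in> V" for v k
      using DK[OF that, of k] by (simp add: Y_def mult_ac)
    have 1: "nrm (\<lambda>p x. \<Sum>i=0..k. D1 $ i * Y u (k - i) p x) \<le> C1 * (C * nrm u) * M * s ^ k" for k
      using D1 C1 C u M by (intro conv_bound[OF r] Yin Yb) (auto simp: nrm_nonneg)
    have 2: "nrm (\<lambda>p x. \<Sum>i=0..k. (D * f u) $ i * Y a (k - i) p x) \<le>
        B * C * nrm u * (C * nrm a) * M * s ^ k" for k
      using Df[OF u] B C a M by (intro conv_bound[OF r] Yin Yb) (auto simp: nrm_nonneg)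
    have "nrm (\<lambda>p x. (D2 * orb K u p x) $ k) \<le> C1 * (C * nrm u) * M * s ^ k +
        B * C * nrm u * (C * nrm a) * M * s ^ k / s"
    proof (cases k)
      case 0
      have "(\<lambda>p x. (D2 * orb K u p x) $ k) = (\<lambda>p x. \<Sum>i=0..k. D1 $ i * Y u (k - i) p x)"
        by (simp add: key[OF u] 0 Y_def)
      moreover have "0 \<le> B * C * nrm u * (C * nrm a) * M * s ^ k / s"
        using B C M s by (simp add: nrm_nonneg)
      ultimately show ?thesis using 1[of k] by simp
    next
      case (Suc j)
      have eq: "(\<lambda>p x. (D2 * orb K u p x) $ k) = (\<lambda>p x. (\<Sum>i=0..k. D1 $ i * Y u (k - i) p x) +
          (\<Sum>i=0..j. (D * f u) $ i * Y a (j - i) p x))"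
        unfolding key[OF u] Suc Y_def by (simp add: fps_mult_nth[of D1] fps_mult_nth[of "D * f u"])
      have "nrm (\<lambda>p x. (D2 * orb K u p x) $ k) \<le> nrm (\<lambda>p x. \<Sum>i=0..k. D1 $ i * Y u (k - i) p x) +
          nrm (\<lambda>p x. \<Sum>i=0..j. (D * f u) $ i * Y a (j - i) p x)"
        unfolding eq using u a by (intro nrm_add sum_mem Yin)
      also have "\<dots> \<le> C1 * (C * nrm u) * M * s ^ k + B * C * nrm u * (C * nrm a) * M * s ^ j"
        by (intro add_mono 1 2)
      also have "s ^ j = s ^ k / s" using s by (simp add: Suc)
      finally show ?thesis by simp
    qed
    then show ?thesis by (simp add: C2_def algebra_simps add_divide_distrib)
  qed
  have DD: "norm (D2 $ k) \<le> C1 * C * M * s ^ k" for k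
  proof -
    have "norm (D2 $ k) \<le> (\<Sum>i=0..k. norm (D1 $ i) * norm (D $ (k - i)))"
      unfolding D2_def fps_mult_nth by (simp add: sum_norm_le norm_mult)
    also have "\<dots> \<le> (\<Sum>i=0..k. (C1 * r ^ i) * (C * r ^ (k - i)))"
      using D1 D C1 r by (intro sum_mono mult_mono) auto
    also have "\<dots> = (\<Sum>i=0..k. C1 * C * r ^ k)"
      by (intro sum.cong) (auto simp: power_add[symmetric])
    also have "\<dots> = C1 * C * ((real k + 1) * r ^ k)" by simp
    also have "\<dots> \<le> C1 * C * (M * s ^ k)"
      using M C1 C by (intro mult_left_mono) auto
    finally show ?thesis by simp
  qed
  have "C1 * C * M \<le> C2" unfolding C2_def using C B M s by (simp add: nrm_nonneg)
  then have "norm (D2 $ k) \<le> C2 * s ^ k" for k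
    using DD[of k] s by (meson mult_right_mono order_trans zero_le_power less_imp_le)
  moreover have "D2 $ 0 = 1" by (simp add: D2_def D1_def D0)
  ultimately show ?thesis
    unfolding decays_def using bound C2 by blast
qed

definition rank_list :: "(('i, 'j) family \<times> (('i, 'j) family \<Rightarrow> complex)) list \<Rightarrow> bool" where
  "rank_list as \<longleftrightarrow> (\<forall>(a, \<beta>)\<in>set as. a \<in> V \<and> functional \<beta>)"

definition approximable :: "(('i, 'j) family \<Rightarrow> ('i, 'j) family) \<Rightarrow> bool" where
  "approximable K \<longleftrightarrow> (\<forall>\<epsilon>>0. \<exists>as. rank_list as \<and>
     (\<forall>u\<in>V. nrm (\<lambda>p x. K u p x - (\<Sum>(a, \<beta>)\<leftarrow>as. \<beta> u * a p x)) \<le> \<epsilon> * nrm u))"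

text \<open>Subtracting the first term of rank one leaves an operator with a shorter list. With no
  terms left, \<open>K\<close> itself has norm at most \<epsilon> and \<open>D = 1\<close> will do.
  Every restored term loses a little of the rate, hence the intermediate r' between \<epsilon> and
  r.\<close>

lemma decays_finite_rank:
  assumes "lin_op K" "rank_list as" "0 < \<epsilon>" "\<epsilon> < r"
    and "\<And>u. u \<in> V \<Longrightarrow> nrm (\<lambda>p x. K u p x - (\<Sum>(a, \<beta>)\<leftarrow>as. \<beta> u * a p x)) \<le> \<epsilon> * nrm u"
  shows "decays K r"
  using assms
proof (induction as arbitrary: K r)
  case Nil
  have pow: "nrm ((K ^^ k) u) \<le> \<epsilon> ^ k * nrm u" if "u \<in> V" for u k
  proof (induction k)
    case (Suc k)
    have "nrm ((K ^^ Suc k) u) \<le> \<epsilon> * nrm ((K ^^ k) u)"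
      using Nil that by (simp add: funpow_mem)
    also have "\<dots> \<le> \<epsilon> * (\<epsilon> ^ k * nrm u)" using Suc Nil by (intro mult_left_mono) auto
    finally show ?case by simp
  qed simp
  have "nrm (\<lambda>p x. (1 * orb K u p x) $ k) \<le> 1 * r ^ k * nrm u" if "u \<in> V" for u k
  proof -
    have "nrm ((K ^^ k) u) \<le> r ^ k * nrm u"
      using pow[OF that, of k] Nil power_mono[of \<epsilon> r k] mult_right_mono[OF _ nrm_nonneg[of u]]
      by (smt (verit))
    then show ?thesis by (simp add: orb_def)
  qed
  moreover have "norm ((1::complex fps) $ k) \<le> 1 * r ^ k" for k using Nil by auto
  ultimately show ?case unfolding decays_def by (intro exI[of _ "1::complex fps"] exI[of _ 1]) auto
next
  case (Cons a\<beta> as)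
  obtain a \<beta> where ab: "a\<beta> = (a, \<beta>)" by force
  have a: "a \<in> V" and \<beta>: "functional \<beta>" and as: "rank_list as"
    using Cons.prems by (auto simp: rank_list_def ab)
  have lin\<beta>: "u \<in> V \<Longrightarrow> v \<in> V \<Longrightarrow> \<beta> (\<lambda>p x. c * u p x + v p x) = c * \<beta> u + \<beta> v" for u v c
    using \<beta> by (simp add: functional_def)
  define K' where "K' u = (\<lambda>p x. K u p x - \<beta> u * a p x)" for u
  have lin: "K' (\<lambda>p x. c * u p x + v p x) = (\<lambda>p x. c * K' u p x + K' v p x)"
    if "u \<in> V" "v \<in> V" for u v c
    using that unfolding K'_def
    by (simp add: lin_opD(2)[OF Cons.prems(1)] lin\<beta>) (simp add: algebra_simps)
  have mem: "K' u \<in> V" if "u \<in> V" for u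
    using that a unfolding K'_def by (simp add: diff_mem scale_mem lin_opD(1)[OF Cons.prems(1)])
  have K': "lin_op K'"
    unfolding lin_op_def using lin mem by blast
  obtain r' where r': "\<epsilon> < r'" "r' < r" using Cons.prems dense by blast
  have "decays K' r'"
    using Cons.prems r' by (intro Cons.IH[OF K' as]) (auto simp: K'_def ab diff_diff_eq)
  then show ?case
    by (rule decays_rank_one[OF K' a \<beta>, rotated]) (use r' Cons.prems in \<open>auto simp: K'_def\<close>)
qed

lemma approximable_decays:
  assumes "lin_op K" "approximable K" "0 < r"
  shows "decays K r"
proof -
  have "\<exists>as. rank_list as \<and>
      (\<forall>u\<in>V. nrm (\<lambda>p x. K u p x - (\<Sum>(a, \<beta>)\<leftarrow>as. \<beta> u * a p x)) \<le> r / 2 * nrm u)"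
    by (rule assms(2)[unfolded approximable_def, THEN spec, THEN mp]) (use assms(3) in simp)
  then obtain as where "rank_list as"
    "\<forall>u\<in>V. nrm (\<lambda>p x. K u p x - (\<Sum>(a, \<beta>)\<leftarrow>as. \<beta> u * a p x)) \<le> r / 2 * nrm u"
    by blast
  then show ?thesis using assms by (intro decays_finite_rank[of K as "r/2" r]) auto
qed

subsection \<open>Products of shifted operators\<close>

primrec prod_op :: "(('i, 'j) family \<Rightarrow> ('i, 'j) family) \<Rightarrow> complex list \<Rightarrow>
    ('i, 'j) family \<Rightarrow> 'i \<Rightarrow> 'j \<Rightarrow> complex" where
  "prod_op K [] u = u"
| "prod_op K (\<mu> # ms) u = (\<lambda>p x. K (prod_op K ms u) p x - \<mu> * prod_op K ms u p x)"

definition bounded_op :: "(('i, 'j) family \<Rightarrow> ('i, 'j) family) \<Rightarrow> bool" where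
  "bounded_op K \<longleftrightarrow> (\<exists>B\<ge>0. \<forall>u\<in>V. nrm (K u) \<le> B * nrm u)"

text \<open>Expresses that, once the components belonging to the roots in \<open>ms\<close> are
  annihilated, the powers of \<open>K\<close> decay at rate r with a constant uniform in the
  starting vector.\<close>

definition root_decay :: "(('i, 'j) family \<Rightarrow> ('i, 'j) family) \<Rightarrow> complex list \<Rightarrow> real \<Rightarrow> bool"
  where "root_decay K ms r \<longleftrightarrow>
    (\<exists>C\<ge>0. \<forall>u\<in>V. \<forall>k. nrm ((K ^^ k) (prod_op K ms u)) \<le> C * r ^ k * nrm u)"

definition eigenvalue :: "(('i, 'j) family \<Rightarrow> ('i, 'j) family) \<Rightarrow> complex \<Rightarrow> bool" where
  "eigenvalue K \<mu> \<longleftrightarrow> (\<exists>u\<in>V. nrm u \<noteq> 0 \<and> nrm (\<lambda>p x. K u p x - \<mu> * u p x) = 0)"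

text \<open>A substitute for completeness of \<open>V\<close>: a Cauchy sequence has to converge
  only after \<open>K\<close> is applied. For integral operators with continuous kernel this limit
  is a uniform one and can be taken pointwise.\<close>

definition complete_range :: "(('i, 'j) family \<Rightarrow> ('i, 'j) family) \<Rightarrow> bool" where
  "complete_range K \<longleftrightarrow> (\<forall>w. (\<forall>n. w n \<in> V) \<and>
     (\<forall>e>0. \<exists>N. \<forall>n\<ge>N. \<forall>j. nrm (\<lambda>p x. w (n + j) p x - w n p x) < e) \<longrightarrow>
     (\<exists>v\<in>V. (\<lambda>n. nrm (\<lambda>p x. K (w n) p x - v p x)) \<longlonglongrightarrow> 0))"

lemma shift_mem:
  assumes "lin_op K" "u \<in> V" shows "(\<lambda>p x. K u p x - \<mu> * u p x) \<in> V"
  using assms by (intro diff_mem scale_mem lin_opD(1)[OF assms(1)])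

lemma prod_op_mem: "lin_op K \<Longrightarrow> u \<in> V \<Longrightarrow> prod_op K ms u \<in> V"
  by (induction ms) (auto intro: shift_mem)

lemma prod_op_append: "prod_op K (ks @ ms) u = prod_op K ks (prod_op K ms u)"
  by (induction ks) auto

lemma funpow_shift:
  assumes "lin_op K" "u \<in> V"
  shows "(K ^^ k) (\<lambda>p x. K u p x - \<mu> * u p x) = (\<lambda>p x. (K ^^ Suc k) u p x - \<mu> * (K ^^ k) u p x)"
  using funpow_lin[OF assms lin_opD(1)[OF assms], of k "- \<mu>"]
  by (simp add: funpow_swap1)

lemma prod_op_swap:
  assumes K: "lin_op K" and u: "u \<in> V"
  shows "prod_op K (\<kappa> # \<mu> # ms) u = prod_op K (\<mu> # \<kappa> # ms) u"
proof -
  define v where "v = prod_op K ms u"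
  have v: "v \<in> V" using u by (simp add: v_def prod_op_mem[OF K])
  have "K (\<lambda>p x. K v p x - \<alpha> * v p x) = (\<lambda>p x. K (K v) p x - \<alpha> * K v p x)" for \<alpha>
    using v by (simp add: lin_op_diff[OF K] lin_op_scale[OF K] scale_mem lin_opD(1)[OF K])
  then show ?thesis by (simp add: v_def[symmetric] algebra_simps)
qed

lemma prod_op_move:
  assumes K: "lin_op K" and u: "u \<in> V"
  shows "prod_op K (ks @ \<mu> # ms) u = prod_op K (\<mu> # ks @ ms) u"
proof (induction ks)
  case (Cons \<kappa> ks)
  have "prod_op K ((\<kappa> # ks) @ \<mu> # ms) u = prod_op K (\<kappa> # \<mu> # ks @ ms) u"
    using Cons by simp
  then show ?case using prod_op_swap[OF K u, of \<kappa> \<mu> "ks @ ms"] by simp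
qed simp

lemma prod_op_commute:
  assumes K: "lin_op K" and u: "u \<in> V"
  shows "prod_op K (ks @ ms) u = prod_op K (ms @ ks) u"
proof (induction ks)
  case (Cons \<kappa> ks)
  have "prod_op K ((\<kappa> # ks) @ ms) u = prod_op K (\<kappa> # ms @ ks) u" using Cons by simp
  then show ?case by (simp only: prod_op_move[OF K u])
qed simp

lemma prod_op_bounded:
  assumes K: "lin_op K" and bK: "bounded_op K"
  obtains B where "0 \<le> B" "\<And>u. u \<in> V \<Longrightarrow> nrm (prod_op K ms u) \<le> B * nrm u"
proof -
  note K = K bK
  obtain B where B: "0 \<le> B" "\<And>u. u \<in> V \<Longrightarrow> nrm (K u) \<le> B * nrm u"
    using bK by (auto simp: bounded_op_def)
  have "\<exists>C\<ge>0. \<forall>u\<in>V. nrm (prod_op K ms u) \<le> C * nrm u"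
  proof (induction ms)
    case (Cons \<mu> ms)
    then obtain C where C: "0 \<le> C" "\<And>u. u \<in> V \<Longrightarrow> nrm (prod_op K ms u) \<le> C * nrm u" by auto
    have "nrm (prod_op K (\<mu> # ms) u) \<le> (B + norm \<mu>) * C * nrm u" if u: "u \<in> V" for u
    proof -
      let ?v = "prod_op K ms u"
      have v: "?v \<in> V" using u K by (simp add: prod_op_mem)
      have "nrm (prod_op K (\<mu> # ms) u) \<le> nrm (K ?v) + nrm (\<lambda>p x. \<mu> * ?v p x)"
        using v by (simp add: nrm_diff scale_mem lin_opD(1)[OF K(1)])
      also have "\<dots> \<le> B * nrm ?v + norm \<mu> * nrm ?v"
        using v by (intro add_mono B nrm_scale_le)
      also have "\<dots> = (B + norm \<mu>) * nrm ?v" by (simp add: algebra_simps)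
      also have "\<dots> \<le> (B + norm \<mu>) * (C * nrm u)"
        using B C u by (intro mult_left_mono) auto
      finally show ?thesis by simp
    qed
    then show ?case using B C by (intro exI[of _ "(B + norm \<mu>) * C"]) auto
  qed (auto intro: exI[of _ 1])
  then show thesis using that by blast
qed

text \<open>Multiplying the series of a sequence u_k by 1 - \<mu> t produces u_(k+1) - \<mu> u_k at
  index k + 1, which is \<open>K - \<mu>\<close> applied to u_k when the sequence is an orbit. The
  shift by \<open>length ms\<close> skips the initial coefficients, where predecessors are
  missing.\<close>

lemma root_poly_orb:
  assumes K: "lin_op K" and u: "u \<in> V"
  shows "(root_poly ms * orb K u p x) $ (k + length ms) = (K ^^ k) (prod_op K ms u) p x"
proof (induction ms arbitrary: k)
  case Nil then show ?case by (simp add: orb_def)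
next
  case (Cons \<mu> ms)
  have "root_poly (\<mu> # ms) * orb K u p x =
      root_poly ms * orb K u p x - fps_const \<mu> * (fps_X * (root_poly ms * orb K u p x))"
    by (simp add: root_poly_Cons algebra_simps)
  then have "(root_poly (\<mu> # ms) * orb K u p x) $ (k + length (\<mu> # ms)) =
      (root_poly ms * orb K u p x) $ (Suc k + length ms) - \<mu> * (root_poly ms * orb K u p x) $ (k + length ms)"
    by simp
  then show ?case
    using funpow_shift[OF K prod_op_mem[OF K u, of ms], of k \<mu>] Cons[of k] Cons[of "Suc k"] by simp
qed

text \<open>The factorisation of \<open>root_poly ms\<close> as \<open>D * H\<close> lets the
  product with the orbit be regrouped as H times a series that decays, and
  \<open>root_poly_orb\<close> reads the result as a statement about \<open>prod_op\<close>.\<close>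

lemma approximable_root_decay:
  assumes K: "lin_op K" "approximable K" and r: "0 < r"
  obtains ms where "root_decay K ms r"
proof -
  \<comment> \<open>The rate grows by the factor 4 in the factorisation and by the factor 2 in the
    Cauchy product.\<close>
  define \<epsilon> where "\<epsilon> = r / 8"
  have \<epsilon>: "0 < \<epsilon>" "4 * \<epsilon> = r / 2" using r by (auto simp: \<epsilon>_def)
  obtain D C where D0: "D $ 0 = 1" and C: "0 \<le> C" and D: "\<And>k. norm (D $ k) \<le> C * \<epsilon> ^ k"
    and DK: "\<And>u k. u \<in> V \<Longrightarrow> nrm (\<lambda>p x. (D * orb K u p x) $ k) \<le> C * \<epsilon> ^ k * nrm u"
    using approximable_decays[OF K \<epsilon>(1)] by (auto simp: decays_def)
  obtain ms H C' where H: "root_poly ms = D * H" "\<And>k. norm (H $ k) \<le> C' * (r / 2) ^ k" "0 \<le> C'"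
    using fps_root_factorization[OF D0 D \<epsilon>(1)] unfolding \<epsilon>(2) by blast
  obtain M where M: "0 \<le> M" "\<And>k. (real k + 1) * (r / 2) ^ k \<le> M * r ^ k"
    using convolution_decay[of "r / 2" r] r by auto
  define n where "n = length ms"
  have "nrm ((K ^^ k) (prod_op K ms u)) \<le> C' * C * M * r ^ n * r ^ k * nrm u" if u: "u \<in> V" for u k
  proof -
    define Y where "Y j = (\<lambda>p x. (D * orb K u p x) $ j)" for j
    have Y: "Y j \<in> V" "nrm (Y j) \<le> C * nrm u * (r / 2) ^ j" for j
    proof -
      show "Y j \<in> V" using u K by (simp add: Y_def conv_orb_mem)
      have "C * \<epsilon> ^ j * nrm u \<le> C * (r / 2) ^ j * nrm u"
        using C \<epsilon> by (intro mult_right_mono mult_left_mono power_mono) (auto simp: nrm_nonneg)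
      then show "nrm (Y j) \<le> C * nrm u * (r / 2) ^ j"
        using DK[OF u, of j] by (simp add: Y_def mult_ac)
    qed
    have "(K ^^ k) (prod_op K ms u) = (\<lambda>p x. \<Sum>i=0..k+n. H $ i * Y (k + n - i) p x)"
    proof (intro ext)
      fix p x
      have "(K ^^ k) (prod_op K ms u) p x = (H * (D * orb K u p x)) $ (k + n)"
        using root_poly_orb[OF K(1) u, of ms p x k] by (simp add: n_def H(1) mult_ac)
      then show "(K ^^ k) (prod_op K ms u) p x = (\<Sum>i=0..k+n. H $ i * Y (k + n - i) p x)"
        by (simp add: fps_mult_nth[of H] Y_def)
    qed
    then have "nrm ((K ^^ k) (prod_op K ms u)) \<le> C' * (C * nrm u) * M * r ^ (k + n)"
      using r H C M Y by (auto intro!: conv_bound[of "r / 2"] simp: nrm_nonneg)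
    then show ?thesis by (simp add: power_add mult_ac)
  qed
  moreover have "0 \<le> C' * C * M * r ^ n" using C H M r by simp
  ultimately have "root_decay K ms r" unfolding root_decay_def by blast
  then show thesis by (rule that)
qed

lemma root_decay_cong:
  assumes "root_decay K ms r" "\<And>u. u \<in> V \<Longrightarrow> prod_op K ms u = prod_op K ls u"
  shows "root_decay K ls r"
  using assms by (simp add: root_decay_def)

text \<open>The list \<open>ks\<close> collects the roots already kept. Since the factors commute,
  the next root of \<open>ms\<close> can be brought to the front, where \<open>drop\<close>
  applies.\<close>

lemma root_decay_filter:
  assumes K: "lin_op K"
    and drop: "\<And>\<mu> ls. \<mu> \<in> set ms \<Longrightarrow> \<not> P \<mu> \<Longrightarrow> root_decay K (\<mu> # ls) r \<Longrightarrow> root_decay K ls r"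
    and "root_decay K (ks @ ms) r"
  shows "root_decay K (ks @ filter P ms) r"
  using assms(2,3)
proof (induction ms arbitrary: ks)
  case (Cons \<mu> ms)
  show ?case
  proof (cases "P \<mu>")
    case True
    then show ?thesis using Cons.IH[of "ks @ [\<mu>]"] Cons.prems by auto
  next
    case False
    have "root_decay K (\<mu> # ks @ ms) r"
      using Cons.prems(2) by (rule root_decay_cong) (rule prod_op_move[OF K])
    then have dec: "root_decay K (ks @ ms) r" by (rule Cons.prems(1)[of \<mu>, rotated 2]) (use False in auto)
    have "root_decay K (ks @ filter P ms) r"
      by (rule Cons.IH[OF _ dec], rule Cons.prems(1)) auto
    then show ?thesis using False by simp
  qed
qed simp

text \<open>The only solution of the recurrence that does not grow like \<open>\<mu>\<^sup>k\<close> is as small as the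
  right-hand side.\<close>

lemma backward_recurrence:
  assumes e: "\<And>k. e k \<in> V" and r: "0 < r" "r < norm \<mu>"
    and rec: "\<And>k. nrm (\<lambda>p x. e (Suc k) p x - \<mu> * e k p x) \<le> c * r ^ k"
    and lim: "(\<lambda>n. nrm (e n) / norm \<mu> ^ n) \<longlonglongrightarrow> 0"
  shows "nrm (e k) \<le> c / (norm \<mu> - r) * r ^ k"
proof -
  \<comment> \<open>The value for which d r^k turns the recurrence inequality into a homogeneous
    one: the difference of \<open>nrm (e k)\<close> and d r^k grows at least by the factor |\<mu>|
    in each step.\<close>
  define d where "d = c / (norm \<mu> - r)"
  have d: "d * (norm \<mu> - r) = c" using r by (simp add: d_def)
  have c: "0 \<le> c" using order_trans[OF nrm_nonneg rec[of 0]] by simp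
  then have d0: "0 \<le> d" using r by (simp add: d_def)
  have step: "norm \<mu> * (nrm (e k) - d * r ^ k) \<le> nrm (e (Suc k)) - d * r ^ Suc k" for k
  proof -
    have "norm \<mu> * nrm (e k) = nrm (\<lambda>p x. \<mu> * e k p x)"
      using e by (simp add: nrm_scale)
    also have "\<dots> = nrm (\<lambda>p x. e (Suc k) p x - (e (Suc k) p x - \<mu> * e k p x))" by simp
    also have "\<dots> \<le> nrm (e (Suc k)) + nrm (\<lambda>p x. e (Suc k) p x - \<mu> * e k p x)"
      using e by (intro nrm_diff diff_mem scale_mem)
    also have "\<dots> \<le> nrm (e (Suc k)) + c * r ^ k" using rec by simp
    finally have "norm \<mu> * nrm (e k) \<le> nrm (e (Suc k)) + d * (norm \<mu> - r) * r ^ k" by (simp add: d)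
    then show ?thesis by (simp add: algebra_simps)
  qed
  have bd: "nrm (e k) - d * r ^ k \<le> nrm (e (n + k)) / norm \<mu> ^ n" for n
  proof -
    have "norm \<mu> ^ n * (nrm (e k) - d * r ^ k) \<le> nrm (e (n + k)) - d * r ^ (n + k)"
    proof (induction n)
      case (Suc n)
      have "norm \<mu> ^ Suc n * (nrm (e k) - d * r ^ k) \<le> norm \<mu> * (nrm (e (n + k)) - d * r ^ (n + k))"
        using mult_left_mono[OF Suc, of "norm \<mu>"] by (simp add: mult_ac)
      also note step
      finally show ?case by simp
    qed simp
    also have "\<dots> \<le> nrm (e (n + k))" using d0 r by simp
    finally have "norm \<mu> ^ n * (nrm (e k) - d * r ^ k) \<le> nrm (e (n + k))" .
    moreover have "0 < norm \<mu> ^ n" using r by (intro zero_less_power) linarith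
    ultimately show ?thesis by (simp add: pos_le_divide_eq mult.commute)
  qed
  have lim': "(\<lambda>n. nrm (e (n + k)) / norm \<mu> ^ n) \<longlonglongrightarrow> 0"
  proof -
    have "(\<lambda>n. norm \<mu> ^ k * (nrm (e (n + k)) / norm \<mu> ^ (n + k))) \<longlonglongrightarrow> norm \<mu> ^ k * 0"
      by (intro tendsto_intros LIMSEQ_ignore_initial_segment[OF lim])
    moreover have "norm \<mu> ^ k * (nrm (e (n + k)) / norm \<mu> ^ (n + k)) = nrm (e (n + k)) / norm \<mu> ^ n" for n
      using r by (auto simp: power_add)
    ultimately show ?thesis by simp
  qed
  have "nrm (e k) - d * r ^ k \<le> 0"
    by (rule LIMSEQ_le_const[OF lim']) (use bd in blast)
  then show ?thesis by (simp add: d_def)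
qed

lemma root_decay_ConsD:
  assumes K: "lin_op K" and u: "u \<in> V"
    and C: "nrm ((K ^^ k) (prod_op K (\<mu> # ls) u)) \<le> C"
  shows "nrm (\<lambda>p x. (K ^^ Suc k) (prod_op K ls u) p x - \<mu> * (K ^^ k) (prod_op K ls u) p x) \<le> C"
  using C funpow_shift[OF K prod_op_mem[OF K u]] by simp

text \<open>Without the factor for \<mu> the orbit e_k satisfies e_(k+1) = \<mu> e_k up to an error
  of order r^k with r < |\<mu>|. Hence e_k / \<mu>^k is a Cauchy sequence, and its limit y satisfies
  K y = \<mu> y. As \<mu> is no eigenvalue, y has norm 0, so the orbit grows slower than |\<mu>|^k
  and \<open>backward_recurrence\<close> brings it down to the rate r.\<close>

lemma drop_root_not_eigenvalue:
  assumes K: "lin_op K" "bounded_op K" "complete_range K" and "\<not> eigenvalue K \<mu>"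
    and r: "0 < r" "r < norm \<mu>" and dec: "root_decay K (\<mu> # ls) r"
  shows "root_decay K ls r"
proof -
  obtain C where C: "0 \<le> C"
    "\<And>u k. u \<in> V \<Longrightarrow> nrm ((K ^^ k) (prod_op K (\<mu> # ls) u)) \<le> C * r ^ k * nrm u"
    using dec by (auto simp: root_decay_def)
  obtain B where B: "0 \<le> B" "\<And>u. u \<in> V \<Longrightarrow> nrm (K u) \<le> B * nrm u"
    using K by (auto simp: bounded_op_def)
  have \<mu>: "\<mu> \<noteq> 0" using r by auto
  have "nrm ((K ^^ k) (prod_op K ls u)) \<le> C * nrm u / (norm \<mu> - r) * r ^ k" if u: "u \<in> V" for u k
  proof -
    define e where "e k = (K ^^ k) (prod_op K ls u)" for k
    have e: "e k \<in> V" for k using u K by (simp add: e_def funpow_mem prod_op_mem)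
    have rec: "nrm (\<lambda>p x. e (Suc k) p x - \<mu> * e k p x) \<le> C * nrm u * r ^ k" for k
      unfolding e_def using C(2)[OF u, of k]
      by (intro root_decay_ConsD K u) (simp add: mult_ac)
    define w where "w k = (\<lambda>p x. inverse \<mu> ^ k * e k p x)" for k
    have w: "w k \<in> V" for k using e by (simp add: w_def scale_mem)
    have nw: "nrm (w k) = nrm (e k) / norm \<mu> ^ k" for k
      using e by (simp add: w_def nrm_scale norm_power norm_inverse divide_inverse power_inverse)
    define q where "q = r / norm \<mu>"
    have q: "0 < q" "q < 1" using r \<mu> by (auto simp: q_def)
    define c where "c = C * nrm u / norm \<mu>"
    have c: "0 \<le> c" using C by (simp add: c_def nrm_nonneg)
    have dw: "nrm (\<lambda>p x. w (Suc k) p x - w k p x) \<le> c * q ^ k" for k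
    proof -
      have eq: "(\<lambda>p x. w (Suc k) p x - w k p x) = (\<lambda>p x. inverse \<mu> ^ Suc k * (e (Suc k) p x - \<mu> * e k p x))"
        using \<mu> by (simp add: w_def field_simps)
      have "nrm (\<lambda>p x. w (Suc k) p x - w k p x) =
          norm (inverse \<mu> ^ Suc k) * nrm (\<lambda>p x. e (Suc k) p x - \<mu> * e k p x)"
        unfolding eq using e by (intro nrm_scale diff_mem scale_mem)
      also have "\<dots> \<le> norm (inverse \<mu> ^ Suc k) * (C * nrm u * r ^ k)"
        by (intro mult_left_mono rec) auto
      also have "\<dots> = c * q ^ k"
        using \<mu> by (simp add: c_def q_def norm_power norm_inverse norm_mult norm_divide power_divide field_simps)
      finally show ?thesis .
    qed
    have cau: "nrm (\<lambda>p x. w (n + j) p x - w n p x) \<le> c / (1 - q) * q ^ n" for n j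
    proof -
      \<comment> \<open>The partial geometric sum is kept in the form 1 - q^j so that the induction
        closes.\<close>
      have "nrm (\<lambda>p x. w (n + j) p x - w n p x) \<le> c / (1 - q) * q ^ n * (1 - q ^ j)"
      proof (induction j)
        case 0 then show ?case by (simp add: nrm_zero)
      next
        case (Suc j)
        have "nrm (\<lambda>p x. w (n + Suc j) p x - w n p x) =
            nrm (\<lambda>p x. (w (Suc (n + j)) p x - w (n + j) p x) + (w (n + j) p x - w n p x))" by simp
        also have "\<dots> \<le> nrm (\<lambda>p x. w (Suc (n + j)) p x - w (n + j) p x) +
            nrm (\<lambda>p x. w (n + j) p x - w n p x)"
          using w by (intro nrm_add diff_mem)
        also have "\<dots> \<le> c * q ^ (n + j) + c / (1 - q) * q ^ n * (1 - q ^ j)"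
          by (intro add_mono dw Suc)
        also have "\<dots> = c / (1 - q) * q ^ n * (1 - q ^ Suc j)"
          using q by (simp add: divide_simps power_add) (simp add: algebra_simps)
        finally show ?case .
      qed
      also have "\<dots> \<le> c / (1 - q) * q ^ n * 1"
        using c q by (intro mult_left_mono) auto
      finally show ?thesis by simp
    qed
    have "\<exists>N. \<forall>n\<ge>N. \<forall>j. nrm (\<lambda>p x. w (n + j) p x - w n p x) < \<epsilon>" if "\<epsilon> > 0" for \<epsilon>
    proof -
      have "(\<lambda>n. c / (1 - q) * q ^ n) \<longlonglongrightarrow> c / (1 - q) * 0"
        using q by (intro tendsto_intros LIMSEQ_power_zero) auto
      then have "\<forall>\<^sub>F n in sequentially. c / (1 - q) * q ^ n < \<epsilon>"
        using that by (intro order_tendstoD) auto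
      then show ?thesis
        unfolding eventually_sequentially using cau by (meson le_less_trans)
    qed
    then obtain v where v: "v \<in> V" and lim: "(\<lambda>n. nrm (\<lambda>p x. K (w n) p x - v p x)) \<longlonglongrightarrow> 0"
      using K(3) w unfolding complete_range_def by blast
    \<comment> \<open>Applying \<open>K\<close> to w_n gives \<mu> w_(n+1), so the limit v of the
      images provided by \<open>complete_range\<close> yields v/\<mu> as the limit of the w_n
      themselves.\<close>
    define y where "y = (\<lambda>p x. inverse \<mu> * v p x)"
    have y: "y \<in> V" using v by (simp add: y_def scale_mem)
    have Kw: "K (w n) = (\<lambda>p x. \<mu> * w (Suc n) p x)" for n
      using \<mu> e[of n] by (simp add: w_def lin_op_scale[OF K(1)] fun_eq_iff) (simp add: e_def field_simps)
    have "(\<lambda>n. nrm (\<lambda>p x. w (Suc n) p x - y p x)) \<longlonglongrightarrow> norm (inverse \<mu>) * 0"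
    proof -
      have "(\<lambda>p x. w (Suc n) p x - y p x) = (\<lambda>p x. inverse \<mu> * (K (w n) p x - v p x))" for n
        using \<mu> by (simp add: Kw y_def field_simps)
      then have "nrm (\<lambda>p x. w (Suc n) p x - y p x) = norm (inverse \<mu>) * nrm (\<lambda>p x. K (w n) p x - v p x)" for n
        using w v K by (simp add: nrm_scale diff_mem lin_opD(1)[OF K(1)])
      then show ?thesis using lim by (simp only:) (intro tendsto_intros)
    qed
    then have limy: "(\<lambda>n. nrm (\<lambda>p x. w n p x - y p x)) \<longlonglongrightarrow> 0"
      by (simp add: filterlim_sequentially_Suc[of "\<lambda>n. nrm (\<lambda>p x. w n p x - y p x)"])
    have bd: "nrm (\<lambda>p x. K y p x - \<mu> * y p x) \<le>
        B * nrm (\<lambda>p x. w n p x - y p x) + nrm (\<lambda>p x. K (w n) p x - v p x)" for n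
    proof -
      have eq: "(\<lambda>p x. K y p x - \<mu> * y p x) = (\<lambda>p x. (K (w n) p x - v p x) - K (\<lambda>p x. w n p x - y p x) p x)"
        using w y \<mu> by (simp add: lin_op_diff[OF K(1)]) (simp add: y_def mult.assoc[symmetric])
      have "nrm (\<lambda>p x. K y p x - \<mu> * y p x) \<le> nrm (\<lambda>p x. K (w n) p x - v p x) + nrm (K (\<lambda>p x. w n p x - y p x))"
        unfolding eq using w y v by (intro nrm_diff diff_mem lin_opD(1)[OF K(1)])
      also have "\<dots> \<le> nrm (\<lambda>p x. K (w n) p x - v p x) + B * nrm (\<lambda>p x. w n p x - y p x)"
        using w y by (intro add_left_mono B diff_mem)
      finally show ?thesis by simp
    qed
    have lim': "(\<lambda>n. B * nrm (\<lambda>p x. w n p x - y p x) + nrm (\<lambda>p x. K (w n) p x - v p x))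
        \<longlonglongrightarrow> B * 0 + 0"
      by (intro tendsto_intros limy lim)
    have "nrm (\<lambda>p x. K y p x - \<mu> * y p x) \<le> B * 0 + 0"
      by (rule LIMSEQ_le_const[OF lim']) (use bd in blast)
    then have "nrm y = 0"
      using \<open>\<not> eigenvalue K \<mu>\<close> y nrm_nonneg[of "\<lambda>p x. K y p x - \<mu> * y p x"]
      by (auto simp: eigenvalue_def)
    then have "nrm (w n) \<le> nrm (\<lambda>p x. w n p x - y p x)" for n
      using nrm_add[OF diff_mem[OF w[of n] y] y] by simp
    then have "(\<lambda>n. nrm (w n)) \<longlonglongrightarrow> 0"
      by (intro tendsto_sandwich[OF _ _ tendsto_const limy]) (auto simp: nrm_nonneg)
    then have "(\<lambda>n. nrm (e n) / norm \<mu> ^ n) \<longlonglongrightarrow> 0" by (simp add: nw)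
    then have "nrm (e k) \<le> C * nrm u / (norm \<mu> - r) * r ^ k"
      by (intro backward_recurrence[where \<mu> = \<mu>] e r rec)
    then show ?thesis by (simp add: e_def)
  qed
  moreover have "0 \<le> C / (norm \<mu> - r)" using C r by simp
  ultimately show ?thesis
    unfolding root_decay_def by (intro exI[of _ "C / (norm \<mu> - r)"]) (simp add: mult_ac)
qed

text \<open>Here the recurrence e_(k+1) = \<mu> e_k + O(r^k) is solved forwards: for |\<mu>| < r the
  homogeneous part is dominated by the rate r.\<close>

lemma drop_small_root:
  assumes K: "lin_op K" "bounded_op K" and r: "norm \<mu> < r" and dec: "root_decay K (\<mu> # ls) r"
  shows "root_decay K ls r"
proof -
  obtain C where C: "0 \<le> C"
    "\<And>u k. u \<in> V \<Longrightarrow> nrm ((K ^^ k) (prod_op K (\<mu> # ls) u)) \<le> C * r ^ k * nrm u"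
    using dec by (auto simp: root_decay_def)
  obtain B where B: "0 \<le> B" "\<And>u. u \<in> V \<Longrightarrow> nrm (prod_op K ls u) \<le> B * nrm u"
    using prod_op_bounded[OF K] by blast
  have r0: "0 < r" using r norm_ge_zero[of \<mu>] by linarith
  \<comment> \<open>The summand \<open>B\<close> starts the induction; the other one gives C +
    |\<mu>| d \<le> d r, which carries it on.\<close>
  define d where "d = B + C / (r - norm \<mu>)"
  have d: "0 \<le> d" "B \<le> d" using B C r by (auto simp: d_def)
  have "0 \<le> B * (r - norm \<mu>)" using B r by simp
  moreover have "d * (r - norm \<mu>) = B * (r - norm \<mu>) + C" using r by (simp add: d_def field_simps)
  ultimately have dC: "C \<le> d * (r - norm \<mu>)" by simp
  have "nrm ((K ^^ k) (prod_op K ls u)) \<le> d * r ^ k * nrm u" if u: "u \<in> V" for u k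
  proof (induction k)
    case 0
    show ?case using B(2)[OF u] mult_right_mono[OF d(2) nrm_nonneg[of u]] by simp
  next
    case (Suc k)
    define e where "e k = (K ^^ k) (prod_op K ls u)" for k
    have e: "e k \<in> V" for k using u K by (simp add: e_def funpow_mem prod_op_mem)
    have rec: "nrm (\<lambda>p x. e (Suc k) p x - \<mu> * e k p x) \<le> C * r ^ k * nrm u" for k
      unfolding e_def by (intro root_decay_ConsD K u C)
    have "nrm (e (Suc k)) = nrm (\<lambda>p x. (e (Suc k) p x - \<mu> * e k p x) + \<mu> * e k p x)" by simp
    also have "\<dots> \<le> nrm (\<lambda>p x. e (Suc k) p x - \<mu> * e k p x) + nrm (\<lambda>p x. \<mu> * e k p x)"
      using e by (intro nrm_add diff_mem scale_mem)
    also have "\<dots> \<le> C * r ^ k * nrm u + norm \<mu> * nrm (e k)"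
      using e by (intro add_mono rec nrm_scale_le)
    also have "\<dots> \<le> C * r ^ k * nrm u + norm \<mu> * (d * r ^ k * nrm u)"
      using Suc by (intro add_left_mono mult_left_mono) (auto simp: e_def)
    also have "\<dots> = (C + norm \<mu> * d) * (r ^ k * nrm u)" by (simp add: algebra_simps)
    also have "\<dots> \<le> (d * r) * (r ^ k * nrm u)"
      using dC r0 by (intro mult_right_mono) (auto simp: nrm_nonneg algebra_simps)
    finally show ?case by (simp add: e_def mult_ac)
  qed
  then show ?thesis using d unfolding root_decay_def by blast
qed

text \<open>The case of interest is s < r. Adding the roots in \<open>ms\<close> to
  \<open>ks\<close> gives the rate s, and they are then removed again one by one: the rate r known
  for \<open>ks\<close> excludes growth like |\<mu>|^k, so that \<open>backward_recurrence\<close>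
  preserves s.\<close>

lemma root_decay_transfer:
  assumes K: "lin_op K" "bounded_op K" and "0 < r" "0 < s"
    and ks: "root_decay K ks r" and ms: "root_decay K ms s"
    and large: "\<And>\<mu>. \<mu> \<in> set ms \<Longrightarrow> r < norm \<mu> \<and> s < norm \<mu>"
  shows "root_decay K ks s"
proof -
  \<comment> \<open>Additional factors are bounded operators applied first, so they only change the
    constant.\<close>
  have left: "root_decay K (ls @ ms') t" if ls: "root_decay K ls t" and t: "0 < t" for ls ms' t
  proof -
    obtain C where C: "0 \<le> C" "\<And>u k. u \<in> V \<Longrightarrow> nrm ((K ^^ k) (prod_op K ls u)) \<le> C * t ^ k * nrm u"
      using ls by (auto simp: root_decay_def)
    obtain B where B: "0 \<le> B" "\<And>u. u \<in> V \<Longrightarrow> nrm (prod_op K ms' u) \<le> B * nrm u"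
      using prod_op_bounded[OF K] by blast
    have "nrm ((K ^^ k) (prod_op K (ls @ ms') u)) \<le> C * B * t ^ k * nrm u" if u: "u \<in> V" for u k
    proof -
      have "nrm ((K ^^ k) (prod_op K (ls @ ms') u)) \<le> C * t ^ k * nrm (prod_op K ms' u)"
        unfolding prod_op_append using u K by (intro C prod_op_mem)
      also have "\<dots> \<le> C * t ^ k * (B * nrm u)"
        using B u C t by (intro mult_left_mono) auto
      finally show ?thesis by (simp add: mult_ac)
    qed
    then show ?thesis unfolding root_decay_def using C B by (intro exI[of _ "C * B"]) auto
  qed
  have "root_decay K (ms' @ ks) s \<Longrightarrow> root_decay K ks s" if "set ms' \<subseteq> set ms" for ms'
    using that
  proof (induction ms')
    case (Cons \<mu> ms')
    have \<mu>: "r < norm \<mu>" "s < norm \<mu>" using large Cons.prems by auto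
    define ls where "ls = ms' @ ks"
    obtain C where C: "0 \<le> C"
      "\<And>u k. u \<in> V \<Longrightarrow> nrm ((K ^^ k) (prod_op K (\<mu> # ls) u)) \<le> C * s ^ k * nrm u"
      using Cons.prems by (auto simp: root_decay_def ls_def)
    have "root_decay K ls r"
      using left[OF ks \<open>0 < r\<close>, of ms'] unfolding ls_def
      by (rule root_decay_cong) (rule prod_op_commute[OF K(1)])
    then obtain C' where C': "0 \<le> C'"
      "\<And>u k. u \<in> V \<Longrightarrow> nrm ((K ^^ k) (prod_op K ls u)) \<le> C' * r ^ k * nrm u"
      by (auto simp: root_decay_def)
    have "nrm ((K ^^ k) (prod_op K ls u)) \<le> C * nrm u / (norm \<mu> - s) * s ^ k" if u: "u \<in> V" for u k
    proof (rule backward_recurrence[where \<mu> = \<mu>])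
      show "(K ^^ k) (prod_op K ls u) \<in> V" for k using u K by (simp add: funpow_mem prod_op_mem)
      show "nrm (\<lambda>p x. (K ^^ Suc k) (prod_op K ls u) p x - \<mu> * (K ^^ k) (prod_op K ls u) p x)
          \<le> C * nrm u * s ^ k" for k
        using C(2)[OF u, of k] by (intro root_decay_ConsD K u) (simp add: mult_ac)
      have "(\<lambda>n. C' * nrm u * (r / norm \<mu>) ^ n) \<longlonglongrightarrow> C' * nrm u * 0"
        using \<mu> \<open>0 < r\<close> by (intro tendsto_intros LIMSEQ_power_zero) (auto simp: divide_less_eq)
      then have lim: "(\<lambda>n. C' * nrm u * (r / norm \<mu>) ^ n) \<longlonglongrightarrow> 0" by simp
      have "nrm ((K ^^ n) (prod_op K ls u)) / norm \<mu> ^ n \<le> C' * nrm u * (r / norm \<mu>) ^ n" for n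
        using C'(2)[OF u, of n] \<mu> by (simp add: power_divide divide_right_mono mult_ac)
      then show "(\<lambda>n. nrm ((K ^^ n) (prod_op K ls u)) / norm \<mu> ^ n) \<longlonglongrightarrow> 0"
        by (intro tendsto_sandwich[OF _ _ tendsto_const lim]) (auto simp: nrm_nonneg)
    qed (use \<mu> \<open>0 < s\<close> in auto)
    then have "root_decay K ls s"
      unfolding root_decay_def using C \<mu>
      by (intro exI[of _ "C / (norm \<mu> - s)"]) (simp add: mult_ac)
    then show ?case using Cons unfolding ls_def by simp
  qed simp
  then show ?thesis using left[OF ms \<open>0 < s\<close>, of ks] by blast
qed

text \<open>On an eigenvector the decaying expression is \<mu>^k times the product of the
  differences \<mu> - \<nu>. Since r < |\<mu>|, it can be of order r^k only if the product
  vanishes.\<close>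

lemma eigenvalue_root:
  assumes K: "lin_op K" "bounded_op K" and dec: "root_decay K ms r" and r: "0 < r" "r < norm \<mu>"
    and \<mu>: "eigenvalue K \<mu>"
  shows "\<mu> \<in> set ms"
proof (rule ccontr)
  assume notin: "\<mu> \<notin> set ms"
  obtain u where u: "u \<in> V" "nrm u \<noteq> 0" "nrm (\<lambda>p x. K u p x - \<mu> * u p x) = 0"
    using \<mu> by (auto simp: eigenvalue_def)
  obtain B where B: "0 \<le> B" "\<And>u. u \<in> V \<Longrightarrow> nrm (K u) \<le> B * nrm u"
    using K by (auto simp: bounded_op_def)
  obtain C where C: "0 \<le> C" "\<And>u k. u \<in> V \<Longrightarrow> nrm ((K ^^ k) (prod_op K ms u)) \<le> C * r ^ k * nrm u"
    using dec by (auto simp: root_decay_def)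
  \<comment> \<open>The eigenvalue equation holds only up to seminorm 0, so multiples of the
    eigenvector have to be followed through \<open>K\<close> with an error of seminorm 0.\<close>
  have step: "nrm (\<lambda>p x. K v p x - \<mu> * a * u p x) = 0"
    if v: "v \<in> V" "nrm (\<lambda>p x. v p x - a * u p x) = 0" for v a
  proof -
    have eq: "(\<lambda>p x. K v p x - \<mu> * a * u p x) =
        (\<lambda>p x. a * (K u p x - \<mu> * u p x) + K (\<lambda>p x. v p x - a * u p x) p x)"
      using u v by (simp add: lin_op_diff[OF K(1)] lin_op_scale[OF K(1)] scale_mem) (simp add: algebra_simps)
    have "nrm (\<lambda>p x. K v p x - \<mu> * a * u p x) \<le>
        norm a * nrm (\<lambda>p x. K u p x - \<mu> * u p x) + nrm (K (\<lambda>p x. v p x - a * u p x))"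
      unfolding eq using u v K by (intro nrm_lin shift_mem lin_opD(1)[OF K(1)] diff_mem scale_mem)
    also have "\<dots> \<le> norm a * nrm (\<lambda>p x. K u p x - \<mu> * u p x) + B * nrm (\<lambda>p x. v p x - a * u p x)"
      using u v by (intro add_left_mono B diff_mem scale_mem)
    finally show ?thesis using u v nrm_nonneg by (intro antisym) auto
  qed
  define a where "a = (\<Prod>\<nu>\<leftarrow>ms. \<mu> - \<nu>)"
  have "a \<noteq> 0" using notin by (auto simp: a_def prod_list_zero_iff)
  have "nrm (\<lambda>p x. prod_op K ms u p x - (\<Prod>\<nu>\<leftarrow>ms. \<mu> - \<nu>) * u p x) = 0"
  proof (induction ms)
    case (Cons \<nu> ms)
    let ?v = "prod_op K ms u" and ?a = "\<Prod>\<nu>\<leftarrow>ms. \<mu> - \<nu>"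
    have v: "?v \<in> V" using u K by (simp add: prod_op_mem)
    have eq: "(\<lambda>p x. prod_op K (\<nu> # ms) u p x - (\<Prod>\<nu>\<leftarrow>\<nu> # ms. \<mu> - \<nu>) * u p x) =
       (\<lambda>p x. - \<nu> * (?v p x - ?a * u p x) + (K ?v p x - \<mu> * ?a * u p x))"
      by (simp add: algebra_simps)
    have "nrm (\<lambda>p x. prod_op K (\<nu> # ms) u p x - (\<Prod>\<nu>\<leftarrow>\<nu> # ms. \<mu> - \<nu>) * u p x)
        \<le> norm (- \<nu>) * nrm (\<lambda>p x. ?v p x - ?a * u p x) +
        nrm (\<lambda>p x. K ?v p x - \<mu> * ?a * u p x)"
      unfolding eq using u v K by (intro nrm_lin lin_opD(1)[OF K(1)] diff_mem scale_mem)
    then show ?case using Cons step[OF v Cons] nrm_nonneg by (intro antisym) auto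
  qed (simp add: nrm_zero)
  then have "nrm (\<lambda>p x. (K ^^ k) (prod_op K ms u) p x - \<mu> ^ k * a * u p x) = 0" for k
  proof (induction k)
    case (Suc k)
    then show ?case
      using step[of "(K ^^ k) (prod_op K ms u)" "\<mu> ^ k * a"] u K
      by (simp add: funpow_mem prod_op_mem mult_ac)
  qed (simp add: a_def)
  have bd: "norm a \<le> C * (r / norm \<mu>) ^ k" for k
  proof -
    let ?e = "(K ^^ k) (prod_op K ms u)"
    have e: "?e \<in> V" using u K by (simp add: funpow_mem prod_op_mem)
    have "norm (\<mu> ^ k * a) * nrm u = nrm (\<lambda>p x. \<mu> ^ k * a * u p x)" using u by (simp add: nrm_scale)
    also have "\<dots> = nrm (\<lambda>p x. ?e p x - (?e p x - \<mu> ^ k * a * u p x))" by simp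
    also have "\<dots> \<le> nrm ?e + nrm (\<lambda>p x. ?e p x - \<mu> ^ k * a * u p x)"
      using e u by (intro nrm_diff diff_mem scale_mem)
    also have "\<dots> \<le> C * r ^ k * nrm u"
      using C u \<open>\<And>k. nrm (\<lambda>p x. (K ^^ k) (prod_op K ms u) p x - \<mu> ^ k * a * u p x) = 0\<close> by simp
    finally have "norm (\<mu> ^ k * a) \<le> C * r ^ k" using u(2) nrm_nonneg[of u] by simp
    moreover have "0 < norm \<mu> ^ k" using r by (intro zero_less_power) linarith
    ultimately show ?thesis by (simp add: norm_mult norm_power power_divide field_simps)
  qed
  have lim: "(\<lambda>k. C * (r / norm \<mu>) ^ k) \<longlonglongrightarrow> C * 0"
    using r by (intro tendsto_intros LIMSEQ_power_zero) (auto simp: divide_less_eq)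
  have "norm a \<le> C * 0" by (rule LIMSEQ_le_const[OF lim]) (use bd in blast)
  then show False using \<open>a \<noteq> 0\<close> by simp
qed

end

subsection \<open>Outliers\<close>

locale compact_operator = function_space +
  fixes K :: "('a \<Rightarrow> 'b \<Rightarrow> complex) \<Rightarrow> 'a \<Rightarrow> 'b \<Rightarrow> complex"
  assumes lin: "lin_op K" and bdd: "bounded_op K"
    and approx: "approximable K" and compl: "complete_range K"
begin

lemma finite_eigenvalues:
  assumes "0 < r" shows "finite {\<mu>. eigenvalue K \<mu> \<and> r < norm \<mu>}"
proof -
  obtain ms where "root_decay K ms r" using approximable_root_decay[OF lin approx assms] .
  then have "{\<mu>. eigenvalue K \<mu> \<and> r < norm \<mu>} \<subseteq> set ms"
    using eigenvalue_root[OF lin bdd] assms by blast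
  then show ?thesis using finite_subset by blast
qed

definition separates :: "complex set \<Rightarrow> real \<Rightarrow> bool" where
  "separates S r \<longleftrightarrow> 0 < r \<and> (\<forall>\<mu>\<in>S. r < norm \<mu>) \<and> (\<forall>\<mu>. eigenvalue K \<mu> \<and> \<mu> \<notin> S \<longrightarrow> norm \<mu> < r)"

text \<open>Two rates are needed. Roots outside \<open>S\<close> of modulus at least r, the circle
  included, are not eigenvalues and are removed at the rate r/2, which lies strictly below them; the
  remaining roots outside \<open>S\<close> have modulus less than r and are removed at the rate r,
  which lies strictly above.\<close>

lemma separates_root_decay:
  assumes S: "separates S r"
  obtains ms where "set ms \<subseteq> S" "root_decay K ms r"
proof -
  have r: "0 < r / 2" "r / 2 < r" using S by (auto simp: separates_def)
  obtain ms where ms: "root_decay K ms (r / 2)" using approximable_root_decay[OF lin approx r(1)] .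
  define ms1 where "ms1 = filter (\<lambda>\<mu>. \<mu> \<in> S \<or> norm \<mu> < r) ms"
  have "root_decay K ([] @ ms1) (r / 2)"
    unfolding ms1_def
  proof (rule root_decay_filter[OF lin])
    fix \<mu> ls assume \<mu>: "\<not> (\<mu> \<in> S \<or> norm \<mu> < r)" and dec: "root_decay K (\<mu> # ls) (r / 2)"
    have "\<not> eigenvalue K \<mu>" using \<mu> S by (auto simp: separates_def)
    then show "root_decay K ls (r / 2)"
      by (rule drop_root_not_eigenvalue[OF lin bdd compl _ _ _ dec]) (use \<mu> r in auto)
  qed (use ms in simp)
  then obtain C where C: "0 \<le> C"
    "\<And>u k. u \<in> V \<Longrightarrow> nrm ((K ^^ k) (prod_op K ([] @ ms1) u)) \<le> C * (r / 2) ^ k * nrm u"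
    by (auto simp: root_decay_def)
  have le: "C * (r / 2) ^ k * nrm u \<le> C * r ^ k * nrm u" for k u
    using C r by (intro mult_right_mono mult_left_mono power_mono) (auto simp: nrm_nonneg)
  have ms1: "root_decay K ([] @ ms1) r"
    unfolding root_decay_def using C(1) order_trans[OF C(2) le] by blast
  have "root_decay K ([] @ filter (\<lambda>\<mu>. \<mu> \<in> S) ms1) r"
  proof (rule root_decay_filter[OF lin _ ms1])
    fix \<mu> ls assume \<mu>: "\<mu> \<in> set ms1" "\<mu> \<notin> S" and dec: "root_decay K (\<mu> # ls) r"
    show "root_decay K ls r"
      by (rule drop_small_root[OF lin bdd _ dec]) (use \<mu> in \<open>auto simp: ms1_def\<close>)
  qed
  then show thesis by (intro that[of "filter (\<lambda>\<mu>. \<mu> \<in> S) ms1"]) (simp_all add: subset_iff)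
qed

text \<open>The degree must not depend on the radius: roots that suffice for one separating circle
  suffice for every other one.\<close>

lemma uniform_degree:
  obtains deg :: "complex set \<Rightarrow> nat" where
    "\<And>S r. separates S r \<Longrightarrow> \<exists>ms. set ms \<subseteq> S \<and> length ms = deg S \<and> root_decay K ms r"
proof -
  have "\<exists>ks. (\<exists>r. separates S r) \<longrightarrow> (\<exists>r. separates S r \<and> set ks \<subseteq> S \<and> root_decay K ks r)" for S
    using separates_root_decay by metis
  then obtain ks where ks: "\<And>S. (\<exists>r. separates S r) \<Longrightarrow>
      (\<exists>r. separates S r \<and> set (ks S) \<subseteq> S \<and> root_decay K (ks S) r)"
    by metis
  show thesis
  proof (rule that[of "\<lambda>S. length (ks S)"])
    fix S s assume s: "separates S s"
    then obtain r where r: "separates S r" "set (ks S) \<subseteq> S" "root_decay K (ks S) r"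
      using ks by blast
    obtain ms where ms: "set ms \<subseteq> S" "root_decay K ms s"
      using separates_root_decay[OF s] .
    \<comment> \<open>The roots in \<open>ms\<close> lie in \<open>S\<close>, hence outside both
      circles, as the transfer demands.\<close>
    have "root_decay K (ks S) s"
      using r s ms unfolding separates_def
      by (rule_tac root_decay_transfer[OF lin bdd _ _ r(3) ms(2)]) auto
    then show "\<exists>ms. set ms \<subseteq> S \<and> length ms = length (ks S) \<and> root_decay K ms s"
      using r by blast
  qed
qed

end

unbundle vec_syntax

section \<open>Boundary charts and the normal\<close>

lemma perp_orthonormal:
  assumes "norm e = 1"
  shows "norm (perp e) = 1" "perp e \<bullet> e = 0" "x = (perp e \<bullet> x) *\<^sub>R perp e + (e \<bullet> x) *\<^sub>R e"
proof -
  have e: "e $ 1 * e $ 1 + e $ 2 * e $ 2 = 1"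
    using assms by (simp add: norm_eq_1 inner_vec_def sum_2)
  show "norm (perp e) = 1" using e by (simp add: norm_eq_1 inner_vec_def sum_2 perp_def)
  show "perp e \<bullet> e = 0" by (simp add: inner_vec_def sum_2 perp_def)
  have "x $ 1 = x $ 1 * (e $ 1 * e $ 1 + e $ 2 * e $ 2)" "x $ 2 = x $ 2 * (e $ 1 * e $ 1 + e $ 2 * e $ 2)"
    by (simp_all add: e)
  then show "x = (perp e \<bullet> x) *\<^sub>R perp e + (e \<bullet> x) *\<^sub>R e"
    by (simp add: vec_eq_iff forall_2 inner_vec_def sum_2 perp_def algebra_simps)
qed

lemma C2_functionD:
  assumes "C2_function f"
  shows "(f has_real_derivative deriv f s) (at s)" "continuous_on A f" "continuous_on A (deriv f)"
proof -
  obtain f' f'' where f: "\<And>s. (f has_real_derivative f' s) (at s)"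
    "\<And>s. (f' has_real_derivative f'' s) (at s)"
    using assms by (auto simp: C2_function_def)
  have "deriv f = f'" using f(1) by (auto intro: DERIV_imp_deriv)
  then show "(f has_real_derivative deriv f s) (at s)" "continuous_on A (deriv f)" "continuous_on A f"
    using f by (auto intro: DERIV_continuous_on DERIV_subset)
qed

definition chart_normal :: "real^2 \<Rightarrow> (real \<Rightarrow> real) \<Rightarrow> real^2 \<Rightarrow> real^2" where
  "chart_normal e f x = e - deriv f (perp e \<bullet> x) *\<^sub>R perp e"

lemma chart_normal_nonzero: "norm e = 1 \<Longrightarrow> chart_normal e f x \<noteq> 0"
proof
  assume e: "norm e = 1" and "chart_normal e f x = 0"
  then have "e \<bullet> (e - deriv f (perp e \<bullet> x) *\<^sub>R perp e) = 0" by (simp add: chart_normal_def)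
  then have "e \<bullet> e = 0"
    using perp_orthonormal(2)[OF e] by (simp add: inner_diff_right inner_commute)
  then show False using e by simp
qed

lemma boundary_chart_recentre:
  "boundary_chart \<Omega> x0 r e f \<Longrightarrow> x \<in> ball x0 r \<Longrightarrow> boundary_chart \<Omega> x (r - dist x0 x) e f"
proof -
  assume c: "boundary_chart \<Omega> x0 r e f" and x: "x \<in> ball x0 r"
  have sub: "ball x (r - dist x0 x) \<subseteq> ball x0 r"
    using dist_triangle_le[of x0 x _ r] by (auto simp: ball_def) (smt (verit) dist_triangle)
  have "\<Omega> \<inter> ball x0 r = {y \<in> ball x0 r. e \<bullet> y < f (perp e \<bullet> y)}"
    using c by (simp add: boundary_chart_def)
  then have "\<Omega> \<inter> ball x (r - dist x0 x) = {y \<in> ball x (r - dist x0 x). e \<bullet> y < f (perp e \<bullet> y)}"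
    using sub by blast
  then show ?thesis using c x by (simp add: boundary_chart_def)
qed

text \<open>A frontier point of an open set is not in the set, hence not below the graph; nor is it
  above, since a neighbourhood above the graph misses the set.\<close>

lemma frontier_on_graph:
  assumes c: "boundary_chart \<Omega> x0 r e f" and x: "x \<in> frontier \<Omega>" "x \<in> ball x0 r" and op: "open \<Omega>"
  shows "e \<bullet> x = f (perp e \<bullet> x)"
proof (rule ccontr)
  assume ne: "e \<bullet> x \<noteq> f (perp e \<bullet> x)"
  have eq: "\<Omega> \<inter> ball x0 r = {y \<in> ball x0 r. e \<bullet> y < f (perp e \<bullet> y)}" and C2: "C2_function f"
    using c by (auto simp: boundary_chart_def)
  have xn: "x \<notin> \<Omega>" using x op by (auto simp: frontier_def interior_open)
  then have "f (perp e \<bullet> x) < e \<bullet> x" using eq x ne by force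
  then have "x \<in> {y. f (perp e \<bullet> y) < e \<bullet> y}" by simp
  moreover have "open {y. f (perp e \<bullet> y) < e \<bullet> y}"
    by (intro open_Collect_less continuous_intros continuous_on_compose2[OF C2_functionD(2)[OF C2, of UNIV]]) auto
  ultimately have "\<exists>y\<in>\<Omega>. y \<in> {y. f (perp e \<bullet> y) < e \<bullet> y} \<inter> ball x0 r"
    using x closure_iff_nhds_not_empty[of x \<Omega>] unfolding frontier_def
    by (metis (no_types, lifting) DiffD1 IntI Int_iff disjoint_iff open_Int open_ball order_refl)
  then show False using eq by force
qed

text \<open>The differentiated function is negative inside the set and vanishes on the graph, so at
  a boundary point a nonzero value tells whether the direction v enters or leaves the set.\<close>

lemma chart_curve_deriv:
  assumes "boundary_chart \<Omega> x r e f"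
  shows "((\<lambda>t. e \<bullet> (x + t *\<^sub>R v) - f (perp e \<bullet> (x + t *\<^sub>R v))) has_real_derivative chart_normal e f x \<bullet> v) (at 0)"
proof -
  have C2: "C2_function f" using assms by (simp add: boundary_chart_def)
  have "((\<lambda>t. perp e \<bullet> x + t * (perp e \<bullet> v)) has_real_derivative (perp e \<bullet> v)) (at 0)"
    by (auto intro!: derivative_eq_intros)
  then have "((\<lambda>t. f (perp e \<bullet> x + t * (perp e \<bullet> v))) has_real_derivative
      deriv f (perp e \<bullet> x) * (perp e \<bullet> v)) (at 0)"
    using C2_functionD(1)[OF C2] by (intro DERIV_chain2[where f = f]) auto
  moreover have "((\<lambda>t. e \<bullet> x + t * (e \<bullet> v)) has_real_derivative (e \<bullet> v)) (at 0)"
    by (auto intro!: derivative_eq_intros)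
  ultimately have "((\<lambda>t. (e \<bullet> x + t * (e \<bullet> v)) - f (perp e \<bullet> x + t * (perp e \<bullet> v))) has_real_derivative
      (e \<bullet> v) - deriv f (perp e \<bullet> x) * (perp e \<bullet> v)) (at 0)"
    by (intro DERIV_diff)
  then show ?thesis by (simp add: chart_normal_def inner_add_right inner_diff_left)
qed

text \<open>If the unit normals a and b of two charts differed, the direction b - a would enter the
  set according to the first chart and leave it according to the second. This is what makes the
  description in \<open>outward_normal\<close> definite.\<close>

lemma chart_normals_agree:
  assumes c: "boundary_chart \<Omega> x r e f" "boundary_chart \<Omega> x r' e' f'"
    and x: "x \<in> frontier \<Omega>" and op: "open \<Omega>"
  shows "sgn (chart_normal e f x) = sgn (chart_normal e' f' x)"
proof -
  let ?\<nu> = "chart_normal e f x" and ?\<nu>' = "chart_normal e' f' x"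
  have r: "0 < r" "0 < r'" "norm e = 1" "norm e' = 1" using c by (auto simp: boundary_chart_def)
  have graph: "e \<bullet> x = f (perp e \<bullet> x)" "e' \<bullet> x = f' (perp e' \<bullet> x)"
    using r by (auto intro!: frontier_on_graph[OF _ x _ op] c)
  have impl: "?\<nu>' \<bullet> v \<le> 0" if v: "?\<nu> \<bullet> v < 0" for v
  proof (rule ccontr)
    assume v': "\<not> ?\<nu>' \<bullet> v \<le> 0"
    obtain d where d: "d > 0" "\<And>t. 0 < t \<Longrightarrow> t < d \<Longrightarrow> e \<bullet> (x + t *\<^sub>R v) < f (perp e \<bullet> (x + t *\<^sub>R v))"
      using DERIV_neg_dec_right[OF chart_curve_deriv[OF c(1)] v] graph by auto
    obtain d' where d': "d' > 0" "\<And>t. 0 < t \<Longrightarrow> t < d' \<Longrightarrow> f' (perp e' \<bullet> (x + t *\<^sub>R v)) < e' \<bullet> (x + t *\<^sub>R v)"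
      using DERIV_pos_inc_right[OF chart_curve_deriv[OF c(2)], of v] v' graph by auto
    have "v \<noteq> 0" using v by auto
    define t where "t = Min {d, d', r / norm v, r' / norm v} / 2"
    have "0 < Min {d, d', r / norm v, r' / norm v}" using d d' r \<open>v \<noteq> 0\<close> by simp
    moreover have "Min {d, d', r / norm v, r' / norm v} \<le> d" "Min {d, d', r / norm v, r' / norm v} \<le> d'"
      "Min {d, d', r / norm v, r' / norm v} \<le> r / norm v" "Min {d, d', r / norm v, r' / norm v} \<le> r' / norm v"
      by (intro Min_le; simp)+
    ultimately have t: "0 < t" "t < d" "t < d'" "t < r / norm v" "t < r' / norm v"
      unfolding t_def by linarith+
    then have "x + t *\<^sub>R v \<in> ball x r" "x + t *\<^sub>R v \<in> ball x r'"
      using \<open>v \<noteq> 0\<close> by (auto simp: dist_norm field_simps)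
    then have "x + t *\<^sub>R v \<in> {y \<in> ball x r. e \<bullet> y < f (perp e \<bullet> y)}"
      and "x + t *\<^sub>R v \<in> ball x r' - {y \<in> ball x r'. e' \<bullet> y < f' (perp e' \<bullet> y)}"
      using d(2)[OF t(1,2)] d'(2)[OF t(1,3)] less_asym by blast+
    moreover have "\<Omega> \<inter> ball x r = {y \<in> ball x r. e \<bullet> y < f (perp e \<bullet> y)}"
      "\<Omega> \<inter> ball x r' = {y \<in> ball x r'. e' \<bullet> y < f' (perp e' \<bullet> y)}"
      using c by (simp_all only: boundary_chart_def)
    ultimately show False by blast
  qed
  define a b where "a = sgn ?\<nu>" and "b = sgn ?\<nu>'"
  have nz: "?\<nu> \<noteq> 0" "?\<nu>' \<noteq> 0" using r by (auto simp: chart_normal_nonzero)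
  then have ab: "a \<bullet> a = 1" "b \<bullet> b = 1"
    by (auto simp: a_def b_def norm_sgn simp flip: norm_eq_1)
  have "a = b"
  proof (rule ccontr)
    assume "a \<noteq> b"
    then have "0 < (a - b) \<bullet> (a - b)" by simp
    then have lt: "a \<bullet> b < 1"
      using ab by (simp add: inner_diff_left inner_diff_right inner_commute)
    have "?\<nu> \<bullet> (b - a) = norm ?\<nu> * (a \<bullet> (b - a))" "?\<nu>' \<bullet> (b - a) = norm ?\<nu>' * (b \<bullet> (b - a))"
      using nz by (simp_all add: a_def b_def sgn_div_norm divide_inverse mult.assoc[symmetric])
    moreover have "a \<bullet> (b - a) < 0" "b \<bullet> (b - a) > 0"
      using lt ab by (auto simp: inner_diff_right inner_commute)
    ultimately have "?\<nu> \<bullet> (b - a) < 0" "?\<nu>' \<bullet> (b - a) > 0"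
      using nz by (auto simp: mult_less_0_iff zero_less_mult_iff)
    then show False using impl by fastforce
  qed
  then show ?thesis by (simp add: a_def b_def)
qed

lemma outward_normal_eq:
  assumes c: "boundary_chart \<Omega> x r e f" and x: "x \<in> frontier \<Omega>" and op: "open \<Omega>"
  shows "outward_normal \<Omega> x = sgn (chart_normal e f x)"
  unfolding outward_normal_def
proof (rule the_equality)
  show "\<exists>r e' f'. boundary_chart \<Omega> x r e' f' \<and>
      sgn (chart_normal e f x) = sgn (e' - deriv f' (perp e' \<bullet> x) *\<^sub>R perp e')"
    using c by (auto simp: chart_normal_def)
next
  fix n assume "\<exists>r e f. boundary_chart \<Omega> x r e f \<and> n = sgn (e - deriv f (perp e \<bullet> x) *\<^sub>R perp e)"
  then show "n = sgn (chart_normal e f x)"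
    using chart_normals_agree[OF c _ x op] by (auto simp: chart_normal_def)
qed

text \<open>One chart, recentred, serves all boundary points near its centre, so there the normal is
  given by a single continuous formula.\<close>

lemma continuous_on_outward_normal:
  assumes C2: "C2_boundary \<Omega>" and op: "open \<Omega>"
  shows "continuous_on (frontier \<Omega>) (outward_normal \<Omega>)"
  unfolding continuous_on_def
proof
  fix x0 assume x0: "x0 \<in> frontier \<Omega>"
  then obtain r e f where c: "boundary_chart \<Omega> x0 r e f" using C2 by (auto simp: C2_boundary_def)
  have e: "norm e = 1" "0 < r" and f: "C2_function f" using c by (auto simp: boundary_chart_def)
  have "continuous_on UNIV (\<lambda>x. sgn (chart_normal e f x))"
    unfolding sgn_div_norm chart_normal_def
    using chart_normal_nonzero[OF e(1), of f]
    by (intro continuous_intros continuous_on_compose2[OF C2_functionD(3)[OF f, of UNIV]])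
       (auto simp: chart_normal_def)
  then have "((\<lambda>x. sgn (chart_normal e f x)) \<longlongrightarrow> sgn (chart_normal e f x0)) (at x0 within frontier \<Omega>)"
    by (metis UNIV_I continuous_on_def continuous_on_subset subset_UNIV x0)
  moreover have "\<forall>\<^sub>F x in at x0 within frontier \<Omega>. sgn (chart_normal e f x) = outward_normal \<Omega> x"
  proof -
    have "\<forall>\<^sub>F x in at x0 within frontier \<Omega>. x \<in> ball x0 r \<and> x \<in> frontier \<Omega>"
      using e by (intro eventually_at_ball)
    then show ?thesis
      by eventually_elim (metis boundary_chart_recentre c op outward_normal_eq)
  qed
  ultimately show "(outward_normal \<Omega> \<longlongrightarrow> outward_normal \<Omega> x0) (at x0 within frontier \<Omega>)"
    using outward_normal_eq[OF c x0 op] by (auto intro: Lim_transform_eventually)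
qed

section \<open>The boundary measure\<close>

text \<open>Only an upper bound is needed: if the set function were not countably additive on the Borel
  sets, \<open>hausdorff1\<close> would be the zero measure and the bound would hold as well.\<close>

lemma emeasure_hausdorff1_le:
  assumes cover: "\<And>\<epsilon>. \<epsilon> > 0 \<Longrightarrow> \<exists>C :: nat \<Rightarrow> (real^2) set. A \<subseteq> (\<Union>i. C i) \<and>
      (\<forall>i. bounded (C i) \<and> diameter (C i) \<le> \<epsilon>) \<and> (\<Sum>i. ennreal (diameter (C i))) \<le> c"
  shows "emeasure hausdorff1 A \<le> c"
proof -
  have "(SUP \<epsilon>\<in>{0<..}.
        INF C\<in>{C :: nat \<Rightarrow> (real^2) set. A \<subseteq> (\<Union>i. C i) \<and> (\<forall>i. bounded (C i) \<and> diameter (C i) \<le> \<epsilon>)}.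
          (\<Sum>i. ennreal (diameter (C i)))) \<le> c"
  proof (rule SUP_least)
    fix \<epsilon> :: real assume "\<epsilon> \<in> {0<..}"
    then obtain C :: "nat \<Rightarrow> (real^2) set" where "A \<subseteq> (\<Union>i. C i)"
      "\<forall>i. bounded (C i) \<and> diameter (C i) \<le> \<epsilon>" "(\<Sum>i. ennreal (diameter (C i))) \<le> c"
      using cover[of \<epsilon>] by auto
    then show "(INF C\<in>{C :: nat \<Rightarrow> (real^2) set. A \<subseteq> (\<Union>i. C i) \<and> (\<forall>i. bounded (C i) \<and> diameter (C i) \<le> \<epsilon>)}.
          (\<Sum>i. ennreal (diameter (C i)))) \<le> c"
      by (intro INF_lower2[of C]) auto
  qed
  then show ?thesis
    unfolding hausdorff1_def emeasure_measure_of_conv by auto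
qed

text \<open>Cutting the interval into equal pieces of length h with L h \<le> \<epsilon> covers the
  curve by sets of diameter at most L h, whose sum does not depend on the number of pieces.\<close>

lemma emeasure_hausdorff1_lipschitz:
  fixes \<gamma> :: "real \<Rightarrow> real^2"
  assumes lip: "\<And>s t. s \<in> {a..b} \<Longrightarrow> t \<in> {a..b} \<Longrightarrow> dist (\<gamma> s) (\<gamma> t) \<le> L * \<bar>s - t\<bar>"
    and ab: "a < b" and L: "0 \<le> L" and A: "A \<subseteq> \<gamma> ` {a..b}"
  shows "emeasure hausdorff1 A \<le> ennreal (L * (b - a))"
proof (rule emeasure_hausdorff1_le)
  fix \<epsilon> :: real assume \<epsilon>: "\<epsilon> > 0"
  obtain n :: nat where n: "L * (b - a) / \<epsilon> < real n" using reals_Archimedean2 by blast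
  have n0: "0 < n" using n \<epsilon> L ab by (cases n) (auto simp: divide_less_0_iff mult_less_0_iff)
  define h where "h = (b - a) / real n"
  have h: "0 < h" "L * h \<le> \<epsilon>" "real n * h = b - a"
    using n n0 \<epsilon> ab by (auto simp: h_def field_simps)
  define I where "I i = {a + real i * h .. a + (real i + 1) * h} \<inter> {a..b}" for i :: nat
  define C where "C i = (if i < n then \<gamma> ` I i else {})" for i
  have dist: "dist x y \<le> L * h" if xy: "x \<in> C i" "y \<in> C i" for x y i
  proof -
    obtain s t where st: "s \<in> I i" "t \<in> I i" "x = \<gamma> s" "y = \<gamma> t"
      using xy by (auto simp: C_def split: if_splits)
    then have "\<bar>s - t\<bar> \<le> h" by (auto simp: I_def algebra_simps)
    then have "L * \<bar>s - t\<bar> \<le> L * h" using L by (intro mult_left_mono)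
    then show ?thesis using lip[of s t] st by (auto simp: I_def)
  qed
  have diam: "diameter (C i) \<le> L * h" for i
    using dist[of _ i] L h by (intro diameter_le) (auto simp: dist_norm)
  have bdd: "bounded (C i)" for i
  proof (cases "C i = {}")
    case False
    then obtain x where "x \<in> C i" by blast
    then show ?thesis using dist unfolding bounded_def by blast
  qed simp
  have "\<gamma> ` {a..b} \<subseteq> (\<Union>i. C i)"
  proof
    fix x assume "x \<in> \<gamma> ` {a..b}"
    then obtain s where s: "s \<in> {a..b}" "x = \<gamma> s" by blast
    \<comment> \<open>For s = b the quotient would give n, one beyond the last piece.\<close>
    define i where "i = (if s = b then n - 1 else nat \<lfloor>(s - a) / h\<rfloor>)"
    have "i < n \<and> s \<in> I i"
    proof (cases "s = b")
      case True
      then show ?thesis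
        using n0 h ab by (auto simp: i_def I_def of_nat_diff algebra_simps)
    next
      case False
      then have lt: "(s - a) / h < real n" using s h by (simp add: field_simps)
      have pos: "0 \<le> (s - a) / h" using s h by simp
      have fl: "real (nat \<lfloor>(s - a) / h\<rfloor>) \<le> (s - a) / h" "(s - a) / h < real (nat \<lfloor>(s - a) / h\<rfloor>) + 1"
        using pos by auto
      have i: "i = nat \<lfloor>(s - a) / h\<rfloor>" using False by (simp add: i_def)
      have "real i < real n" unfolding i using fl(1) lt by (rule le_less_trans)
      moreover have "real i * h \<le> s - a" "s - a \<le> (real i + 1) * h"
        using fl h unfolding i by (simp_all add: field_simps)
      ultimately show ?thesis using s by (auto simp: I_def)
    qed
    then show "x \<in> (\<Union>i. C i)" using s by (auto simp: C_def)
  qed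
  moreover have "(\<Sum>i. ennreal (diameter (C i))) \<le> ennreal (L * (b - a))"
  proof -
    have "(\<Sum>i. ennreal (diameter (C i))) = (\<Sum>i<n. ennreal (diameter (C i)))"
      by (intro suminf_finite) (auto simp: C_def)
    also have "\<dots> \<le> (\<Sum>i<n. ennreal (L * h))"
      using diam by (intro sum_mono ennreal_leI)
    also have "\<dots> = ennreal (real n * (L * h))"
      using L h by (simp add: ennreal_mult ennreal_of_nat_eq_real_of_nat)
    also have "real n * (L * h) = L * (b - a)" using h by (simp add: mult_ac)
    finally show ?thesis .
  qed
  ultimately show "\<exists>C :: nat \<Rightarrow> (real^2) set. A \<subseteq> (\<Union>i. C i) \<and>
      (\<forall>i. bounded (C i) \<and> diameter (C i) \<le> \<epsilon>) \<and> (\<Sum>i. ennreal (diameter (C i))) \<le> ennreal (L * (b - a))"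
    using A bdd diam h by (intro exI[of _ C]) (meson order_trans)
qed

lemma sets_hausdorff1 [simp]: "sets hausdorff1 = sets borel"
  and space_hausdorff1 [simp]: "space hausdorff1 = UNIV"
  by (simp_all add: hausdorff1_def sets.sigma_sets_eq[of borel, simplified])

lemma space_bdry [simp]: "space (bdry \<Omega>) = frontier \<Omega>"
  by (simp add: bdry_def space_restrict_space)

lemma sets_bdry: "sets (bdry \<Omega>) = sets (restrict_space borel (frontier \<Omega>))"
  by (simp add: bdry_def sets_restrict_space)

lemma measurable_bdry_iff:
  "f \<in> borel_measurable (bdry \<Omega>) \<longleftrightarrow> f \<in> borel_measurable (restrict_space borel (frontier \<Omega>))"
  by (intro arg_cong[where f = "(\<in>) f"] measurable_cong_sets sets_bdry refl)

lemma borel_measurable_bdry: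
  "f \<in> borel_measurable borel \<Longrightarrow> f \<in> borel_measurable (bdry \<Omega>)"
  unfolding measurable_bdry_iff by (rule measurable_restrict_space1)

lemma continuous_measurable_bdry:
  "continuous_on (frontier \<Omega>) f \<Longrightarrow> f \<in> borel_measurable (bdry \<Omega>)"
  unfolding measurable_bdry_iff by (rule borel_measurable_continuous_on_restrict)

text \<open>Inside a chart the boundary lies on the graph of f over a compact interval, where the
  continuous derivative is bounded and the graph is a Lipschitz curve.\<close>

lemma chart_arc_finite:
  assumes c: "boundary_chart \<Omega> x0 r e f" and op: "open \<Omega>"
  shows "emeasure hausdorff1 (frontier \<Omega> \<inter> cball x0 (r / 2)) < \<infinity>"
proof -
  have e: "norm e = 1" "0 < r" and f: "C2_function f" using c by (auto simp: boundary_chart_def)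
  define a b where "a = perp e \<bullet> x0 - r" and "b = perp e \<bullet> x0 + r"
  define \<gamma> where "\<gamma> s = s *\<^sub>R perp e + f s *\<^sub>R e" for s
  have "compact (deriv f ` {a..b})"
    using C2_functionD(3)[OF f] by (intro compact_continuous_image) auto
  then obtain B where B: "\<And>s. s \<in> {a..b} \<Longrightarrow> norm (deriv f s) \<le> B"
    by (metis bounded_iff compact_imp_bounded imageI)
  have lipf: "norm (f s - f t) \<le> B * norm (s - t)" if "s \<in> {a..b}" "t \<in> {a..b}" for s t
    using that C2_functionD(1)[OF f] B
    by (intro field_differentiable_bound[of "{a..b}" f "deriv f"]) (auto intro: has_field_derivative_at_within)
  have "dist (\<gamma> s) (\<gamma> t) \<le> (1 + B) * \<bar>s - t\<bar>" if "s \<in> {a..b}" "t \<in> {a..b}" for s t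
  proof -
    have "\<gamma> s - \<gamma> t = (s - t) *\<^sub>R perp e + (f s - f t) *\<^sub>R e" by (simp add: \<gamma>_def algebra_simps)
    then have "dist (\<gamma> s) (\<gamma> t) \<le> \<bar>s - t\<bar> * norm (perp e) + \<bar>f s - f t\<bar> * norm e"
      by (metis dist_norm norm_scaleR norm_triangle_ineq)
    then show ?thesis using lipf[OF that] e perp_orthonormal(1)[OF e(1)] by (simp add: algebra_simps)
  qed
  moreover have "0 \<le> B" using B[of a] e norm_ge_zero[of "deriv f a"] by (simp add: a_def b_def)
  moreover have "frontier \<Omega> \<inter> cball x0 (r / 2) \<subseteq> \<gamma> ` {a..b}"
  proof
    fix x assume x: "x \<in> frontier \<Omega> \<inter> cball x0 (r / 2)"
    then have "x \<in> ball x0 r" using e by auto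
    then have "e \<bullet> x = f (perp e \<bullet> x)" using frontier_on_graph[OF c _ _ op] x by blast
    then have "x = \<gamma> (perp e \<bullet> x)" unfolding \<gamma>_def using perp_orthonormal(3)[OF e(1), of x] by simp
    moreover have "\<bar>perp e \<bullet> x - perp e \<bullet> x0\<bar> \<le> r"
    proof -
      have "\<bar>perp e \<bullet> (x - x0)\<bar> \<le> norm (perp e) * norm (x - x0)" by (rule Cauchy_Schwarz_ineq2)
      then show ?thesis
        using x e perp_orthonormal(1)[OF e(1)]
        by (auto simp: inner_diff_right dist_norm norm_minus_commute)
    qed
    then have "perp e \<bullet> x \<in> {a..b}" unfolding a_def b_def by (simp add: abs_le_iff)
    ultimately show "x \<in> \<gamma> ` {a..b}" by blast
  qed
  ultimately have "emeasure hausdorff1 (frontier \<Omega> \<inter> cball x0 (r / 2)) \<le> ennreal ((1 + B) * (b - a))"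
    using e by (intro emeasure_hausdorff1_lipschitz) (auto simp: a_def b_def)
  then show ?thesis by (simp add: le_less_trans)
qed

text \<open>The boundary is compact, so finitely many of the arcs of \<open>chart_arc_finite\<close>
  cover it.\<close>

lemma finite_measure_bdry:
  assumes C2: "C2_boundary \<Omega>" and op: "open \<Omega>" and bd: "bounded \<Omega>"
  shows "finite_measure (bdry \<Omega>)"
proof
  have ex: "\<exists>r>0. emeasure hausdorff1 (frontier \<Omega> \<inter> cball x r) < \<infinity>" if x: "x \<in> frontier \<Omega>" for x
  proof -
    obtain r e f where c: "boundary_chart \<Omega> x r e f" using C2 x by (auto simp: C2_boundary_def)
    then show ?thesis
      using chart_arc_finite[OF c op] by (intro exI[of _ "r / 2"]) (auto simp: boundary_chart_def)
  qed
  define r where "r x = (SOME r. r > 0 \<and> emeasure hausdorff1 (frontier \<Omega> \<inter> cball x r) < \<infinity>)" for x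
  have r: "0 < r x" "emeasure hausdorff1 (frontier \<Omega> \<inter> cball x (r x)) < \<infinity>"
    if "x \<in> frontier \<Omega>" for x
    using someI_ex[OF ex[OF that]] unfolding r_def by blast+
  have cpt: "compact (frontier \<Omega>)" using bd by (rule compact_frontier_bounded)
  have cov: "frontier \<Omega> \<subseteq> (\<Union>x\<in>frontier \<Omega>. ball x (r x))" using r(1) by fastforce
  obtain F where F: "finite F" "F \<subseteq> frontier \<Omega>" "frontier \<Omega> \<subseteq> (\<Union>x\<in>F. ball x (r x))"
    by (rule compactE_image[OF cpt _ cov]) auto
  have "emeasure hausdorff1 (frontier \<Omega>) \<le> emeasure hausdorff1 (\<Union>x\<in>F. frontier \<Omega> \<inter> cball x (r x))"
  proof (rule emeasure_mono)
    have "(\<Union>x\<in>F. ball x (r x)) \<subseteq> (\<Union>x\<in>F. cball x (r x))"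
      by (intro UN_mono ball_subset_cball order_refl)
    with F(3) have "frontier \<Omega> \<subseteq> frontier \<Omega> \<inter> (\<Union>x\<in>F. cball x (r x))"
      by (intro Int_greatest order_refl) (rule order_trans)
    then show "frontier \<Omega> \<subseteq> (\<Union>x\<in>F. frontier \<Omega> \<inter> cball x (r x))"
      by (simp only: Int_UN_distrib)
    show "(\<Union>x\<in>F. frontier \<Omega> \<inter> cball x (r x)) \<in> sets hausdorff1"
      using F by (auto intro!: borel_closed closed_UN)
  qed
  also have "\<dots> \<le> (\<Sum>x\<in>F. emeasure hausdorff1 (frontier \<Omega> \<inter> cball x (r x)))"
    using F by (intro emeasure_subadditive_finite) (auto intro!: borel_closed)
  also have "\<dots> < \<infinity>" using F r by (auto simp: less_top)
  finally show "emeasure (bdry \<Omega>) (space (bdry \<Omega>)) \<noteq> \<infinity>"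
    by (simp add: bdry_def emeasure_restrict_space space_restrict_space)
qed

section \<open>Square-integrable functions\<close>

lemma L2_lin:
  assumes "f \<in> L2 \<mu>" "g \<in> L2 \<mu>"
  shows "(\<lambda>x. a * f x + g x) \<in> L2 \<mu>"
proof -
  have [measurable]: "f \<in> borel_measurable \<mu>" "g \<in> borel_measurable \<mu>" using assms by (auto simp: L2_def)
  have int: "integrable \<mu> (\<lambda>x. (cmod (f x))\<^sup>2)" "integrable \<mu> (\<lambda>x. (cmod (g x))\<^sup>2)"
    using assms by (auto simp: L2_def)
  have "integrable \<mu> (\<lambda>x. (cmod (a * f x + g x))\<^sup>2)"
  proof (rule Bochner_Integration.integrable_bound)
    show "integrable \<mu> (\<lambda>x. 2 * (cmod a)\<^sup>2 * (cmod (f x))\<^sup>2 + 2 * (cmod (g x))\<^sup>2)"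
      using int by simp
    have "(cmod (a * f x + g x))\<^sup>2 \<le> 2 * (cmod a)\<^sup>2 * (cmod (f x))\<^sup>2 + 2 * (cmod (g x))\<^sup>2" for x
    proof -
      have "(cmod (a * f x + g x))\<^sup>2 \<le> (cmod (a * f x) + cmod (g x))\<^sup>2"
        by (intro power_mono norm_triangle_ineq) auto
      also have "\<dots> \<le> 2 * (cmod (a * f x))\<^sup>2 + 2 * (cmod (g x))\<^sup>2"
        using sum_squares_bound[of "cmod (a * f x)" "cmod (g x)"] by (simp add: power2_sum)
      finally show ?thesis by (simp add: norm_mult power_mult_distrib)
    qed
    then show "AE x in \<mu>. norm ((cmod (a * f x + g x))\<^sup>2) \<le>
        norm (2 * (cmod a)\<^sup>2 * (cmod (f x))\<^sup>2 + 2 * (cmod (g x))\<^sup>2)"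
      by simp
  qed measurable
  then show ?thesis by (simp add: L2_def)
qed

lemma bounded_L2:
  assumes fin: "finite_measure M" and f: "f \<in> borel_measurable M" and b: "\<And>x. x \<in> space M \<Longrightarrow> cmod (f x) \<le> c" and c: "0 \<le> c"
  shows "f \<in> L2 M" "(LINT x|M. (cmod (f x))\<^sup>2) \<le> c\<^sup>2 * measure M (space M)"
proof -
  interpret finite_measure M by fact
  have b2: "(cmod (f x))\<^sup>2 \<le> c\<^sup>2" if "x \<in> space M" for x
    using b[OF that] by (intro power_mono) auto
  then have "integrable M (\<lambda>x. (cmod (f x))\<^sup>2)"
    using f by (intro integrable_const_bound[of _ "c\<^sup>2"]) auto
  then show "f \<in> L2 M" using f by (simp add: L2_def)
  have "(LINT x|M. (cmod (f x))\<^sup>2) \<le> (LINT x|M. c\<^sup>2)"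
    using b2 \<open>integrable M (\<lambda>x. (cmod (f x))\<^sup>2)\<close> by (intro integral_mono) auto
  then show "(LINT x|M. (cmod (f x))\<^sup>2) \<le> c\<^sup>2 * measure M (space M)"
    by (simp add: mult.commute)
qed

lemma L2_integrable:
  assumes fin: "finite_measure M" and f: "f \<in> L2 M" shows "integrable M f"
proof (rule Bochner_Integration.integrable_bound)
  interpret finite_measure M by fact
  show "integrable M (\<lambda>x. 1 + (cmod (f x))\<^sup>2)" using f by (simp add: L2_def)
  show "f \<in> borel_measurable M" using assms by (simp add: L2_def)
  have "cmod (f x) \<le> 1 + (cmod (f x))\<^sup>2" for x
  proof -
    have "2 * cmod (f x) \<le> (cmod (f x))\<^sup>2 + 1" using sum_squares_bound[of "cmod (f x)" 1] by simp
    then show ?thesis using norm_ge_zero[of "f x"] by linarith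
  qed
  then show "AE x in M. norm (f x) \<le> norm (1 + (cmod (f x))\<^sup>2)" by simp
qed

lemma L2_mult_integrable:
  assumes fin: "finite_measure M" and f: "f \<in> L2 M" and k: "k \<in> borel_measurable M" "\<And>x. x \<in> space M \<Longrightarrow> cmod (k x) \<le> c"
  shows "integrable M (\<lambda>x. k x * f x)"
proof (rule Bochner_Integration.integrable_bound)
  show "integrable M (\<lambda>x. c * cmod (f x))" using L2_integrable[OF fin f] by simp
  show "(\<lambda>x. k x * f x) \<in> borel_measurable M" using f k(1) by (auto simp: L2_def)
  show "AE x in M. norm (k x * f x) \<le> norm (c * cmod (f x))"
  proof (rule AE_I2)
    fix x assume "x \<in> space M"
    then have "cmod (k x) * cmod (f x) \<le> c * cmod (f x)" by (intro mult_right_mono k) auto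
    then show "norm (k x * f x) \<le> norm (c * cmod (f x))" by (simp add: norm_mult)
  qed
qed

text \<open>A weak form of the Cauchy-Schwarz inequality: integrate |f| \<le> s + |f|^2/s and take
  for s the norm of f. If the norm is 0, s is sent to 0 instead.\<close>

lemma L1_le_L2:
  assumes fin: "finite_measure M" and f: "f \<in> L2 M"
  shows "(LINT x|M. cmod (f x)) \<le> (measure M (space M) + 1) * norm_L2 M f"
proof -
  interpret finite_measure M by fact
  define n where "n = norm_L2 M f"
  define \<mu> where "\<mu> = measure M (space M)"
  have int2: "integrable M (\<lambda>x. (cmod (f x))\<^sup>2)" using f by (simp add: L2_def)
  have n2: "n\<^sup>2 = (LINT x|M. (cmod (f x))\<^sup>2)" by (simp add: n_def norm_L2_def)
  have n0: "0 \<le> n" by (simp add: n_def norm_L2_def)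
  have \<mu>0: "0 \<le> \<mu>" by (simp add: \<mu>_def)
  have *: "(LINT x|M. cmod (f x)) \<le> s * \<mu> + n\<^sup>2 / s" if s: "s > 0" for s
  proof -
    have "cmod (f x) \<le> s + (cmod (f x))\<^sup>2 / s" for x
    proof -
      have "0 \<le> cmod (f x) * s" using s by simp
      then have "cmod (f x) * s \<le> s\<^sup>2 + (cmod (f x))\<^sup>2"
        using sum_squares_bound[of "cmod (f x)" s] by simp
      then show ?thesis using s by (simp add: field_simps power2_eq_square)
    qed
    then have "(LINT x|M. cmod (f x)) \<le> (LINT x|M. s + (cmod (f x))\<^sup>2 / s)"
      using L2_integrable[OF fin f] int2 by (intro integral_mono) auto
    also have "\<dots> = s * \<mu> + n\<^sup>2 / s" using int2 by (simp add: n2 \<mu>_def mult.commute)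
    finally show ?thesis .
  qed
  have "(LINT x|M. cmod (f x)) \<le> (\<mu> + 1) * n"
  proof (cases "n = 0")
    case True
    have "(LINT x|M. cmod (f x)) \<le> 0 + \<epsilon>" if "\<epsilon> > 0" for \<epsilon>
    proof -
      have "(LINT x|M. cmod (f x)) \<le> \<epsilon> / (\<mu> + 1) * \<mu>"
        using *[of "\<epsilon> / (\<mu> + 1)"] that \<mu>0 True by simp
      also have "\<dots> \<le> \<epsilon>" using that \<mu>0 by (simp add: field_simps)
      finally show ?thesis by simp
    qed
    then have "(LINT x|M. cmod (f x)) \<le> 0" by (rule field_le_epsilon)
    then show ?thesis using True by simp
  next
    case False
    then show ?thesis using *[of n] n0 by (simp add: power2_eq_square algebra_simps)
  qed
  then show ?thesis by (simp add: n_def \<mu>_def)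
qed

section \<open>Regularity of the fundamental solution\<close>

lemma factorial_series_summable:
  fixes c :: "nat \<Rightarrow> complex"
  assumes "\<And>k. norm (c k) \<le> 1 / fact k"
  shows "summable (\<lambda>k. c k * w ^ k)"
proof (rule summable_comparison_test'[where N = 0])
  show "summable (\<lambda>k. inverse (fact k) * norm w ^ k)" by (rule summable_exp)
  fix k
  show "norm (c k * w ^ k) \<le> inverse (fact k) * norm w ^ k"
    using mult_right_mono[OF assms[of k], of "norm w ^ k"]
    by (simp add: norm_mult norm_power inverse_eq_divide)
qed

lemma factorial_series_holomorphic:
  fixes c :: "nat \<Rightarrow> complex"
  assumes "\<And>k. norm (c k) \<le> 1 / fact k"
  shows "(\<lambda>w. \<Sum>k. c k * w ^ k) holomorphic_on UNIV"
  unfolding holomorphic_on_def field_differentiable_def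
  using termdiffs_strong_converges_everywhere[OF factorial_series_summable[OF assms]]
  by (metis has_field_derivative_at_within)

text \<open>Crude, but it bounds the coefficients of the second series in \<open>bessel_Y0\<close>
  by 1/k!.\<close>

lemma harm_le_fact: "(harm k :: real) \<le> fact k"
proof -
  have "(harm k :: real) \<le> real k"
  proof (induction k)
    case (Suc k)
    moreover have "inverse (real (Suc k)) \<le> 1" by (simp add: field_simps)
    ultimately show ?case by (simp add: harm_Suc)
  qed (simp add: harm_def)
  also have "\<dots> \<le> fact k"
    using of_nat_mono[OF fact_ge_self[of k], where ?'a = real] by simp
  finally show ?thesis .
qed

text \<open>Both power series are entire in z^2, and the logarithm of \<kappa> r/2 is that of
  \<kappa>/2 plus half the logarithm of r^2. So the fundamental solution is a function of the
  squared distance that extends holomorphically to the right half-plane, which provides the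
  derivatives. The squared distance is chosen because it is a quadratic polynomial along every
  line.\<close>

lemma green_radial:
  assumes \<kappa>: "\<kappa> \<noteq> 0"
  obtains F F1 F2 :: "real \<Rightarrow> complex" where
    "\<And>s. 0 < s \<Longrightarrow> (F has_vector_derivative F1 s) (at s)"
    "\<And>s. 0 < s \<Longrightarrow> (F1 has_vector_derivative F2 s) (at s)"
    "continuous_on {0<..} F2"
    "\<And>x y. x \<noteq> y \<Longrightarrow> green \<kappa> x y = F ((dist x y)\<^sup>2)"
proof -
  define a where "a k = ((-1) ^ k / (4 ^ k * (fact k)\<^sup>2) :: complex)" for k
  define b where "b k = ((-1) ^ k * harm k / (4 ^ k * (fact k)\<^sup>2) :: complex)" for k
  have a: "norm (a k) \<le> 1 / fact k" for k
  proof -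
    have "(1::real) * 1 \<le> 4 ^ k * fact k" by (intro mult_mono) auto
    then show ?thesis
      by (simp add: a_def norm_divide norm_mult norm_power field_simps power2_eq_square)
  qed
  have b: "norm (b k) \<le> 1 / fact k" for k
  proof -
    have "harm k * 1 \<le> fact k * (4 ^ k :: real)"
      by (intro mult_mono harm_le_fact) auto
    moreover have "norm (harm k :: complex) = harm k"
      using norm_of_real[of "harm k :: real", where ?'a = complex] harm_nonneg[of k, where ?'a = real]
      by (simp add: of_real_harm)
    ultimately show ?thesis
      by (simp add: b_def norm_divide norm_mult norm_power field_simps power2_eq_square)
  qed
  define P where "P w = (\<Sum>k. a k * w ^ k)" for w
  define Q where "Q w = (\<Sum>k. b k * w ^ k)" for w
  have PQ: "P holomorphic_on UNIV" "Q holomorphic_on UNIV"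
    unfolding P_def Q_def using a b by (auto intro!: factorial_series_holomorphic)
  have J: "bessel_J0 z = P (z\<^sup>2)" for z
  proof -
    have "(-1) ^ k * (z / 2) ^ (2 * k) / (fact k)\<^sup>2 = a k * (z\<^sup>2) ^ k" for k
      by (simp add: a_def power_mult power_divide)
    then show ?thesis by (simp add: bessel_J0_def P_def)
  qed
  have Y: "(\<Sum>k. (-1) ^ k * harm k * (z / 2) ^ (2 * k) / (fact k)\<^sup>2) = Q (z\<^sup>2)" for z
  proof -
    have "(-1) ^ k * harm k * (z / 2) ^ (2 * k) / (fact k)\<^sup>2 = b k * (z\<^sup>2) ^ k" for k
      by (simp add: b_def power_mult power_divide)
    then show ?thesis by (simp add: Q_def)
  qed
  define f where "f w = \<i> / 4 * (P (\<kappa>\<^sup>2 * w) + \<i> * (2 / of_real pi *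
    (Ln (\<kappa> / 2) + Ln w / 2 + of_real euler_mascheroni) * P (\<kappa>\<^sup>2 * w) - 2 / of_real pi * Q (\<kappa>\<^sup>2 * w)))" for w
  let ?H = "{w. 0 < Re w}"
  have opH: "open ?H" by (rule open_halfspace_Re_gt)
  have hol: "f holomorphic_on ?H"
  proof -
    have "(\<lambda>w. P (\<kappa>\<^sup>2 * w)) holomorphic_on ?H" "(\<lambda>w. Q (\<kappa>\<^sup>2 * w)) holomorphic_on ?H"
      by (auto intro!: holomorphic_on_compose_gen[OF _ PQ(1), unfolded o_def]
          holomorphic_on_compose_gen[OF _ PQ(2), unfolded o_def] holomorphic_intros)
    moreover have "Ln holomorphic_on ?H"
      by (intro holomorphic_on_Ln) (auto simp: complex_nonpos_Reals_iff)
    ultimately show ?thesis unfolding f_def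
      by (intro holomorphic_intros) (auto simp: complex_nonpos_Reals_iff)
  qed
  have hol1: "deriv f holomorphic_on ?H" by (intro holomorphic_deriv hol opH)
  have hol2: "deriv (deriv f) holomorphic_on ?H" by (intro holomorphic_deriv hol1 opH)
  show thesis
  proof (rule that[of "\<lambda>s. f (of_real s)" "\<lambda>s. deriv f (of_real s)" "\<lambda>s. deriv (deriv f) (of_real s)"])
    fix s :: real assume "0 < s"
    then show "((\<lambda>s. f (of_real s)) has_vector_derivative deriv f (of_real s)) (at s)"
      "((\<lambda>s. deriv f (of_real s)) has_vector_derivative deriv (deriv f) (of_real s)) (at s)"
      by (auto intro!: has_vector_derivative_real_field holomorphic_derivI[OF hol opH]
          holomorphic_derivI[OF hol1 opH])
  next
    show "continuous_on {0<..} (\<lambda>s. deriv (deriv f) (of_real s))"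
      by (intro continuous_on_compose2[OF holomorphic_on_imp_continuous_on[OF hol2]] continuous_intros) auto
  next
    fix x y :: "real^2" assume "x \<noteq> y"
    define r where "r = dist x y"
    have r: "0 < r" using \<open>x \<noteq> y\<close> by (simp add: r_def)
    have "Ln (\<kappa> * of_real r / 2) = Ln (of_real r * (\<kappa> / 2))" by (simp add: mult_ac)
    also have "\<dots> = of_real (ln r) + Ln (\<kappa> / 2)"
      using r \<kappa> by (subst Ln_times_of_real) (auto simp: Ln_of_real)
    finally have L: "Ln (\<kappa> * of_real r / 2) = Ln (\<kappa> / 2) + Ln (of_real (r\<^sup>2)) / 2"
      using r by (simp add: Ln_of_real ln_realpow del: of_real_power)
    show "green \<kappa> x y = f (of_real ((dist x y)\<^sup>2))"
      unfolding green_def hankel_H0_def bessel_Y0_def J Y r_def[symmetric] f_def L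
      by (simp add: power_mult_distrib)
  qed
qed

section \<open>Integrals depending on a parameter\<close>

text \<open>The mean value inequality dominates the normalised remainder of the first order
  expansion by \<open>2 * g y\<close>; dominated convergence along sequences then sends its integral
  to 0.\<close>

lemma has_vector_derivative_integral:
  fixes f f' :: "real \<Rightarrow> 'a \<Rightarrow> complex"
  assumes \<delta>: "0 < \<delta>"
    and int: "\<And>t. \<bar>t\<bar> < \<delta> \<Longrightarrow> integrable M (f t)"
    and der: "\<And>t y. \<bar>t\<bar> < \<delta> \<Longrightarrow> y \<in> space M \<Longrightarrow> ((\<lambda>t. f t y) has_vector_derivative f' t y) (at t)"
    and bound: "\<And>t y. \<bar>t\<bar> < \<delta> \<Longrightarrow> y \<in> space M \<Longrightarrow> norm (f' t y) \<le> g y"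
    and g: "integrable M g" and int': "integrable M (f' 0)"
  shows "((\<lambda>t. integral\<^sup>L M (f t)) has_vector_derivative integral\<^sup>L M (f' 0)) (at 0)"
proof -
  let ?S = "{-\<delta><..<\<delta>}"
  \<comment> \<open>Written with \<open>t - 0\<close> to match the quotient in
    \<open>has_derivative_within\<close> at the point 0.\<close>
  define q where "q t y = (1 / norm (t - 0)) *\<^sub>R (f t y - (f 0 y + (t - 0) *\<^sub>R f' 0 y))" for t y
  have q0: "((\<lambda>t. q t y) \<longlongrightarrow> 0) (at 0 within ?S)" if y: "y \<in> space M" for y
  proof -
    have "((\<lambda>t. f t y) has_derivative (\<lambda>t. t *\<^sub>R f' 0 y)) (at 0 within ?S)"
      using der[of 0 y] \<delta> y unfolding has_vector_derivative_def by (auto intro: has_derivative_at_withinI)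
    then show ?thesis unfolding has_derivative_within q_def by simp
  qed
  have qb: "norm (q t y) \<le> 2 * g y" if t: "t \<in> ?S" "t \<noteq> 0" and y: "y \<in> space M" for t y
  proof -
    have "norm (f t y - f 0 y) \<le> g y * norm (t - 0)"
    proof (rule differentiable_bound[of ?S])
      fix s assume "s \<in> ?S"
      then have s: "\<bar>s\<bar> < \<delta>" by auto
      show "((\<lambda>t. f t y) has_derivative (\<lambda>t. t *\<^sub>R f' s y)) (at s within ?S)"
        using der[OF s y] unfolding has_vector_derivative_def by (rule has_derivative_at_withinI)
      show "onorm (\<lambda>t. t *\<^sub>R f' s y) \<le> g y"
        using bound[OF s y] by (intro onorm_le) (simp add: mult.commute[of "g y"] mult_left_mono)
    qed (use t \<delta> in auto)
    moreover have "norm (t *\<^sub>R f' 0 y) \<le> \<bar>t\<bar> * g y"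
      using bound[of 0 y] \<delta> y by (simp add: mult_left_mono)
    ultimately have "norm (f t y - f 0 y - t *\<^sub>R f' 0 y) \<le> \<bar>t\<bar> * (2 * g y)"
      using norm_triangle_ineq4[of "f t y - f 0 y" "t *\<^sub>R f' 0 y"] by (simp add: mult_ac)
    then show ?thesis using t by (simp add: q_def diff_diff_eq divide_simps mult_ac)
  qed
  have qint: "integrable M (q t)" if "t \<in> ?S" for t
    unfolding q_def using that \<delta> int[of t] int[of 0] int' by (intro integrable_scaleR_right Bochner_Integration.integrable_diff Bochner_Integration.integrable_add) auto
  have "((\<lambda>t. integral\<^sup>L M (q t)) \<longlongrightarrow> 0) (at 0 within ?S)"
    unfolding tendsto_at_iff_sequentially
  proof (intro allI impI)
    fix X :: "nat \<Rightarrow> real" assume X: "\<forall>i. X i \<in> ?S - {0}" "X \<longlonglongrightarrow> 0"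
    have "(\<lambda>i. integral\<^sup>L M (q (X i))) \<longlonglongrightarrow> integral\<^sup>L M (\<lambda>y. 0)"
    proof (rule integral_dominated_convergence[where w = "\<lambda>y. 2 * g y"])
      show "q (X i) \<in> borel_measurable M" for i
        using X(1) by (intro borel_measurable_integrable qint) auto
      show "integrable M (\<lambda>y. 2 * g y)" using g by simp
      show "AE y in M. (\<lambda>i. q (X i) y) \<longlonglongrightarrow> 0"
      proof (rule AE_I2)
        fix y assume "y \<in> space M"
        then show "(\<lambda>i. q (X i) y) \<longlonglongrightarrow> 0"
          by (rule q0[unfolded tendsto_at_iff_sequentially, rule_format, of _ X, unfolded o_def])
             (use X in auto)
      qed
      show "AE y in M. norm (q (X i) y) \<le> 2 * g y" for i
        using qb[of "X i"] X(1) by (intro AE_I2) auto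
    qed simp
    then show "((\<lambda>t. integral\<^sup>L M (q t)) \<circ> X) \<longlonglongrightarrow> 0" by (simp add: o_def)
  qed
  moreover have "integral\<^sup>L M (q t) = (1 / norm (t - 0)) *\<^sub>R
      (integral\<^sup>L M (f t) - (integral\<^sup>L M (f 0) + (t - 0) *\<^sub>R integral\<^sup>L M (f' 0)))" if "t \<in> ?S" for t
  proof -
    have "integrable M (f t)" "integrable M (f 0)" using that \<delta> int by auto
    then show ?thesis unfolding q_def using int' by simp
  qed
  then have "\<forall>\<^sub>F t in at 0 within ?S. integral\<^sup>L M (q t) = (1 / norm (t - 0)) *\<^sub>R
      (integral\<^sup>L M (f t) - (integral\<^sup>L M (f 0) + (t - 0) *\<^sub>R integral\<^sup>L M (f' 0)))"
    unfolding eventually_at_filter by (intro always_eventually) auto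
  ultimately have "((\<lambda>t. (1 / norm (t - 0)) *\<^sub>R
      (integral\<^sup>L M (f t) - (integral\<^sup>L M (f 0) + (t - 0) *\<^sub>R integral\<^sup>L M (f' 0)))) \<longlongrightarrow> 0) (at 0 within ?S)"
    by (rule Lim_transform_eventually)
  then have "((\<lambda>t. integral\<^sup>L M (f t)) has_derivative (\<lambda>t. t *\<^sub>R integral\<^sup>L M (f' 0))) (at 0 within ?S)"
    unfolding has_derivative_within by (simp add: bounded_linear_scaleR_left)
  then show ?thesis
    using \<delta> by (simp add: has_vector_derivative_def at_within_open[of 0 ?S])
qed

text \<open>A continuous kernel on a compact product is bounded and uniformly continuous. Combined
  with \<open>L1_le_L2\<close> this gives a uniform bound and equicontinuity of the potentials. In
  the application \<open>X\<close> is the receiving boundary and the frontier of \<Omega> the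
  emitting one.\<close>

lemma kernel_operator_bounds:
  fixes k :: "'a :: metric_space \<Rightarrow> real^2 \<Rightarrow> complex"
  assumes \<Omega>: "open \<Omega>" "bounded \<Omega>" "C2_boundary \<Omega>" and X: "compact X"
    and k: "continuous_on (X \<times> frontier \<Omega>) (\<lambda>(x, y). k x y)"
  shows "\<And>x \<phi>. x \<in> X \<Longrightarrow> \<phi> \<in> L2 (bdry \<Omega>) \<Longrightarrow> integrable (bdry \<Omega>) (\<lambda>y. k x y * \<phi> y)"
    and "\<exists>C\<ge>0. \<forall>x\<in>X. \<forall>\<phi>\<in>L2 (bdry \<Omega>).
      cmod (LINT y|bdry \<Omega>. k x y * \<phi> y) \<le> C * norm_L2 (bdry \<Omega>) \<phi>"
    and "\<And>\<epsilon>. \<epsilon> > 0 \<Longrightarrow> \<exists>\<delta>>0. \<forall>x\<in>X. \<forall>x'\<in>X. dist x x' < \<delta> \<longrightarrow> (\<forall>\<phi>\<in>L2 (bdry \<Omega>).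
      cmod ((LINT y|bdry \<Omega>. k x y * \<phi> y) - (LINT y|bdry \<Omega>. k x' y * \<phi> y)) \<le> \<epsilon> * norm_L2 (bdry \<Omega>) \<phi>)"
proof -
  interpret finite_measure "bdry \<Omega>" using \<Omega> by (intro finite_measure_bdry)
  have fin: "finite_measure (bdry \<Omega>)" by unfold_locales
  have cF: "compact (frontier \<Omega>)" using \<Omega>(2) by (rule compact_frontier_bounded)
  have cXF: "compact (X \<times> frontier \<Omega>)" by (intro compact_Times X cF)
  have ky: "continuous_on (frontier \<Omega>) (k x)" if "x \<in> X" for x
    using that by (intro continuous_on_compose2[OF k, of _ "\<lambda>y. (x, y)", simplified] continuous_intros) auto
  have "compact ((\<lambda>(x, y). k x y) ` (X \<times> frontier \<Omega>))"
    by (intro compact_continuous_image k cXF)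
  then obtain B where "\<forall>z\<in>(\<lambda>(x, y). k x y) ` (X \<times> frontier \<Omega>). cmod z \<le> B"
    using compact_imp_bounded bounded_iff by blast
  then have B: "cmod (k x y) \<le> B" if "x \<in> X" "y \<in> frontier \<Omega>" for x y
    using that by force
  show int: "integrable (bdry \<Omega>) (\<lambda>y. k x y * \<phi> y)" if "x \<in> X" "\<phi> \<in> L2 (bdry \<Omega>)" for x \<phi>
    using that B by (intro L2_mult_integrable[OF fin] continuous_measurable_bdry ky) auto
  define m where "m = measure (bdry \<Omega>) (space (bdry \<Omega>)) + 1"
  have m: "1 \<le> m" by (simp add: m_def)
  have est: "cmod (LINT y|bdry \<Omega>. c y * \<phi> y) \<le> e * m * norm_L2 (bdry \<Omega>) \<phi>"
    if c: "\<And>y. y \<in> frontier \<Omega> \<Longrightarrow> cmod (c y) \<le> e" and e: "0 \<le> e" and \<phi>: "\<phi> \<in> L2 (bdry \<Omega>)"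
      and ci: "integrable (bdry \<Omega>) (\<lambda>y. c y * \<phi> y)" for c \<phi> e
  proof -
    have "cmod (LINT y|bdry \<Omega>. c y * \<phi> y) \<le> (LINT y|bdry \<Omega>. cmod (c y * \<phi> y))"
      by (rule integral_norm_bound)
    also have "\<dots> \<le> (LINT y|bdry \<Omega>. e * cmod (\<phi> y))"
      using L2_integrable[OF fin \<phi>] c
      by (intro integral_mono integrable_norm[OF ci]) (auto simp: norm_mult mult_right_mono)
    also have "\<dots> = e * (LINT y|bdry \<Omega>. cmod (\<phi> y))" by simp
    also have "\<dots> \<le> e * (m * norm_L2 (bdry \<Omega>) \<phi>)"
      using L1_le_L2[OF fin \<phi>] e by (intro mult_left_mono) (auto simp: m_def)
    finally show ?thesis by simp
  qed
  have "cmod (LINT y|bdry \<Omega>. k x y * \<phi> y) \<le> max B 0 * m * norm_L2 (bdry \<Omega>) \<phi>"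
    if "x \<in> X" "\<phi> \<in> L2 (bdry \<Omega>)" for x \<phi>
    using that B by (intro est int) (auto simp: le_max_iff_disj)
  moreover have "0 \<le> max B 0 * m" using m by simp
  ultimately show "\<exists>C\<ge>0. \<forall>x\<in>X. \<forall>\<phi>\<in>L2 (bdry \<Omega>).
      cmod (LINT y|bdry \<Omega>. k x y * \<phi> y) \<le> C * norm_L2 (bdry \<Omega>) \<phi>"
    by blast
  fix \<epsilon> :: real assume \<epsilon>: "\<epsilon> > 0"
  have "uniformly_continuous_on (X \<times> frontier \<Omega>) (\<lambda>(x, y). k x y)"
    by (intro compact_uniformly_continuous k cXF)
  moreover have "0 < \<epsilon> / m" using \<epsilon> m by simp
  ultimately obtain \<delta> where \<delta>: "\<delta> > 0" "\<And>z z'. z \<in> X \<times> frontier \<Omega> \<Longrightarrow> z' \<in> X \<times> frontier \<Omega> \<Longrightarrow> dist z' z < \<delta> \<Longrightarrow>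
      dist ((\<lambda>(x, y). k x y) z') ((\<lambda>(x, y). k x y) z) < \<epsilon> / m"
    unfolding uniformly_continuous_on_def using \<open>0 < \<epsilon> / m\<close> by blast
  have "cmod ((LINT y|bdry \<Omega>. k x y * \<phi> y) - (LINT y|bdry \<Omega>. k x' y * \<phi> y)) \<le> \<epsilon> * norm_L2 (bdry \<Omega>) \<phi>"
    if x: "x \<in> X" "x' \<in> X" "dist x x' < \<delta>" and \<phi>: "\<phi> \<in> L2 (bdry \<Omega>)" for x x' \<phi>
  proof -
    have eq: "(LINT y|bdry \<Omega>. k x y * \<phi> y) - (LINT y|bdry \<Omega>. k x' y * \<phi> y) =
        (LINT y|bdry \<Omega>. (k x y - k x' y) * \<phi> y)"
      using int x \<phi> by (simp add: left_diff_distrib)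
    have "cmod (k x y - k x' y) \<le> \<epsilon> / m" if "y \<in> frontier \<Omega>" for y
      using \<delta>(2)[of "(x', y)" "(x, y)"] x that by (simp add: dist_norm dist_Pair_Pair)
    moreover have "integrable (bdry \<Omega>) (\<lambda>y. (k x y - k x' y) * \<phi> y)"
      using int x \<phi> by (simp add: left_diff_distrib)
    ultimately have "cmod (LINT y|bdry \<Omega>. (k x y - k x' y) * \<phi> y) \<le> \<epsilon> / m * m * norm_L2 (bdry \<Omega>) \<phi>"
      using \<epsilon> m \<phi> by (intro est) auto
    then show ?thesis using m unfolding eq by simp
  qed
  then show "\<exists>\<delta>>0. \<forall>x\<in>X. \<forall>x'\<in>X. dist x x' < \<delta> \<longrightarrow> (\<forall>\<phi>\<in>L2 (bdry \<Omega>).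
      cmod ((LINT y|bdry \<Omega>. k x y * \<phi> y) - (LINT y|bdry \<Omega>. k x' y * \<phi> y)) \<le> \<epsilon> * norm_L2 (bdry \<Omega>) \<phi>)"
    using \<delta>(1) by blast
qed

section \<open>Layer potentials\<close>

lemma sq_dist_deriv:
  fixes x y v :: "real^2"
  shows "((\<lambda>t. (dist (x + t *\<^sub>R v) y)\<^sup>2) has_real_derivative 2 * ((x + t *\<^sub>R v - y) \<bullet> v)) (at t)"
proof -
  have eq: "(dist (x + t *\<^sub>R v) y)\<^sup>2 = (x - y) \<bullet> (x - y) + 2 * t * ((x - y) \<bullet> v) + t\<^sup>2 * (v \<bullet> v)" for t
    unfolding dist_norm power2_norm_eq_inner
    by (simp add: inner_simps inner_commute algebra_simps power2_eq_square)
  show ?thesis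
    unfolding eq by (auto intro!: derivative_eq_intros simp: inner_simps inner_commute algebra_simps)
qed

lemma radial_deriv:
  fixes x y v :: "real^2"
  assumes G: "\<And>s. 0 < s \<Longrightarrow> (G has_vector_derivative G' s) (at s)" and "x + t *\<^sub>R v \<noteq> y"
  shows "((\<lambda>t. G ((dist (x + t *\<^sub>R v) y)\<^sup>2)) has_vector_derivative
    (2 * ((x + t *\<^sub>R v - y) \<bullet> v)) *\<^sub>R G' ((dist (x + t *\<^sub>R v) y)\<^sup>2)) (at t)"
  using vector_diff_chain_at[OF sq_dist_deriv[of x v y t,
      unfolded has_real_derivative_iff_has_vector_derivative] G] assms(2)
  by (simp add: o_def)

lemma dir_deriv_eqI:
  assumes D: "((\<lambda>t. f (x + t *\<^sub>R v)) has_vector_derivative D) (at 0)"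
    and S: "open S" "x \<in> S" and eq: "\<And>z. z \<in> S \<Longrightarrow> f z = g z"
  shows "dir_deriv g x v = D"
proof -
  have "open ((\<lambda>t. x + t *\<^sub>R v) -` S)"
    by (intro open_vimage S continuous_intros)
  then have "((\<lambda>t. g (x + t *\<^sub>R v)) has_vector_derivative D) (at 0)"
    using S eq by (intro has_vector_derivative_transform_within_open[OF D]) auto
  then show ?thesis unfolding dir_deriv_def by (rule vector_derivative_at)
qed

lemma continuous_on_radial:
  assumes "continuous_on {0<..} G" "continuous_on S p" "continuous_on S q"
    and "\<And>z. z \<in> S \<Longrightarrow> p z \<noteq> q z"
  shows "continuous_on S (\<lambda>z. G ((dist (p z) (q z))\<^sup>2))"
  by (intro continuous_on_compose2[OF assms(1)] continuous_intros assms(2,3)) (use assms(4) in auto)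

text \<open>Together with \<open>scoef\<close> this lets the mixed potentials of all three boundary
  conditions share one kernel.\<close>

definition dcoef :: "real \<Rightarrow> bc \<Rightarrow> complex" where
  "dcoef \<eta> i = (if i = Dirichlet then 1 else - \<i> * of_real \<eta>)"

definition scoef :: "real \<Rightarrow> bc \<Rightarrow> complex" where
  "scoef \<eta> i = (if i = Dirichlet then \<i> * of_real \<eta> else - 1)"

lemma mixed_potential_layers:
  "mixed_potential \<kappa> \<eta> i \<Omega> \<phi> x = dcoef \<eta> i * double_layer \<kappa> \<Omega> \<phi> x + scoef \<eta> i * single_layer \<kappa> \<Omega> \<phi> x"
  by (cases i) (auto simp: dcoef_def scoef_def)

text \<open>What the approximation by operators of finite rank uses of an integral operator with
  continuous kernel.\<close>

definition regular_op ::
    "(real^2) set \<Rightarrow> (real^2) set \<Rightarrow> ((real^2 \<Rightarrow> complex) \<Rightarrow> real^2 \<Rightarrow> complex) \<Rightarrow> bool" where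
  "regular_op \<Omega> X T \<longleftrightarrow>
    (\<forall>\<phi>\<in>L2 (bdry \<Omega>). \<forall>\<psi>\<in>L2 (bdry \<Omega>). \<forall>\<omega>\<in>L2 (bdry \<Omega>). \<forall>a.
       (AE y in bdry \<Omega>. \<omega> y = a * \<phi> y + \<psi> y) \<longrightarrow> (\<forall>x\<in>X. T \<omega> x = a * T \<phi> x + T \<psi> x)) \<and>
    (\<exists>C\<ge>0. \<forall>x\<in>X. \<forall>\<phi>\<in>L2 (bdry \<Omega>). cmod (T \<phi> x) \<le> C * norm_L2 (bdry \<Omega>) \<phi>) \<and>
    (\<forall>\<epsilon>>0. \<exists>\<delta>>0. \<forall>x\<in>X. \<forall>x'\<in>X. dist x x' < \<delta> \<longrightarrow>
       (\<forall>\<phi>\<in>L2 (bdry \<Omega>). cmod (T \<phi> x - T \<phi> x') \<le> \<epsilon> * norm_L2 (bdry \<Omega>) \<phi>))"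

lemma regular_op_kernel:
  assumes \<Omega>: "open \<Omega>" "bounded \<Omega>" "C2_boundary \<Omega>" and X: "compact X"
    and k: "continuous_on (X \<times> frontier \<Omega>) (\<lambda>(x, y). k x y)"
    and T: "\<And>\<phi> x. \<phi> \<in> L2 (bdry \<Omega>) \<Longrightarrow> x \<in> X \<Longrightarrow> T \<phi> x = (LINT y|bdry \<Omega>. k x y * \<phi> y)"
  shows "regular_op \<Omega> X T"
  unfolding regular_op_def
proof (intro conjI ballI allI impI)
  note kb = kernel_operator_bounds[OF \<Omega> X k]
  fix \<phi> \<psi> \<omega> a x
  assume f: "\<phi> \<in> L2 (bdry \<Omega>)" "\<psi> \<in> L2 (bdry \<Omega>)" "\<omega> \<in> L2 (bdry \<Omega>)" and x: "x \<in> X"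
    and ae: "AE y in bdry \<Omega>. \<omega> y = a * \<phi> y + \<psi> y"
  have int: "integrable (bdry \<Omega>) (\<lambda>y. a * (k x y * \<phi> y) + k x y * \<psi> y)"
    using kb(1)[OF x] f by simp
  have "T \<omega> x = (LINT y|bdry \<Omega>. a * (k x y * \<phi> y) + k x y * \<psi> y)"
    unfolding T[OF f(3) x]
  proof (rule integral_cong_AE)
    show "AE y in bdry \<Omega>. k x y * \<omega> y = a * (k x y * \<phi> y) + k x y * \<psi> y"
      using ae by eventually_elim (simp add: algebra_simps)
  qed (use kb(1)[OF x f(3)] int in \<open>auto intro: borel_measurable_integrable\<close>)
  also have "\<dots> = a * T \<phi> x + T \<psi> x"
    using kb(1)[OF x] f x by (simp add: T)
  finally show "T \<omega> x = a * T \<phi> x + T \<psi> x" .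
next
  show "\<exists>C\<ge>0. \<forall>x\<in>X. \<forall>\<phi>\<in>L2 (bdry \<Omega>). cmod (T \<phi> x) \<le> C * norm_L2 (bdry \<Omega>) \<phi>"
    using kernel_operator_bounds(2)[OF \<Omega> X k] by (simp add: T)
next
  fix \<epsilon> :: real assume "\<epsilon> > 0"
  then show "\<exists>\<delta>>0. \<forall>x\<in>X. \<forall>x'\<in>X. dist x x' < \<delta> \<longrightarrow>
      (\<forall>\<phi>\<in>L2 (bdry \<Omega>). cmod (T \<phi> x - T \<phi> x') \<le> \<epsilon> * norm_L2 (bdry \<Omega>) \<phi>)"
    using kernel_operator_bounds(3)[OF \<Omega> X k] by (simp add: T)
qed

text \<open>Holds the outcome of \<open>green_radial\<close>: from here on the fundamental solution
  enters only as a twice differentiable function of the squared distance.\<close>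

locale radial_kernel =
  fixes \<kappa> :: complex and F F1 F2 :: "real \<Rightarrow> complex"
  assumes F: "\<And>s. 0 < s \<Longrightarrow> (F has_vector_derivative F1 s) (at s)"
    and F1: "\<And>s. 0 < s \<Longrightarrow> (F1 has_vector_derivative F2 s) (at s)"
    and F2: "continuous_on {0<..} F2"
    and green: "\<And>x y. x \<noteq> y \<Longrightarrow> green \<kappa> x y = F ((dist x y)\<^sup>2)"
begin

lemma cont_F: "continuous_on {0<..} F" and cont_F1: "continuous_on {0<..} F1"
  using F F1 by (auto intro!: continuous_at_imp_continuous_on has_vector_derivative_continuous)

end

locale obstacle = radial_kernel +
  fixes \<Omega> :: "(real^2) set"
  assumes op: "open \<Omega>" and bd: "bounded \<Omega>" and C2: "C2_boundary \<Omega>"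
begin

abbreviation "nu \<equiv> outward_normal \<Omega>"

lemma fin: "finite_measure (bdry \<Omega>)" using C2 op bd by (rule finite_measure_bdry)

lemma closed_frontier: "closed (frontier \<Omega>)" and compact_frontier: "compact (frontier \<Omega>)"
  using bd by (auto simp: compact_frontier_bounded)

text \<open>\<open>dl\<close> and \<open>mk\<close> are the kernels of the double layer and of the mixed potentials; a prime
  marks the derivative along \<open>v\<close> with respect to the first point.\<close>

definition dl :: "real^2 \<Rightarrow> real^2 \<Rightarrow> complex" where
  "dl x y = (2 * ((y - x) \<bullet> nu y)) *\<^sub>R F1 ((dist x y)\<^sup>2)"

definition dl' :: "real^2 \<Rightarrow> real^2 \<Rightarrow> real^2 \<Rightarrow> complex" where
  "dl' v x y = (2 * ((y - x) \<bullet> nu y)) *\<^sub>R ((2 * ((x - y) \<bullet> v)) *\<^sub>R F2 ((dist x y)\<^sup>2)) +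
     (- 2 * (v \<bullet> nu y)) *\<^sub>R F1 ((dist x y)\<^sup>2)"

definition mk :: "complex \<Rightarrow> complex \<Rightarrow> real^2 \<Rightarrow> real^2 \<Rightarrow> complex" where
  "mk \<alpha> \<beta> x y = \<alpha> * dl x y + \<beta> * F ((dist x y)\<^sup>2)"

definition mk' :: "complex \<Rightarrow> complex \<Rightarrow> real^2 \<Rightarrow> real^2 \<Rightarrow> real^2 \<Rightarrow> complex" where
  "mk' \<alpha> \<beta> v x y = \<alpha> * dl' v x y + \<beta> * ((2 * ((x - y) \<bullet> v)) *\<^sub>R F1 ((dist x y)\<^sup>2))"

section \<open>Derivatives and continuity of the kernels\<close>

lemma dl_line:
  assumes "x + t *\<^sub>R v \<noteq> y"
  shows "((\<lambda>t. dl (x + t *\<^sub>R v) y) has_vector_derivative dl' v (x + t *\<^sub>R v) y) (at t)"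
proof -
  have "((\<lambda>t. 2 * ((y - (x + t *\<^sub>R v)) \<bullet> nu y)) has_real_derivative - 2 * (v \<bullet> nu y)) (at t)"
    by (auto intro!: derivative_eq_intros simp: inner_simps)
  from has_vector_derivative_scaleR[OF this radial_deriv[OF F1 assms]]
  show ?thesis by (simp add: dl_def dl'_def)
qed

lemma mk_line:
  assumes "x + t *\<^sub>R v \<noteq> y"
  shows "((\<lambda>t. mk \<alpha> \<beta> (x + t *\<^sub>R v) y) has_vector_derivative mk' \<alpha> \<beta> v (x + t *\<^sub>R v) y) (at t)"
  unfolding mk_def mk'_def
  by (intro has_vector_derivative_add has_vector_derivative_mult_right dl_line radial_deriv F assms)

lemma green_dy_eq: "x \<noteq> y \<Longrightarrow> green_dy \<kappa> \<Omega> x y = dl x y"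
  unfolding green_dy_def dl_def
  using radial_deriv[OF F, of y 0 "nu y" x]
  by (intro dir_deriv_eqI[where f = "\<lambda>z. F ((dist z x)\<^sup>2)" and S = "- {x}"])
     (auto simp: green dist_commute)

lemma green_dx_eq: "x \<noteq> y \<Longrightarrow> green_dx \<kappa> \<Omega> x y = (2 * ((x - y) \<bullet> nu x)) *\<^sub>R F1 ((dist x y)\<^sup>2)"
  unfolding green_dx_def
  using radial_deriv[OF F, of x 0 "nu x" y]
  by (intro dir_deriv_eqI[where f = "\<lambda>z. F ((dist z y)\<^sup>2)" and S = "- {y}"])
     (auto simp: green dist_commute)

lemma green_dxdy_eq: "x \<noteq> y \<Longrightarrow> green_dxdy \<kappa> \<Omega> x y = dl' (nu x) x y"
  unfolding green_dxdy_def
  using dl_line[of x 0 "nu x" y]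
  by (intro dir_deriv_eqI[where f = "\<lambda>z. dl z y" and S = "- {y}"]) (auto simp: green_dy_eq)

lemma continuous_on_nu:
  "continuous_on S q \<Longrightarrow> (\<And>z. z \<in> S \<Longrightarrow> q z \<in> frontier \<Omega>) \<Longrightarrow> continuous_on S (\<lambda>z. nu (q z))"
  by (rule continuous_on_compose2[OF continuous_on_outward_normal[OF C2 op]]) auto

lemma continuous_on_dl':
  assumes "continuous_on S p" "continuous_on S q" "continuous_on S v"
    "\<And>z. z \<in> S \<Longrightarrow> q z \<in> frontier \<Omega>" "\<And>z. z \<in> S \<Longrightarrow> p z \<noteq> q z"
  shows "continuous_on S (\<lambda>z. dl' (v z) (p z) (q z))"
  unfolding dl'_def
  by (intro continuous_intros continuous_on_radial[OF cont_F1] continuous_on_radial[OF F2] continuous_on_nu assms)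

lemma continuous_on_dl:
  assumes "continuous_on S p" "continuous_on S q"
    "\<And>z. z \<in> S \<Longrightarrow> q z \<in> frontier \<Omega>" "\<And>z. z \<in> S \<Longrightarrow> p z \<noteq> q z"
  shows "continuous_on S (\<lambda>z. dl (p z) (q z))"
  unfolding dl_def
  by (intro continuous_intros continuous_on_radial[OF cont_F1] continuous_on_nu assms)

lemma continuous_on_mk:
  assumes "continuous_on S p" "continuous_on S q"
    "\<And>z. z \<in> S \<Longrightarrow> q z \<in> frontier \<Omega>" "\<And>z. z \<in> S \<Longrightarrow> p z \<noteq> q z"
  shows "continuous_on S (\<lambda>z. mk \<alpha> \<beta> (p z) (q z))"
  unfolding mk_def
  by (intro continuous_intros continuous_on_radial[OF cont_F] continuous_on_dl assms)

lemma continuous_on_mk':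
  assumes "continuous_on S p" "continuous_on S q" "continuous_on S v"
    "\<And>z. z \<in> S \<Longrightarrow> q z \<in> frontier \<Omega>" "\<And>z. z \<in> S \<Longrightarrow> p z \<noteq> q z"
  shows "continuous_on S (\<lambda>z. mk' \<alpha> \<beta> (v z) (p z) (q z))"
  unfolding mk'_def
  by (intro continuous_intros continuous_on_radial[OF cont_F1] continuous_on_dl' assms)

section \<open>Potentials off the boundary as integrals\<close>

lemma kernel_integrable:
  assumes "continuous_on (frontier \<Omega>) k" "\<phi> \<in> L2 (bdry \<Omega>)"
  shows "integrable (bdry \<Omega>) (\<lambda>y. k y * \<phi> y)"
proof -
  \<comment> \<open>A single kernel function is treated as a family over a parameter space with one
    point.\<close>
  have "continuous_on ({0::real} \<times> frontier \<Omega>) (\<lambda>(x, y). k y)"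
    unfolding split_def by (intro continuous_on_compose2[OF assms(1)] continuous_intros) auto
  from kernel_operator_bounds(1)[OF op bd C2 _ this] assms(2) show ?thesis by simp
qed

lemma mixed_potential_eq:
  assumes x: "x \<notin> frontier \<Omega>" and \<phi>: "\<phi> \<in> L2 (bdry \<Omega>)"
  shows "mixed_potential \<kappa> \<eta> i \<Omega> \<phi> x = (LINT y|bdry \<Omega>. mk (dcoef \<eta> i) (scoef \<eta> i) x y * \<phi> y)"
proof -
  have ne: "x \<noteq> y" if "y \<in> frontier \<Omega>" for y using x that by blast
  have "double_layer \<kappa> \<Omega> \<phi> x = (LINT y|bdry \<Omega>. dl x y * \<phi> y)"
    unfolding double_layer_def
    by (intro Bochner_Integration.integral_cong refl) (simp add: green_dy_eq[OF ne])
  moreover have "single_layer \<kappa> \<Omega> \<phi> x = (LINT y|bdry \<Omega>. F ((dist x y)\<^sup>2) * \<phi> y)"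
    unfolding single_layer_def
    by (intro Bochner_Integration.integral_cong refl) (simp add: green[OF ne])
  moreover have "integrable (bdry \<Omega>) (\<lambda>y. dl x y * \<phi> y)" "integrable (bdry \<Omega>) (\<lambda>y. F ((dist x y)\<^sup>2) * \<phi> y)"
    using x \<phi> by (auto intro!: kernel_integrable continuous_on_dl continuous_on_radial[OF cont_F] continuous_intros)
  ultimately show ?thesis
    by (simp add: mixed_potential_layers mk_def distrib_right mult.assoc)
qed

text \<open>Off the boundary the kernel is smooth along a short segment through x, so the derivative
  passes under the integral. The dominating function is |\<phi>| times a bound of the differentiated
  kernel on the compact set of segment points and boundary points.\<close>

lemma dir_deriv_mixed_potential:
  assumes x: "x \<notin> frontier \<Omega>" and \<phi>: "\<phi> \<in> L2 (bdry \<Omega>)"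
  shows "dir_deriv (mixed_potential \<kappa> \<eta> i \<Omega> \<phi>) x v =
    (LINT y|bdry \<Omega>. mk' (dcoef \<eta> i) (scoef \<eta> i) v x y * \<phi> y)"
proof (rule dir_deriv_eqI)
  let ?mk = "mk (dcoef \<eta> i) (scoef \<eta> i)" and ?mk' = "mk' (dcoef \<eta> i) (scoef \<eta> i)"
  show "open (- frontier \<Omega>)" "x \<in> - frontier \<Omega>" using closed_frontier x by auto
  show "z \<in> - frontier \<Omega> \<Longrightarrow> (LINT y|bdry \<Omega>. ?mk z y * \<phi> y) = mixed_potential \<kappa> \<eta> i \<Omega> \<phi> z" for z
    using mixed_potential_eq[OF _ \<phi>] by simp
  obtain e where e: "e > 0" "ball x e \<subseteq> - frontier \<Omega>"
    using \<open>open (- frontier \<Omega>)\<close> \<open>x \<in> - frontier \<Omega>\<close> open_contains_ball by blast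
  \<comment> \<open>Adding 1 keeps \<open>c\<close> positive for v = 0; the 2 in \<delta> keeps the
    closed segment inside the open ball.\<close>
  define c where "c = norm v + 1"
  have c: "0 < c" by (simp add: c_def add_nonneg_pos)
  define \<delta> where "\<delta> = e / (2 * c)"
  have \<delta>: "\<delta> > 0" using e c by (simp add: \<delta>_def)
  have off: "x + t *\<^sub>R v \<notin> frontier \<Omega>" if t: "\<bar>t\<bar> \<le> \<delta>" for t
  proof -
    have "\<bar>t\<bar> * norm v \<le> \<delta> * c"
      using t \<delta> by (intro mult_mono) (auto simp: c_def)
    also have "\<dots> = e / 2" using c by (simp add: \<delta>_def)
    finally have "x + t *\<^sub>R v \<in> ball x e" using e by (simp add: dist_norm)
    then show ?thesis using e by blast
  qed
  have ne: "x + t *\<^sub>R v \<noteq> y" if "\<bar>t\<bar> \<le> \<delta>" "y \<in> frontier \<Omega>" for t y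
    using off that by blast
  have "continuous_on ({-\<delta>..\<delta>} \<times> frontier \<Omega>) (\<lambda>z. ?mk' v (x + fst z *\<^sub>R v) (snd z))"
    by (intro continuous_on_mk' continuous_intros) (use ne in force)+
  then have "compact ((\<lambda>z. ?mk' v (x + fst z *\<^sub>R v) (snd z)) ` ({-\<delta>..\<delta>} \<times> frontier \<Omega>))"
    by (intro compact_continuous_image compact_Times compact_frontier) auto
  then obtain B where "\<forall>w\<in>(\<lambda>z. ?mk' v (x + fst z *\<^sub>R v) (snd z)) ` ({-\<delta>..\<delta>} \<times> frontier \<Omega>). norm w \<le> B"
    using compact_imp_bounded bounded_iff by blast
  then have B: "norm (?mk' v (x + t *\<^sub>R v) y) \<le> B" if "\<bar>t\<bar> \<le> \<delta>" "y \<in> frontier \<Omega>" for t y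
    using that by (force simp: abs_le_iff)
  have "((\<lambda>t. LINT y|bdry \<Omega>. ?mk (x + t *\<^sub>R v) y * \<phi> y) has_vector_derivative
      (LINT y|bdry \<Omega>. ?mk' v (x + 0 *\<^sub>R v) y * \<phi> y)) (at 0)"
  proof (rule has_vector_derivative_integral[OF \<delta>,
        where f = "\<lambda>t y. ?mk (x + t *\<^sub>R v) y * \<phi> y" and f' = "\<lambda>t y. ?mk' v (x + t *\<^sub>R v) y * \<phi> y"
          and g = "\<lambda>y. B * norm (\<phi> y)"])
    show "integrable (bdry \<Omega>) (\<lambda>y. ?mk (x + t *\<^sub>R v) y * \<phi> y)" if "\<bar>t\<bar> < \<delta>" for t
      using that \<phi> ne[of t] by (intro kernel_integrable continuous_on_mk continuous_intros) auto
    show "integrable (bdry \<Omega>) (\<lambda>y. ?mk' v (x + 0 *\<^sub>R v) y * \<phi> y)"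
      using \<delta> \<phi> ne[of 0] by (intro kernel_integrable continuous_on_mk' continuous_intros) auto
    show "integrable (bdry \<Omega>) (\<lambda>y. B * norm (\<phi> y))"
      using L2_integrable[OF fin \<phi>] by simp
    fix t y assume t: "\<bar>t\<bar> < \<delta>" and y: "y \<in> space (bdry \<Omega>)"
    show "((\<lambda>t. ?mk (x + t *\<^sub>R v) y * \<phi> y) has_vector_derivative ?mk' v (x + t *\<^sub>R v) y * \<phi> y) (at t)"
      using t y by (intro has_vector_derivative_mult_left mk_line ne) auto
    show "norm (?mk' v (x + t *\<^sub>R v) y * \<phi> y) \<le> B * norm (\<phi> y)"
      using B[of t y] t y by (simp add: norm_mult mult_right_mono)
  qed
  then show "((\<lambda>t. LINT y|bdry \<Omega>. ?mk (x + t *\<^sub>R v) y * \<phi> y) has_vector_derivative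
      (LINT y|bdry \<Omega>. ?mk' v x y * \<phi> y)) (at 0)"
    by simp
qed

lemma regular_op_mixed_potential:
  assumes "compact X" "X \<inter> frontier \<Omega> = {}"
  shows "regular_op \<Omega> X (mixed_potential \<kappa> \<eta> i \<Omega>)"
proof (rule regular_op_kernel[OF op bd C2 assms(1), where k = "mk (dcoef \<eta> i) (scoef \<eta> i)"])
  show "continuous_on (X \<times> frontier \<Omega>) (\<lambda>(x, y). mk (dcoef \<eta> i) (scoef \<eta> i) x y)"
    unfolding split_def using assms(2) by (intro continuous_on_mk continuous_intros) auto
qed (use assms in \<open>auto intro: mixed_potential_eq\<close>)

lemma regular_op_dir_deriv_mixed_potential:
  assumes "compact X" "X \<inter> frontier \<Omega> = {}" "continuous_on X v"
  shows "regular_op \<Omega> X (\<lambda>\<phi> x. dir_deriv (mixed_potential \<kappa> \<eta> i \<Omega> \<phi>) x (v x))"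
proof (rule regular_op_kernel[OF op bd C2 assms(1), where k = "\<lambda>x. mk' (dcoef \<eta> i) (scoef \<eta> i) (v x) x"])
  show "continuous_on (X \<times> frontier \<Omega>) (\<lambda>(x, y). mk' (dcoef \<eta> i) (scoef \<eta> i) (v x) x y)"
    unfolding split_def using assms(2)
    by (intro continuous_on_mk' continuous_intros continuous_on_compose2[OF assms(3)]) auto
qed (use assms in \<open>auto intro: dir_deriv_mixed_potential\<close>)

section \<open>Linearity of the solution operator\<close>

text \<open>Truncated integrals stay away from the diagonal, so this continuity serves principal
  values and finite parts alike, however strong the singularity at x.\<close>

lemma kernels_continuous:
  shows "continuous_on (frontier \<Omega> - {x}) (green \<kappa> x)"
    "continuous_on (frontier \<Omega> - {x}) (green_dy \<kappa> \<Omega> x)"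
    "continuous_on (frontier \<Omega> - {x}) (green_dx \<kappa> \<Omega> x)"
    "continuous_on (frontier \<Omega> - {x}) (green_dxdy \<kappa> \<Omega> x)"
proof -
  let ?S = "frontier \<Omega> - {x}"
  have "continuous_on ?S (\<lambda>y. F ((dist x y)\<^sup>2))"
    by (intro continuous_on_radial[OF cont_F] continuous_intros) auto
  then show "continuous_on ?S (green \<kappa> x)"
    by (rule continuous_on_eq) (use green[of x] in auto)
  have "continuous_on ?S (\<lambda>y. dl x y)"
    by (intro continuous_on_dl continuous_intros) auto
  then show "continuous_on ?S (green_dy \<kappa> \<Omega> x)"
    by (rule continuous_on_eq) (use green_dy_eq[of x] in auto)
  have "continuous_on ?S (\<lambda>y. (2 * ((x - y) \<bullet> nu x)) *\<^sub>R F1 ((dist x y)\<^sup>2))"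
    by (intro continuous_intros continuous_on_radial[OF cont_F1]) auto
  then show "continuous_on ?S (green_dx \<kappa> \<Omega> x)"
    by (rule continuous_on_eq) (use green_dx_eq[of x] in auto)
  have "continuous_on ?S (\<lambda>y. dl' (nu x) x y)"
    by (intro continuous_on_dl' continuous_intros) auto
  then show "continuous_on ?S (green_dxdy \<kappa> \<Omega> x)"
    by (rule continuous_on_eq) (use green_dxdy_eq[of x] in auto)
qed

lemma truncated_integrable:
  assumes k: "continuous_on (frontier \<Omega> - {x}) (k x)" and \<phi>: "\<phi> \<in> L2 (bdry \<Omega>)" and \<epsilon>: "0 < \<epsilon>"
  shows "integrable (bdry \<Omega>) (\<lambda>y. indicator {y. \<epsilon> < dist x y} y *\<^sub>R (k x y * \<phi> y))"
proof -
  \<comment> \<open>The integrand lives on \<open>?A\<close>; the kernel is bounded there because it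
    is continuous on the larger set \<open>?C\<close>, which is compact and avoids x.\<close>
  let ?A = "frontier \<Omega> \<inter> {y. \<epsilon> < dist x y}" and ?C = "frontier \<Omega> \<inter> {y. \<epsilon> \<le> dist x y}"
  have "compact ?C"
    by (intro compact_Int_closed compact_frontier closed_Collect_le continuous_intros)
  moreover have "continuous_on ?C (k x)"
    using \<epsilon> by (intro continuous_on_subset[OF k]) auto
  ultimately have "compact (k x ` ?C)" by (intro compact_continuous_image)
  then obtain B where B: "\<forall>w\<in>k x ` ?C. norm w \<le> B"
    using compact_imp_bounded bounded_iff by blast
  have "open {y. \<epsilon> < dist x y}" by (intro open_Collect_less continuous_intros)
  then have "?A \<in> sets borel" using closed_frontier by auto
  moreover have "continuous_on ?A (k x)" using \<epsilon> by (intro continuous_on_subset[OF k]) auto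
  ultimately have "(\<lambda>y. indicator ?A y *\<^sub>R k x y) \<in> borel_measurable borel"
    by (rule borel_measurable_continuous_on_indicator)
  then have meas: "(\<lambda>y. indicator ?A y *\<^sub>R k x y) \<in> borel_measurable (bdry \<Omega>)"
    by (rule borel_measurable_bdry)
  have "integrable (bdry \<Omega>) (\<lambda>y. (indicator ?A y *\<^sub>R k x y) * \<phi> y)"
    using B by (intro L2_mult_integrable[OF fin \<phi> meas, of "max B 0"])
      (auto simp: indicator_def le_max_iff_disj)
  then show ?thesis
    by (rule Bochner_Integration.integrable_cong[OF refl, THEN iffD1, rotated])
       (auto simp: indicator_def)
qed

lemma truncated_integral_lin:
  assumes k: "continuous_on (frontier \<Omega> - {x}) (k x)"
    and f: "\<phi> \<in> L2 (bdry \<Omega>)" "\<psi> \<in> L2 (bdry \<Omega>)" and \<epsilon>: "0 < \<epsilon>"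
  shows "truncated_integral \<Omega> k (\<lambda>y. a * \<phi> y + \<psi> y) x \<epsilon> =
    a * truncated_integral \<Omega> k \<phi> x \<epsilon> + truncated_integral \<Omega> k \<psi> x \<epsilon>"
proof -
  have eq: "indicator {y. \<epsilon> < dist x y} y *\<^sub>R (k x y * (a * \<phi> y + \<psi> y)) =
      a * (indicator {y. \<epsilon> < dist x y} y *\<^sub>R (k x y * \<phi> y)) +
      indicator {y. \<epsilon> < dist x y} y *\<^sub>R (k x y * \<psi> y)" for y
    by (simp add: algebra_simps)
  show ?thesis
    unfolding truncated_integral_def eq
    using truncated_integrable[of x k, OF k _ \<epsilon>] f by (simp del: mult_scaleR_right)
qed

lemma finite_part_lin:
  assumes k: "continuous_on (frontier \<Omega> - {x}) (k x)"
    and f: "\<phi> \<in> L2 (bdry \<Omega>)" "\<psi> \<in> L2 (bdry \<Omega>)"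
    and L: "has_finite_part \<Omega> k \<phi> x L" "has_finite_part \<Omega> k \<psi> x L'"
  shows "has_finite_part \<Omega> k (\<lambda>y. a * \<phi> y + \<psi> y) x (a * L + L')"
proof -
  obtain c c' where c: "((\<lambda>\<epsilon>. truncated_integral \<Omega> k \<phi> x \<epsilon> - c / of_real \<epsilon>) \<longlongrightarrow> L) (at_right 0)"
    "((\<lambda>\<epsilon>. truncated_integral \<Omega> k \<psi> x \<epsilon> - c' / of_real \<epsilon>) \<longlongrightarrow> L') (at_right 0)"
    using L by (auto simp: has_finite_part_def)
  have "((\<lambda>\<epsilon>. a * (truncated_integral \<Omega> k \<phi> x \<epsilon> - c / of_real \<epsilon>) +
      (truncated_integral \<Omega> k \<psi> x \<epsilon> - c' / of_real \<epsilon>)) \<longlongrightarrow> a * L + L') (at_right 0)"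
    by (intro tendsto_intros c)
  moreover have "\<forall>\<^sub>F \<epsilon> in at_right 0. a * (truncated_integral \<Omega> k \<phi> x \<epsilon> - c / of_real \<epsilon>) +
      (truncated_integral \<Omega> k \<psi> x \<epsilon> - c' / of_real \<epsilon>) =
      truncated_integral \<Omega> k (\<lambda>y. a * \<phi> y + \<psi> y) x \<epsilon> - (a * c + c') / of_real \<epsilon>"
    using eventually_at_right_less[of 0]
    by eventually_elim
      (simp add: truncated_integral_lin[of x k, OF k f], simp add: algebra_simps add_divide_distrib)
  ultimately show ?thesis
    unfolding has_finite_part_def by (blast intro: Lim_transform_eventually)
qed

lemma principal_value_lin:
  assumes k: "continuous_on (frontier \<Omega> - {x}) (k x)"
    and f: "\<phi> \<in> L2 (bdry \<Omega>)" "\<psi> \<in> L2 (bdry \<Omega>)"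
    and L: "has_principal_value \<Omega> k \<phi> x L" "has_principal_value \<Omega> k \<psi> x L'"
  shows "has_principal_value \<Omega> k (\<lambda>y. a * \<phi> y + \<psi> y) x (a * L + L')"
proof -
  have "((\<lambda>\<epsilon>. a * truncated_integral \<Omega> k \<phi> x \<epsilon> + truncated_integral \<Omega> k \<psi> x \<epsilon>) \<longlongrightarrow> a * L + L') (at_right 0)"
    using L unfolding has_principal_value_def by (intro tendsto_intros)
  moreover have "\<forall>\<^sub>F \<epsilon> in at_right 0. a * truncated_integral \<Omega> k \<phi> x \<epsilon> + truncated_integral \<Omega> k \<psi> x \<epsilon> =
      truncated_integral \<Omega> k (\<lambda>y. a * \<phi> y + \<psi> y) x \<epsilon>"
    using eventually_at_right_less[of 0]
    by eventually_elim (simp add: truncated_integral_lin[of x k, OF k f])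
  ultimately show ?thesis
    unfolding has_principal_value_def by (rule Lim_transform_eventually)
qed

lemma boundary_eq_lin:
  assumes f: "\<phi> \<in> L2 (bdry \<Omega>)" "\<psi> \<in> L2 (bdry \<Omega>)"
    and e: "boundary_eq \<kappa> \<eta> h i \<Omega> \<phi> W x" "boundary_eq \<kappa> \<eta> h i \<Omega> \<psi> W' x"
  shows "boundary_eq \<kappa> \<eta> h i \<Omega> (\<lambda>y. a * \<phi> y + \<psi> y) (\<lambda>y. a * W y + W' y) x"
proof (cases i)
  case Dirichlet
  obtain s d s' d' where sd: "has_principal_value \<Omega> (green \<kappa>) \<phi> x s" "has_principal_value \<Omega> (green \<kappa>) \<psi> x s'"
    "has_principal_value \<Omega> (green_dy \<kappa> \<Omega>) \<phi> x d" "has_principal_value \<Omega> (green_dy \<kappa> \<Omega>) \<psi> x d'"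
    and eqs: "1 / 2 * \<phi> x + d + \<i> * of_real \<eta> * s = W x" "1 / 2 * \<psi> x + d' + \<i> * of_real \<eta> * s' = W' x"
    using e by (auto simp: Dirichlet)
  show ?thesis
    unfolding Dirichlet boundary_eq.simps eqs[symmetric]
    using sd f by (intro exI[of _ "a * s + s'"] exI[of _ "a * d + d'"] conjI principal_value_lin kernels_continuous)
      (simp_all add: algebra_simps)
next
  case Neumann
  obtain d n d' n' where sd: "has_principal_value \<Omega> (green_dx \<kappa> \<Omega>) \<phi> x d" "has_principal_value \<Omega> (green_dx \<kappa> \<Omega>) \<psi> x d'"
    "\<eta> \<noteq> 0 \<longrightarrow> has_finite_part \<Omega> (green_dxdy \<kappa> \<Omega>) \<phi> x n" "\<eta> \<noteq> 0 \<longrightarrow> has_finite_part \<Omega> (green_dxdy \<kappa> \<Omega>) \<psi> x n'"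
    and eqs: "1 / 2 * \<phi> x - \<i> * of_real \<eta> * n - d = W x" "1 / 2 * \<psi> x - \<i> * of_real \<eta> * n' - d' = W' x"
    using e by (auto simp: Neumann)
  show ?thesis
    unfolding Neumann boundary_eq.simps eqs[symmetric]
    using sd f by (intro exI[of _ "a * d + d'"] exI[of _ "a * n + n'"] conjI impI
        principal_value_lin finite_part_lin kernels_continuous)
      (simp_all add: algebra_simps)
next
  case Robin
  obtain s s' d d' dx dx' n n' where sd:
    "has_principal_value \<Omega> (green \<kappa>) \<phi> x s" "has_principal_value \<Omega> (green \<kappa>) \<psi> x s'"
    "has_principal_value \<Omega> (green_dy \<kappa> \<Omega>) \<phi> x d" "has_principal_value \<Omega> (green_dy \<kappa> \<Omega>) \<psi> x d'"
    "has_principal_value \<Omega> (green_dx \<kappa> \<Omega>) \<phi> x dx" "has_principal_value \<Omega> (green_dx \<kappa> \<Omega>) \<psi> x dx'"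
    "\<eta> \<noteq> 0 \<longrightarrow> has_finite_part \<Omega> (green_dxdy \<kappa> \<Omega>) \<phi> x n" "\<eta> \<noteq> 0 \<longrightarrow> has_finite_part \<Omega> (green_dxdy \<kappa> \<Omega>) \<psi> x n'"
    and eqs: "1 / 2 * \<phi> x - \<i> * of_real \<eta> * (h x * d + n) - (h x * s + dx) - \<i> / 2 * of_real \<eta> * h x * \<phi> x = W x"
      "1 / 2 * \<psi> x - \<i> * of_real \<eta> * (h x * d' + n') - (h x * s' + dx') - \<i> / 2 * of_real \<eta> * h x * \<psi> x = W' x"
    using e unfolding Robin boundary_eq.simps by blast
  show ?thesis
    unfolding Robin boundary_eq.simps eqs[symmetric]
    using sd f by (intro exI[of _ "a * s + s'"] exI[of _ "a * d + d'"] exI[of _ "a * dx + dx'"]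
        exI[of _ "a * n + n'"] conjI impI principal_value_lin finite_part_lin kernels_continuous)
      (simp_all add: algebra_simps)
qed

text \<open>The weak tangential derivatives combine in the same way as the functions. Continuity of
  the normal makes the integrands with test functions integrable, so that the integrals
  split.\<close>

lemma H1_lin:
  assumes "\<phi> \<in> H1 \<Omega>" "\<phi>' \<in> H1 \<Omega>"
  shows "(\<lambda>x. a * \<phi> x + \<phi>' x) \<in> H1 \<Omega>"
proof -
  obtain \<psi> \<psi>' where f: "\<phi> \<in> L2 (bdry \<Omega>)" "\<phi>' \<in> L2 (bdry \<Omega>)" "\<psi> \<in> L2 (bdry \<Omega>)" "\<psi>' \<in> L2 (bdry \<Omega>)"
    and weak: "\<And>v v'. (\<And>x. (v has_derivative blinfun_apply (v' x)) (at x)) \<Longrightarrow> continuous_on UNIV v' \<Longrightarrow>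
       (LINT y|bdry \<Omega>. \<phi> y * of_real (blinfun_apply (v' y) (perp (nu y)))) = - (LINT y|bdry \<Omega>. \<psi> y * of_real (v y))"
      "\<And>v v'. (\<And>x. (v has_derivative blinfun_apply (v' x)) (at x)) \<Longrightarrow> continuous_on UNIV v' \<Longrightarrow>
       (LINT y|bdry \<Omega>. \<phi>' y * of_real (blinfun_apply (v' y) (perp (nu y)))) = - (LINT y|bdry \<Omega>. \<psi>' y * of_real (v y))"
    using assms unfolding H1_def by blast
  have key: "(LINT y|bdry \<Omega>. (a * \<phi> y + \<phi>' y) * of_real (blinfun_apply (v' y) (perp (nu y)))) =
       - (LINT y|bdry \<Omega>. (a * \<psi> y + \<psi>' y) * of_real (v y))"
    if v: "\<And>x. (v has_derivative blinfun_apply (v' x)) (at x)" "continuous_on UNIV v'" for v v'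
  proof -
    have perp: "continuous_on UNIV perp"
      by (intro linear_continuous_on linear_conv_bounded_linear[THEN iffD1] linearI)
         (simp_all add: perp_def vec_eq_iff forall_2)
    have c1: "continuous_on (frontier \<Omega>) (\<lambda>y. of_real (blinfun_apply (v' y) (perp (nu y))) :: complex)"
      by (intro continuous_intros continuous_on_compose2[OF perp] continuous_on_nu continuous_on_subset[OF v(2)]) auto
    have int1: "integrable (bdry \<Omega>) (\<lambda>y. \<omega> y * of_real (blinfun_apply (v' y) (perp (nu y))))"
      if "\<omega> \<in> L2 (bdry \<Omega>)" for \<omega>
      using kernel_integrable[OF c1 that] by (simp add: mult.commute)
    have c2: "continuous_on (frontier \<Omega>) (\<lambda>y. of_real (v y) :: complex)"
      using v(1) by (intro continuous_intros continuous_at_imp_continuous_on) (auto intro: has_derivative_continuous)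
    have int2: "integrable (bdry \<Omega>) (\<lambda>y. \<omega> y * of_real (v y))"
      if "\<omega> \<in> L2 (bdry \<Omega>)" for \<omega>
      using kernel_integrable[OF c2 that] by (simp add: mult.commute)
    have "(LINT y|bdry \<Omega>. (a * \<phi> y + \<phi>' y) * of_real (blinfun_apply (v' y) (perp (nu y)))) =
        a * (LINT y|bdry \<Omega>. \<phi> y * of_real (blinfun_apply (v' y) (perp (nu y)))) +
        (LINT y|bdry \<Omega>. \<phi>' y * of_real (blinfun_apply (v' y) (perp (nu y))))"
      using int1 f by (simp add: distrib_right mult.assoc)
    also have "\<dots> = - (a * (LINT y|bdry \<Omega>. \<psi> y * of_real (v y)) + (LINT y|bdry \<Omega>. \<psi>' y * of_real (v y)))"
      using weak(1)[OF v] weak(2)[OF v] by simp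
    also have "\<dots> = - (LINT y|bdry \<Omega>. (a * \<psi> y + \<psi>' y) * of_real (v y))"
      using int2 f by (simp add: distrib_right mult.assoc)
    finally show ?thesis .
  qed
  show ?thesis
    unfolding H1_def mem_Collect_eq
    by (intro conjI bexI[of _ "\<lambda>y. a * \<psi> y + \<psi>' y"] allI impI key L2_lin f) auto
qed

lemma density_space_L2: "\<phi> \<in> density_space \<eta> i \<Omega> \<Longrightarrow> \<phi> \<in> L2 (bdry \<Omega>)"
  by (auto simp: density_space_def H1_def split: if_splits)

lemma solves_bie_lin:
  assumes s: "solves_bie \<kappa> \<eta> h i \<Omega> W \<phi>" "solves_bie \<kappa> \<eta> h i \<Omega> W' \<psi>"
  shows "solves_bie \<kappa> \<eta> h i \<Omega> (\<lambda>y. a * W y + W' y) (\<lambda>y. a * \<phi> y + \<psi> y)"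
proof -
  have d: "\<phi> \<in> density_space \<eta> i \<Omega>" "\<psi> \<in> density_space \<eta> i \<Omega>"
    and ae: "AE x in bdry \<Omega>. boundary_eq \<kappa> \<eta> h i \<Omega> \<phi> W x" "AE x in bdry \<Omega>. boundary_eq \<kappa> \<eta> h i \<Omega> \<psi> W' x"
    using s by (auto simp: solves_bie_def)
  have "(\<lambda>y. a * \<phi> y + \<psi> y) \<in> density_space \<eta> i \<Omega>"
    using d by (auto simp: density_space_def H1_lin L2_lin split: if_splits)
  moreover have "AE x in bdry \<Omega>. boundary_eq \<kappa> \<eta> h i \<Omega> (\<lambda>y. a * \<phi> y + \<psi> y) (\<lambda>y. a * W y + W' y) x"
    using ae by eventually_elim (intro boundary_eq_lin density_space_L2[OF d(1)] density_space_L2[OF d(2)])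
  ultimately show ?thesis by (simp add: solves_bie_def)
qed

text \<open>The choice in \<open>solution_op\<close> fixes no particular representative, so
  linearity can hold only almost everywhere; it follows from uniqueness, since the combination of
  two solutions solves the combined equation.\<close>

lemma solution_op_lin:
  assumes b: "bounded_solution_op \<kappa> \<eta> h i \<Omega>" and W: "W \<in> L2 (bdry \<Omega>)" "W' \<in> L2 (bdry \<Omega>)"
  shows "solution_op \<kappa> \<eta> h i \<Omega> W \<in> L2 (bdry \<Omega>)"
    and "AE y in bdry \<Omega>. solution_op \<kappa> \<eta> h i \<Omega> (\<lambda>y. a * W y + W' y) y =
      a * solution_op \<kappa> \<eta> h i \<Omega> W y + solution_op \<kappa> \<eta> h i \<Omega> W' y"
proof -
  note b' = b[unfolded bounded_solution_op_def]
  note ex = conjunct1[OF b'] and uniq = conjunct1[OF conjunct2[OF b']]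
  have sol: "solves_bie \<kappa> \<eta> h i \<Omega> W (solution_op \<kappa> \<eta> h i \<Omega> W)" if "W \<in> L2 (bdry \<Omega>)" for W
    unfolding solution_op_def using someI_ex[OF ex[rule_format, OF that]] .
  show "solution_op \<kappa> \<eta> h i \<Omega> W \<in> L2 (bdry \<Omega>)"
    using sol[OF W(1)] unfolding solves_bie_def by (elim conjE density_space_L2)
  show "AE y in bdry \<Omega>. solution_op \<kappa> \<eta> h i \<Omega> (\<lambda>y. a * W y + W' y) y =
      a * solution_op \<kappa> \<eta> h i \<Omega> W y + solution_op \<kappa> \<eta> h i \<Omega> W' y"
    by (rule uniq[rule_format, OF L2_lin[OF W, of a]])
       (intro conjI sol[OF L2_lin[OF W, of a]] solves_bie_lin sol W)
qed

end

section \<open>Numbering the eigenvalues\<close>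

text \<open>The elements other than 1 are ordered by decreasing distance from 1. By
  \<open>fin\<close> each of them has finitely many predecessors, because these are at least as far
  from 1, and the number of predecessors serves as its position.\<close>

lemma eigenvalue_numbering_exists:
  assumes fin: "\<And>r. 0 < r \<Longrightarrow> finite {z \<in> E. r < cmod (z - 1)}"
  shows "countable E" "\<exists>N \<Lambda>. eigenvalue_numbering E N \<Lambda>"
proof -
  define E' where "E' = E - {1}"
  have "E \<subseteq> {1} \<union> (\<Union>n. {z \<in> E. inverse (real (Suc n)) < cmod (z - 1)})"
  proof
    fix z assume z: "z \<in> E"
    show "z \<in> {1} \<union> (\<Union>n. {z \<in> E. inverse (real (Suc n)) < cmod (z - 1)})"
    proof (cases "z = 1")
      case False
      then show ?thesis using z reals_Archimedean[of "cmod (z - 1)"] by auto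
    qed simp
  qed
  moreover have "countable ({1} \<union> (\<Union>n. {z \<in> E. inverse (real (Suc n)) < cmod (z - 1)}))"
    by (intro countable_Un countable_UN[OF countableI_type]) (auto intro!: countable_finite fin)
  ultimately show "countable E" by (rule countable_subset)
  then have "countable E'" by (simp add: E'_def)
  define g where "g = to_nat_on E'"
  have inj: "inj_on g E'" using \<open>countable E'\<close> unfolding g_def by (rule inj_on_to_nat_on)
  define d where "d z = cmod (z - 1)" for z
  \<comment> \<open>Points at equal distance from 1 are ordered by an injection into the naturals,
    which makes the order total.\<close>
  define before where "before w z \<longleftrightarrow> d z < d w \<or> d w = d z \<and> g w < g z" for w z
  define pre where "pre z = {w \<in> E'. before w z}" for z
  define rank where "rank z = card (pre z)" for z
  have fp: "finite (pre z)" if "z \<in> E'" for z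
  proof (rule finite_subset)
    have "0 < d z" using that by (simp add: d_def E'_def)
    then show "finite {w \<in> E. d z / 2 < cmod (w - 1)}" by (intro fin) simp
    show "pre z \<subseteq> {w \<in> E. d z / 2 < cmod (w - 1)}"
    proof
      fix w assume "w \<in> pre z"
      then have "w \<in> E" "d z \<le> d w" by (auto simp: pre_def before_def E'_def)
      then show "w \<in> {w \<in> E. d z / 2 < cmod (w - 1)}"
        using \<open>0 < d z\<close> unfolding d_def[symmetric] by simp
    qed
  qed
  have mono: "rank w < rank z" if "w \<in> E'" "z \<in> E'" "before w z" for w z
    unfolding rank_def
  proof (rule psubset_card_mono[OF fp])
    have "pre w \<subseteq> pre z" using that by (auto simp: pre_def before_def)
    moreover have "w \<in> pre z" "w \<notin> pre w" using that by (auto simp: pre_def before_def)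
    ultimately show "pre w \<subset> pre z" by blast
  qed fact
  have total: "before w z \<or> before z w" if "w \<in> E'" "z \<in> E'" "w \<noteq> z" for w z
    using inj that unfolding before_def inj_on_def by (metis linorder_neqE_nat linorder_less_linear)
  have injr: "inj_on rank E'"
    unfolding inj_on_def using mono total by (metis less_irrefl)
  have dist: "d z \<le> d w" if wz: "w \<in> E'" "z \<in> E'" and "rank w < rank z" for w z
  proof -
    have "w \<noteq> z" "\<not> before z w" using that mono[of z w] by auto
    then show ?thesis using total[OF wz] by (auto simp: before_def)
  qed
  define S where "S = rank ` E'"
  define N where "N = (if finite S then enat (card S) else \<infinity>)"
  \<comment> \<open>\<open>enumerate\<close> lists the positions in increasing order; it starts at 0
    and the numbering at 1, hence \<open>j - 1\<close>.\<close>
  define \<Lambda> where "\<Lambda> j = inv_into E' rank (enumerate S (j - 1))" for j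
  have idx: "enat j \<le> N \<longleftrightarrow> infinite S \<or> j \<le> card S" for j
    by (simp add: N_def)
  have inS: "enumerate S (j - 1) \<in> S" if "1 \<le> j" "enat j \<le> N" for j
    using that enumerate_in_set[of S] finite_enumerate_in_set[of S "j - 1"] by (cases "finite S") (auto simp: idx)
  have \<Lambda>: "\<Lambda> j \<in> E'" "rank (\<Lambda> j) = enumerate S (j - 1)" if "1 \<le> j" "enat j \<le> N" for j
    using inS[OF that] unfolding \<Lambda>_def S_def by (auto intro: inv_into_into f_inv_into_f)
  have "E' \<subseteq> \<Lambda> ` {j. 1 \<le> j \<and> enat j \<le> N}"
  proof
    fix z assume z: "z \<in> E'"
    then have "rank z \<in> S" by (simp add: S_def)
    then obtain n where n: "enumerate S n = rank z" "infinite S \<or> n < card S"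
      using enumerate_Ex[of S] finite_enumerate_Ex[of S] by metis
    then have "1 \<le> Suc n" "enat (Suc n) \<le> N" by (auto simp: idx)
    moreover have "\<Lambda> (Suc n) = z"
      using n z injr by (simp add: \<Lambda>_def inv_into_f_f)
    ultimately show "z \<in> \<Lambda> ` {j. 1 \<le> j \<and> enat j \<le> N}" by blast
  qed
  moreover have "cmod (\<Lambda> (Suc j) - 1) \<le> cmod (\<Lambda> j - 1)" if j: "1 \<le> j" "enat (Suc j) \<le> N" for j
  proof -
    have j': "1 \<le> Suc j" "enat j \<le> N" using j by (auto simp: idx)
    have "enumerate S (j - 1) < enumerate S (Suc j - 1)"
      using j by (cases "finite S") (auto simp: idx intro!: enumerate_mono finite_enumerate_mono)
    then have "d (\<Lambda> (Suc j)) \<le> d (\<Lambda> j)"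
      using \<Lambda>[OF j(1) j'(2)] \<Lambda>[OF j'(1) j(2)] by (intro dist) auto
    then show ?thesis by (simp add: d_def)
  qed
  moreover have "\<Lambda> ` {j. 1 \<le> j \<and> enat j \<le> N} \<subseteq> E" using \<Lambda> by (auto simp: E'_def)
  ultimately have "eigenvalue_numbering E N \<Lambda>"
    unfolding eigenvalue_numbering_def E'_def by blast
  then show "\<exists>N \<Lambda>. eigenvalue_numbering E N \<Lambda>" by blast
qed

section \<open>Sums of compact operators and residual polynomials\<close>

context function_space
begin

text \<open>The assumptions of \<open>compact_operator\<close>, bundled so that they can be carried
  through finite sums.\<close>

definition compact_op :: "(('i, 'j) family \<Rightarrow> 'i \<Rightarrow> 'j \<Rightarrow> complex) \<Rightarrow> bool" where
  "compact_op K \<longleftrightarrow> lin_op K \<and> bounded_op K \<and> approximable K \<and> complete_range K"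

lemma compact_op_zero: "compact_op (\<lambda>u p x. 0)"
proof -
  have "lin_op (\<lambda>u p x. 0)" by (simp add: lin_op_def zero_mem)
  moreover have "bounded_op (\<lambda>u p x. 0)"
    unfolding bounded_op_def by (intro exI[of _ 0]) (simp add: nrm_zero)
  moreover have "approximable (\<lambda>u p x. 0)"
    unfolding approximable_def by (intro allI impI exI[of _ "[]"]) (simp add: rank_list_def nrm_zero nrm_nonneg)
  moreover have "complete_range (\<lambda>u p x. 0)"
    unfolding complete_range_def by (intro allI impI bexI[of _ "\<lambda>p x. 0"]) (auto simp: nrm_zero zero_mem)
  ultimately show ?thesis by (simp add: compact_op_def)
qed

lemma compact_op_add:
  assumes "compact_op K" "compact_op L"
  shows "compact_op (\<lambda>u p x. K u p x + L u p x)"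
proof -
  have K: "lin_op K" "bounded_op K" "approximable K" "complete_range K"
    and L: "lin_op L" "bounded_op L" "approximable L" "complete_range L"
    using assms by (auto simp: compact_op_def)
  note mem = lin_opD(1)[OF K(1)] lin_opD(1)[OF L(1)]
  have 1: "lin_op (\<lambda>u p x. K u p x + L u p x)"
    unfolding lin_op_def
    by (auto simp: lin_opD(2)[OF K(1)] lin_opD(2)[OF L(1)] fun_eq_iff distrib_left intro: add_mem mem)
  obtain B C where B: "0 \<le> B" "\<And>u. u \<in> V \<Longrightarrow> nrm (K u) \<le> B * nrm u"
    and C: "0 \<le> C" "\<And>u. u \<in> V \<Longrightarrow> nrm (L u) \<le> C * nrm u"
    using K(2) L(2) unfolding bounded_op_def by blast
  have "nrm (\<lambda>p x. K u p x + L u p x) \<le> (B + C) * nrm u" if u: "u \<in> V" for u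
    using nrm_add[OF mem(1)[OF u] mem(2)[OF u]] B(2)[OF u] C(2)[OF u] by (simp add: distrib_right)
  then have 2: "bounded_op (\<lambda>u p x. K u p x + L u p x)"
    unfolding bounded_op_def using B(1) C(1) by (intro exI[of _ "B + C"]) auto
  have 3: "approximable (\<lambda>u p x. K u p x + L u p x)"
    unfolding approximable_def
  proof (intro allI impI)
    fix \<epsilon> :: real assume "\<epsilon> > 0"
    then have h: "\<epsilon> / 2 > 0" by simp
    obtain as where as: "rank_list as"
      "\<And>u. u \<in> V \<Longrightarrow> nrm (\<lambda>p x. K u p x - (\<Sum>(a, \<beta>)\<leftarrow>as. \<beta> u * a p x)) \<le> \<epsilon> / 2 * nrm u"
      using K(3)[unfolded approximable_def, THEN spec, THEN mp, OF h] by blast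
    obtain bs where bs: "rank_list bs"
      "\<And>u. u \<in> V \<Longrightarrow> nrm (\<lambda>p x. L u p x - (\<Sum>(a, \<beta>)\<leftarrow>bs. \<beta> u * a p x)) \<le> \<epsilon> / 2 * nrm u"
      using L(3)[unfolded approximable_def, THEN spec, THEN mp, OF h] by blast
    have rank_mem: "(\<lambda>p x. \<Sum>(a, \<beta>)\<leftarrow>cs. \<beta> u * a p x) \<in> V" if "rank_list cs" for cs u
      using that by (induction cs) (auto simp: rank_list_def zero_mem intro: lin_mem)
    have "nrm (\<lambda>p x. K u p x + L u p x - (\<Sum>(a, \<beta>)\<leftarrow>as @ bs. \<beta> u * a p x)) \<le> \<epsilon> * nrm u"
      if u: "u \<in> V" for u
    proof -
      have "nrm (\<lambda>p x. (K u p x - (\<Sum>(a, \<beta>)\<leftarrow>as. \<beta> u * a p x)) + (L u p x - (\<Sum>(a, \<beta>)\<leftarrow>bs. \<beta> u * a p x)))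
          \<le> \<epsilon> / 2 * nrm u + \<epsilon> / 2 * nrm u"
        by (rule order_trans[OF nrm_add add_mono[OF as(2)[OF u] bs(2)[OF u]]])
           (intro diff_mem mem rank_mem as bs u)+
      then show ?thesis by (simp add: algebra_simps)
    qed
    moreover have "rank_list (as @ bs)" using as(1) bs(1) by (auto simp: rank_list_def)
    ultimately show "\<exists>as. rank_list as \<and>
        (\<forall>u\<in>V. nrm (\<lambda>p x. K u p x + L u p x - (\<Sum>(a, \<beta>)\<leftarrow>as. \<beta> u * a p x)) \<le> \<epsilon> * nrm u)"
      by blast
  qed
  have 4: "complete_range (\<lambda>u p x. K u p x + L u p x)"
    unfolding complete_range_def
  proof (intro allI impI)
    fix w :: "nat \<Rightarrow> 'i \<Rightarrow> 'j \<Rightarrow> complex" assume w: "(\<forall>n. w n \<in> V) \<and>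
      (\<forall>e>0. \<exists>N. \<forall>n\<ge>N. \<forall>j. nrm (\<lambda>p x. w (n + j) p x - w n p x) < e)"
    obtain v where v: "v \<in> V" "(\<lambda>n. nrm (\<lambda>p x. K (w n) p x - v p x)) \<longlonglongrightarrow> 0"
      using K(4)[unfolded complete_range_def, THEN spec, THEN mp, OF w] by blast
    obtain v' where v': "v' \<in> V" "(\<lambda>n. nrm (\<lambda>p x. L (w n) p x - v' p x)) \<longlonglongrightarrow> 0"
      using L(4)[unfolded complete_range_def, THEN spec, THEN mp, OF w] by blast
    have lim: "(\<lambda>n. nrm (\<lambda>p x. K (w n) p x - v p x) + nrm (\<lambda>p x. L (w n) p x - v' p x)) \<longlonglongrightarrow> 0"
      using tendsto_add[OF v(2) v'(2)] by simp
    have "nrm (\<lambda>p x. K (w n) p x + L (w n) p x - (v p x + v' p x)) \<le>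
        nrm (\<lambda>p x. K (w n) p x - v p x) + nrm (\<lambda>p x. L (w n) p x - v' p x)" for n
    proof -
      have "w n \<in> V" using w by blast
      then have "nrm (\<lambda>p x. (K (w n) p x - v p x) + (L (w n) p x - v' p x)) \<le>
          nrm (\<lambda>p x. K (w n) p x - v p x) + nrm (\<lambda>p x. L (w n) p x - v' p x)"
        using v(1) v'(1) by (intro nrm_add diff_mem mem)
      then show ?thesis by (simp add: algebra_simps)
    qed
    then have "(\<lambda>n. nrm (\<lambda>p x. K (w n) p x + L (w n) p x - (v p x + v' p x))) \<longlonglongrightarrow> 0"
      by (intro tendsto_sandwich[OF _ _ tendsto_const lim]) (auto simp: nrm_nonneg)
    then show "\<exists>v\<in>V. (\<lambda>n. nrm (\<lambda>p x. K (w n) p x + L (w n) p x - v p x)) \<longlonglongrightarrow> 0"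
      using add_mem[OF v(1) v'(1)] by (intro bexI[of _ "\<lambda>p x. v p x + v' p x"])
  qed
  show ?thesis using 1 2 3 4 by (simp add: compact_op_def)
qed

lemma compact_op_sum:
  "(\<And>i. i \<in> I \<Longrightarrow> compact_op (K i)) \<Longrightarrow> compact_op (\<lambda>u p x. \<Sum>i\<in>I. K i u p x)"
proof (induction I rule: infinite_finite_induct)
  case (insert i I)
  then have "compact_op (\<lambda>u p x. K i u p x + (\<Sum>i\<in>I. K i u p x))"
    by (intro compact_op_add) auto
  then show ?case using insert by simp
qed (simp_all add: compact_op_zero)

lemma prod_op_zeros: "prod_op K (replicate k 0 @ ms) u = (K ^^ k) (prod_op K ms u)"
  by (induction k) auto

text \<open>Each factor \<open>K - \<mu>\<close> is \<open>A - (1 + \<mu>)\<close>, so the product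
  is a polynomial in \<open>A\<close>. Its constant term, the value at 0, is the number by which a
  residual polynomial has to be normalised.\<close>

lemma prod_op_polynomial:
  assumes K: "lin_op K" and u: "u \<in> V"
  defines "A \<equiv> \<lambda>u p x. u p x + K u p x"
  shows "\<exists>q. prod_op K ms u = (\<lambda>p x. \<Sum>i\<le>length ms. q i * (A ^^ i) u p x) \<and>
    q 0 = (\<Prod>\<mu>\<leftarrow>ms. - 1 - \<mu>)"
proof (induction ms)
  case Nil
  then show ?case by (intro exI[of _ "\<lambda>i. 1"]) simp
next
  case (Cons \<mu> ms)
  have "A (\<lambda>p x. c * v p x + w p x) = (\<lambda>p x. c * A v p x + A w p x)" if "v \<in> V" "w \<in> V" for v w c
    using that unfolding A_def by (simp add: lin_opD(2)[OF K]) (simp add: algebra_simps)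
  then have A: "lin_op A"
    unfolding lin_op_def using add_mem[OF _ lin_opD(1)[OF K]] by (auto simp: A_def)
  define n where "n = length ms"
  obtain q where q: "prod_op K ms u = (\<lambda>p x. \<Sum>i\<le>n. q i * (A ^^ i) u p x)"
    "q 0 = (\<Prod>\<mu>\<leftarrow>ms. - 1 - \<mu>)"
    using Cons by (auto simp: n_def)
  \<comment> \<open>The coefficients of (z - (1 + \<mu>)) q(z): the shift is multiplication by z,
    and q is extended by 0 to the new degree.\<close>
  define q' where "q' i = (case i of 0 \<Rightarrow> 0 | Suc j \<Rightarrow> q j) - (1 + \<mu>) * (if i \<le> n then q i else 0)" for i
  let ?P = "prod_op K ms u"
  have "A ?P = (\<lambda>p x. \<Sum>i\<le>n. q i * A ((A ^^ i) u) p x)"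
    unfolding q(1) using u by (intro lin_op_sum[OF A] funpow_mem[OF A])
  then have AP: "A ?P p x = (\<Sum>i\<le>Suc n. (case i of 0 \<Rightarrow> 0 | Suc j \<Rightarrow> q j) * (A ^^ i) u p x)" for p x
    by (simp only: sum.atMost_Suc_shift) simp
  have P: "?P p x = (\<Sum>i\<le>Suc n. (if i \<le> n then q i else 0) * (A ^^ i) u p x)" for p x
    by (simp add: q(1))
  have "prod_op K (\<mu> # ms) u p x = (\<Sum>i\<le>Suc n. q' i * (A ^^ i) u p x)" for p x
  proof -
    have "prod_op K (\<mu> # ms) u p x = A ?P p x - (1 + \<mu>) * ?P p x"
      by (simp add: A_def algebra_simps)
    also have "\<dots> = (\<Sum>i\<le>Suc n. q' i * (A ^^ i) u p x)"
      unfolding AP P q'_def by (simp add: sum_subtractf sum_distrib_left left_diff_distrib mult.assoc del: sum.atMost_Suc)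
    finally show ?thesis .
  qed
  then show ?case
    using q(2) by (intro exI[of _ q']) (auto simp: n_def q'_def fun_eq_iff algebra_simps)
qed

end

section \<open>The product space\<close>

text \<open>Over t > 0 the right-hand side is smallest at t = b/a, with value (a + b)^2. Raising
  both numbers by e/2 first makes this choice legitimate when one of them is 0.\<close>

lemma sum_of_squares_triangle:
  fixes x a b :: real
  assumes x: "\<And>t. t > 0 \<Longrightarrow> x\<^sup>2 \<le> (1 + t) * a\<^sup>2 + (1 + 1 / t) * b\<^sup>2" and ab: "0 \<le> a" "0 \<le> b"
  shows "x \<le> a + b"
proof (rule field_le_epsilon)
  fix e :: real assume e: "e > 0"
  define c d where "c = a + e / 2" and "d = b + e / 2"
  have cd: "0 < c" "0 < d" "a \<le> c" "b \<le> d" using ab e by (auto simp: c_def d_def)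
  have "x\<^sup>2 \<le> (1 + d / c) * a\<^sup>2 + (1 + 1 / (d / c)) * b\<^sup>2" using cd by (intro x) simp
  also have "\<dots> \<le> (1 + d / c) * c\<^sup>2 + (1 + 1 / (d / c)) * d\<^sup>2"
    using cd ab by (intro add_mono mult_left_mono power_mono) auto
  also have "\<dots> = (c + d)\<^sup>2" using cd by (simp add: field_simps power2_eq_square)
  finally have "x \<le> c + d" using cd by (intro power2_le_imp_le[of x "c + d"]) auto
  then show "x \<le> a + b + e" by (simp add: c_def d_def)
qed

lemma finite_scatterers: "finite (scatterers m)"
proof -
  have "(UNIV :: bc set) = {Dirichlet, Neumann, Robin}" using bc.exhaust by auto
  then have "finite (UNIV :: bc set)" by (metis finite.simps)
  then have "finite (SIGMA i : (UNIV :: bc set). {1..m i})" by (intro finite_SigmaI) auto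
  moreover have "scatterers m \<subseteq> (SIGMA i : (UNIV :: bc set). {1..m i})" by (auto simp: scatterers_def)
  ultimately show ?thesis by (rule finite_subset[rotated])
qed

lemma prod_norm_eq:
  "prod_norm m \<Omega> u = sqrt (\<Sum>p\<in>scatterers m. LINT x|bdry (\<Omega> p). (cmod (u p x))\<^sup>2)"
proof -
  have "(LINT x|bdry (\<Omega> p). u p x * cnj (u p x)) = of_real (LINT x|bdry (\<Omega> p). (cmod (u p x))\<^sup>2)" for p
    by (simp only: complex_norm_square[symmetric] integral_complex_of_real)
  then show ?thesis by (simp add: prod_norm_def prod_inner_def)
qed

text \<open>The triangle inequality comes from the pointwise estimate |az + w|^2 \<le> (1 + t)
  |az|^2 + (1 + 1/t) |w|^2, integrated and summed with the same t on all boundaries; t is optimised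
  only at the end.\<close>

lemma prod_L2_function_space: "function_space (prod_L2 m \<Omega>) (prod_norm m \<Omega>)"
proof
  let ?n = "prod_norm m \<Omega>"
  define sq where "sq u = (\<Sum>p\<in>scatterers m. LINT x|bdry (\<Omega> p). (cmod (u p x))\<^sup>2)" for u
  have sq0: "0 \<le> sq u" for u by (auto simp: sq_def intro!: sum_nonneg)
  have nsq: "?n u = sqrt (sq u)" for u by (simp add: prod_norm_eq sq_def)
  show mem0: "(\<lambda>p x. 0) \<in> prod_L2 m \<Omega>" by (simp add: prod_L2_def L2_def)
  show nn: "0 \<le> ?n u" for u using sq0 by (simp add: nsq)
  show "?n (\<lambda>p x. 0) = 0" by (simp add: prod_norm_eq)
  fix u v a assume u: "u \<in> prod_L2 m \<Omega>" and v: "v \<in> prod_L2 m \<Omega>"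
  show mem: "(\<lambda>p x. a * u p x + v p x) \<in> prod_L2 m \<Omega>"
    using u v by (simp add: prod_L2_def L2_lin)
  have tri: "(?n (\<lambda>p x. a * u p x + v p x))\<^sup>2 \<le> (1 + t) * (cmod a * ?n u)\<^sup>2 + (1 + 1 / t) * (?n v)\<^sup>2"
    if t: "t > 0" for t
  proof -
    have pt: "(cmod (a * z + w))\<^sup>2 \<le> (1 + t) * (cmod a)\<^sup>2 * (cmod z)\<^sup>2 + (1 + 1 / t) * (cmod w)\<^sup>2" for z w
    proof -
      define c where "c = cmod (a * z)"
      have "2 * (t * c) * cmod w \<le> (t * c)\<^sup>2 + (cmod w)\<^sup>2" by (rule sum_squares_bound)
      then have "2 * c * cmod w \<le> t * c\<^sup>2 + (cmod w)\<^sup>2 / t"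
        using t by (simp add: field_simps power2_eq_square)
      moreover have "(cmod (a * z + w))\<^sup>2 \<le> (c + cmod w)\<^sup>2"
        unfolding c_def by (intro power_mono norm_triangle_ineq) auto
      ultimately have "(cmod (a * z + w))\<^sup>2 \<le> (1 + t) * c\<^sup>2 + (1 + 1 / t) * (cmod w)\<^sup>2"
        by (simp add: power2_sum algebra_simps)
      then show ?thesis by (simp add: c_def norm_mult power_mult_distrib mult_ac)
    qed
    have "sq (\<lambda>p x. a * u p x + v p x) \<le>
        (\<Sum>p\<in>scatterers m. (1 + t) * (cmod a)\<^sup>2 * (LINT x|bdry (\<Omega> p). (cmod (u p x))\<^sup>2) +
          (1 + 1 / t) * (LINT x|bdry (\<Omega> p). (cmod (v p x))\<^sup>2))"
      unfolding sq_def
    proof (rule sum_mono)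
      fix p assume p: "p \<in> scatterers m"
      have int: "integrable (bdry (\<Omega> p)) (\<lambda>x. (cmod (u p x))\<^sup>2)" "integrable (bdry (\<Omega> p)) (\<lambda>x. (cmod (v p x))\<^sup>2)"
        "integrable (bdry (\<Omega> p)) (\<lambda>x. (cmod (a * u p x + v p x))\<^sup>2)"
        using u v mem p by (auto simp: prod_L2_def L2_def)
      have "(LINT x|bdry (\<Omega> p). (cmod (a * u p x + v p x))\<^sup>2) \<le>
          (LINT x|bdry (\<Omega> p). (1 + t) * (cmod a)\<^sup>2 * (cmod (u p x))\<^sup>2 + (1 + 1 / t) * (cmod (v p x))\<^sup>2)"
        using int pt by (intro integral_mono) auto
      then show "(LINT x|bdry (\<Omega> p). (cmod (a * u p x + v p x))\<^sup>2) \<le>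
          (1 + t) * (cmod a)\<^sup>2 * (LINT x|bdry (\<Omega> p). (cmod (u p x))\<^sup>2) +
          (1 + 1 / t) * (LINT x|bdry (\<Omega> p). (cmod (v p x))\<^sup>2)"
        using int by simp
    qed
    also have "\<dots> = (1 + t) * (cmod a)\<^sup>2 * sq u + (1 + 1 / t) * sq v"
      by (simp add: sq_def sum.distrib sum_distrib_left)
    finally show ?thesis using sq0 by (simp add: nsq power_mult_distrib mult.assoc)
  qed
  show "?n (\<lambda>p x. a * u p x + v p x) \<le> cmod a * ?n u + ?n v"
    by (rule sum_of_squares_triangle[OF tri]) (simp_all add: nn)
qed

lemma prod_norm_zero_iff:
  assumes u: "u \<in> prod_L2 m \<Omega>"
  shows "prod_norm m \<Omega> u = 0 \<longleftrightarrow> (\<forall>p\<in>scatterers m. AE x in bdry (\<Omega> p). u p x = 0)"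
proof -
  have "prod_norm m \<Omega> u = 0 \<longleftrightarrow> (\<forall>p\<in>scatterers m. (LINT x|bdry (\<Omega> p). (cmod (u p x))\<^sup>2) = 0)"
    unfolding prod_norm_eq real_sqrt_eq_zero_cancel_iff
    by (intro sum_nonneg_eq_0_iff finite_scatterers) simp
  also have "\<dots> \<longleftrightarrow> (\<forall>p\<in>scatterers m. AE x in bdry (\<Omega> p). u p x = 0)"
  proof (intro ball_cong refl)
    fix p assume "p \<in> scatterers m"
    then have "integrable (bdry (\<Omega> p)) (\<lambda>x. (cmod (u p x))\<^sup>2)" using u by (auto simp: prod_L2_def L2_def)
    from integral_nonneg_eq_0_iff_AE[OF this]
    show "((LINT x|bdry (\<Omega> p). (cmod (u p x))\<^sup>2) = 0) = (AE x in bdry (\<Omega> p). u p x = 0)" by simp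
  qed
  finally show ?thesis .
qed

lemma norm_L2_le_prod_norm:
  assumes p: "p \<in> scatterers m"
  shows "norm_L2 (bdry (\<Omega> p)) (u p) \<le> prod_norm m \<Omega> u"
  unfolding norm_L2_def prod_norm_eq
  by (intro real_sqrt_le_mono member_le_sum[OF p, of "\<lambda>p. LINT x|bdry (\<Omega> p). (cmod (u p x))\<^sup>2"] finite_scatterers) simp

section \<open>The coupling operator\<close>

locale scattering = radial_kernel +
  fixes m :: "bc \<Rightarrow> nat" and \<Omega> :: "bc \<times> nat \<Rightarrow> (real^2) set" and \<eta> :: real and h :: "real^2 \<Rightarrow> complex"
  assumes scatterer: "\<And>p. p \<in> scatterers m \<Longrightarrow> open (\<Omega> p) \<and> bounded (\<Omega> p) \<and> C2_boundary (\<Omega> p)"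
    and separated: "\<And>p q. p \<in> scatterers m \<Longrightarrow> q \<in> scatterers m \<Longrightarrow> p \<noteq> q \<Longrightarrow>
                      closure (\<Omega> p) \<inter> closure (\<Omega> q) = {}"
    and h_measurable: "\<And>j. (Robin, j) \<in> scatterers m \<Longrightarrow> h \<in> borel_measurable (bdry (\<Omega> (Robin, j)))"
    and h_bounded: "\<And>j. (Robin, j) \<in> scatterers m \<Longrightarrow> bounded (h ` frontier (\<Omega> (Robin, j)))"
    and solvable: "\<And>p. p \<in> scatterers m \<Longrightarrow> bounded_solution_op \<kappa> \<eta> h (fst p) (\<Omega> p)"
begin

abbreviation "V \<equiv> prod_L2 m \<Omega>"
abbreviation "nrm \<equiv> prod_norm m \<Omega>"
abbreviation "I \<equiv> scatterers m"
abbreviation "\<Gamma> p \<equiv> frontier (\<Omega> p)"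

sublocale function_space V nrm by (rule prod_L2_function_space)

lemma obstacle: "p \<in> I \<Longrightarrow> obstacle \<kappa> F F1 F2 (\<Omega> p)"
  using scatterer by (intro obstacle.intro radial_kernel_axioms obstacle_axioms.intro) auto

lemma finite_bdry: "p \<in> I \<Longrightarrow> finite_measure (bdry (\<Omega> p))"
  using scatterer by (intro finite_measure_bdry) auto

lemma compact_\<Gamma>: "p \<in> I \<Longrightarrow> compact (\<Gamma> p)"
  using scatterer by (intro compact_frontier_bounded) auto

lemma disjoint_\<Gamma>: "p \<in> I \<Longrightarrow> q \<in> I \<Longrightarrow> p \<noteq> q \<Longrightarrow> \<Gamma> p \<inter> \<Gamma> q = {}"
  using separated[of p q] unfolding frontier_def by blast

text \<open>The norm of the constant function 1, by which uniform bounds on the boundaries become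
  bounds in \<open>nrm\<close>.\<close>

definition mass :: real where
  "mass = sqrt (\<Sum>p\<in>I. measure (bdry (\<Omega> p)) (\<Gamma> p))"

lemma mass_nonneg: "0 \<le> mass"
  by (auto simp: mass_def intro!: sum_nonneg)

lemma bounded_mem:
  assumes u: "\<And>p. p \<in> I \<Longrightarrow> u p \<in> borel_measurable (bdry (\<Omega> p))"
    and c: "\<And>p x. p \<in> I \<Longrightarrow> x \<in> \<Gamma> p \<Longrightarrow> cmod (u p x) \<le> c" "0 \<le> c"
  shows "u \<in> V" "nrm u \<le> c * mass"
proof -
  have b: "u p \<in> L2 (bdry (\<Omega> p))" "(LINT x|bdry (\<Omega> p). (cmod (u p x))\<^sup>2) \<le> c\<^sup>2 * measure (bdry (\<Omega> p)) (\<Gamma> p)"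
    if "p \<in> I" for p
    using bounded_L2[OF finite_bdry[OF that] u[OF that] _ c(2)] c(1)[OF that] by auto
  show "u \<in> V" using b by (simp add: prod_L2_def)
  have "(\<Sum>p\<in>I. LINT x|bdry (\<Omega> p). (cmod (u p x))\<^sup>2) \<le> (\<Sum>p\<in>I. c\<^sup>2 * measure (bdry (\<Omega> p)) (\<Gamma> p))"
    by (intro sum_mono b)
  then have "nrm u \<le> sqrt (\<Sum>p\<in>I. c\<^sup>2 * measure (bdry (\<Omega> p)) (\<Gamma> p))"
    unfolding prod_norm_eq by (rule real_sqrt_le_mono)
  also have "\<dots> = c * mass"
    using c(2) by (simp add: mass_def sum_distrib_left[symmetric] real_sqrt_mult)
  finally show "nrm u \<le> c * mass" .
qed

text \<open>Describes a linear map into the continuous functions on \<open>\<Gamma> p\<close> under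
  which the unit ball of \<open>V\<close> becomes bounded and equicontinuous, hence a compact one in
  the sense of Arzela and Ascoli.\<close>

definition reg :: "bc \<times> nat \<Rightarrow> (fields \<Rightarrow> real^2 \<Rightarrow> complex) \<Rightarrow> bool" where
  "reg p r \<longleftrightarrow>
    (\<forall>u\<in>V. \<forall>v\<in>V. \<forall>a. \<forall>x\<in>\<Gamma> p. r (\<lambda>p x. a * u p x + v p x) x = a * r u x + r v x) \<and>
    (\<exists>C\<ge>0. \<forall>u\<in>V. \<forall>x\<in>\<Gamma> p. cmod (r u x) \<le> C * nrm u) \<and>
    (\<forall>\<epsilon>>0. \<exists>\<delta>>0. \<forall>x\<in>\<Gamma> p. \<forall>x'\<in>\<Gamma> p. dist x x' < \<delta> \<longrightarrow> (\<forall>u\<in>V. cmod (r u x - r u x') \<le> \<epsilon> * nrm u))"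

lemma reg_zero: "reg p (\<lambda>u x. 0)"
  unfolding reg_def by (auto simp: nrm_nonneg intro!: exI[of _ "1::real"])

lemma reg_add:
  assumes "reg p r" "reg p s" shows "reg p (\<lambda>u x. r u x + s u x)"
  unfolding reg_def
proof (intro conjI ballI allI impI)
  fix u v a x assume "u \<in> V" "v \<in> V" "x \<in> \<Gamma> p"
  then show "r (\<lambda>p x. a * u p x + v p x) x + s (\<lambda>p x. a * u p x + v p x) x =
      a * (r u x + s u x) + (r v x + s v x)"
    using assms by (simp add: reg_def algebra_simps)
next
  obtain C where C: "0 \<le> C" "\<And>u x. u \<in> V \<Longrightarrow> x \<in> \<Gamma> p \<Longrightarrow> cmod (r u x) \<le> C * nrm u"
    using assms(1)[unfolded reg_def, THEN conjunct2, THEN conjunct1] by blast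
  obtain D where D: "0 \<le> D" "\<And>u x. u \<in> V \<Longrightarrow> x \<in> \<Gamma> p \<Longrightarrow> cmod (s u x) \<le> D * nrm u"
    using assms(2)[unfolded reg_def, THEN conjunct2, THEN conjunct1] by blast
  have "cmod (r u x + s u x) \<le> (C + D) * nrm u" if "u \<in> V" "x \<in> \<Gamma> p" for u x
    using C(2)[OF that] D(2)[OF that] norm_triangle_ineq[of "r u x" "s u x"] by (simp add: distrib_right)
  then show "\<exists>C\<ge>0. \<forall>u\<in>V. \<forall>x\<in>\<Gamma> p. cmod (r u x + s u x) \<le> C * nrm u"
    using C(1) D(1) by (intro exI[of _ "C + D"]) auto
next
  fix \<epsilon> :: real assume "\<epsilon> > 0"
  then have h: "\<epsilon> / 2 > 0" by simp
  obtain \<delta> where \<delta>: "\<delta> > 0" "\<And>x x' u. x \<in> \<Gamma> p \<Longrightarrow> x' \<in> \<Gamma> p \<Longrightarrow> dist x x' < \<delta> \<Longrightarrow> u \<in> V \<Longrightarrow>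
      cmod (r u x - r u x') \<le> \<epsilon> / 2 * nrm u"
    using assms(1)[unfolded reg_def, THEN conjunct2, THEN conjunct2, THEN spec, THEN mp, OF h] by blast
  obtain \<delta>' where \<delta>': "\<delta>' > 0" "\<And>x x' u. x \<in> \<Gamma> p \<Longrightarrow> x' \<in> \<Gamma> p \<Longrightarrow> dist x x' < \<delta>' \<Longrightarrow> u \<in> V \<Longrightarrow>
      cmod (s u x - s u x') \<le> \<epsilon> / 2 * nrm u"
    using assms(2)[unfolded reg_def, THEN conjunct2, THEN conjunct2, THEN spec, THEN mp, OF h] by blast
  have "cmod (r u x + s u x - (r u x' + s u x')) \<le> \<epsilon> * nrm u"
    if x: "x \<in> \<Gamma> p" "x' \<in> \<Gamma> p" "dist x x' < min \<delta> \<delta>'" and u: "u \<in> V" for x x' u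
  proof -
    have "cmod ((r u x - r u x') + (s u x - s u x')) \<le> \<epsilon> / 2 * nrm u + \<epsilon> / 2 * nrm u"
      using x u by (intro order_trans[OF norm_triangle_ineq] add_mono \<delta>(2) \<delta>'(2)) auto
    then show ?thesis by (simp add: algebra_simps)
  qed
  then show "\<exists>\<delta>>0. \<forall>x\<in>\<Gamma> p. \<forall>x'\<in>\<Gamma> p. dist x x' < \<delta> \<longrightarrow>
      (\<forall>u\<in>V. cmod (r u x + s u x - (r u x' + s u x')) \<le> \<epsilon> * nrm u)"
    using \<delta>(1) \<delta>'(1) by (intro exI[of _ "min \<delta> \<delta>'"]) auto
qed

lemma reg_sum: "finite J \<Longrightarrow> (\<And>q. q \<in> J \<Longrightarrow> reg p (r q)) \<Longrightarrow> reg p (\<lambda>u x. \<Sum>q\<in>J. r q u x)"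
proof (induction J rule: finite_induct)
  case (insert q J)
  then have "reg p (\<lambda>u x. r q u x + (\<Sum>q\<in>J. r q u x))" by (intro reg_add) auto
  then show ?case using insert by simp
qed (simp add: reg_zero)

abbreviation sol :: "bc \<times> nat \<Rightarrow> fields \<Rightarrow> real^2 \<Rightarrow> complex" where
  "sol q W \<equiv> solution_op \<kappa> \<eta> h (fst q) (\<Omega> q) (W q)"

text \<open>The solution operator is linear only almost everywhere, but \<open>regular_op\<close>
  accepts a combination of densities up to null sets, so the composite is linear at every point of
  the boundary.\<close>

lemma reg_solution_op:
  assumes q: "q \<in> I" and T: "regular_op (\<Omega> q) (\<Gamma> p) T"
  shows "reg p (\<lambda>W. T (sol q W))"
proof -
  interpret q: obstacle \<kappa> F F1 F2 "\<Omega> q" using q by (rule obstacle)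
  have Vq: "u q \<in> L2 (bdry (\<Omega> q))" if "u \<in> V" for u using that q by (simp add: prod_L2_def)
  have sq: "sol q u \<in> L2 (bdry (\<Omega> q))" if "u \<in> V" for u
    using q.solution_op_lin(1)[OF solvable[OF q] Vq[OF that] Vq[OF that]] .
  obtain B0 where "\<forall>W\<in>L2 (bdry (\<Omega> q)). norm_L2 (bdry (\<Omega> q)) (solution_op \<kappa> \<eta> h (fst q) (\<Omega> q) W) \<le>
      B0 * norm_L2 (bdry (\<Omega> q)) W"
    using solvable[OF q] by (auto simp: bounded_solution_op_def)
  then have B0: "norm_L2 (bdry (\<Omega> q)) (sol q u) \<le> B0 * norm_L2 (bdry (\<Omega> q)) (u q)" if "u \<in> V" for u
    using Vq[OF that] by blast
  \<comment> \<open>The constant in \<open>bounded_solution_op\<close> carries no sign condition,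
    hence a positive majorant.\<close>
  define B where "B = \<bar>B0\<bar> + 1"
  have B: "norm_L2 (bdry (\<Omega> q)) (sol q u) \<le> B * nrm u" if u: "u \<in> V" for u
  proof -
    have n0: "0 \<le> norm_L2 (bdry (\<Omega> q)) (u q)" by (simp add: norm_L2_def)
    have "B0 * norm_L2 (bdry (\<Omega> q)) (u q) \<le> B * norm_L2 (bdry (\<Omega> q)) (u q)"
      using n0 by (intro mult_right_mono) (auto simp: B_def)
    also have "\<dots> \<le> B * nrm u" using q by (intro mult_left_mono norm_L2_le_prod_norm) (auto simp: B_def)
    finally show ?thesis using B0[OF u] by simp
  qed
  have B1: "0 < B" by (simp add: B_def)
  show ?thesis
    unfolding reg_def
  proof (intro conjI ballI allI impI)
    fix u v a x assume u: "u \<in> V" "v \<in> V" and x: "x \<in> \<Gamma> p"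
    show "T (sol q (\<lambda>p x. a * u p x + v p x)) x = a * T (sol q u) x + T (sol q v) x"
      using T[unfolded regular_op_def, THEN conjunct1, rule_format,
          OF sq[OF u(1)] sq[OF u(2)] sq[OF lin_mem[OF u, of a]], of a]
        q.solution_op_lin(2)[OF solvable[OF q] Vq[OF u(1)] Vq[OF u(2)], of a] x by simp
  next
    obtain C where C: "C \<ge> 0" "\<forall>x\<in>\<Gamma> p. \<forall>\<phi>\<in>L2 (bdry (\<Omega> q)). cmod (T \<phi> x) \<le> C * norm_L2 (bdry (\<Omega> q)) \<phi>"
      using T[unfolded regular_op_def, THEN conjunct2, THEN conjunct1] by blast
    have "cmod (T (sol q u) x) \<le> C * B * nrm u" if "u \<in> V" "x \<in> \<Gamma> p" for u x
    proof -
      have "cmod (T (sol q u) x) \<le> C * norm_L2 (bdry (\<Omega> q)) (sol q u)" using C(2) sq that by blast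
      also have "\<dots> \<le> C * (B * nrm u)" using C(1) by (intro mult_left_mono B that)
      finally show ?thesis by simp
    qed
    then show "\<exists>C\<ge>0. \<forall>u\<in>V. \<forall>x\<in>\<Gamma> p. cmod (T (sol q u) x) \<le> C * nrm u"
      using C(1) B1 by (intro exI[of _ "C * B"]) auto
  next
    fix \<epsilon> :: real assume \<epsilon>: "\<epsilon> > 0"
    then have eB: "\<epsilon> / B > 0" using B1 by simp
    obtain \<delta> where \<delta>: "\<delta> > 0" "\<forall>x\<in>\<Gamma> p. \<forall>x'\<in>\<Gamma> p. dist x x' < \<delta> \<longrightarrow>
       (\<forall>\<phi>\<in>L2 (bdry (\<Omega> q)). cmod (T \<phi> x - T \<phi> x') \<le> \<epsilon> / B * norm_L2 (bdry (\<Omega> q)) \<phi>)"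
      using T[unfolded regular_op_def, THEN conjunct2, THEN conjunct2, THEN spec, THEN mp, OF eB] by blast
    have "cmod (T (sol q u) x - T (sol q u) x') \<le> \<epsilon> * nrm u"
      if "x \<in> \<Gamma> p" "x' \<in> \<Gamma> p" "dist x x' < \<delta>" "u \<in> V" for x x' u
    proof -
      have "cmod (T (sol q u) x - T (sol q u) x') \<le> \<epsilon> / B * norm_L2 (bdry (\<Omega> q)) (sol q u)"
        using \<delta>(2) sq that by blast
      also have "\<dots> \<le> \<epsilon> / B * (B * nrm u)" using eB by (intro mult_left_mono B that) auto
      finally show ?thesis using B1 by simp
    qed
    then show "\<exists>\<delta>>0. \<forall>x\<in>\<Gamma> p. \<forall>x'\<in>\<Gamma> p. dist x x' < \<delta> \<longrightarrow>
        (\<forall>u\<in>V. cmod (T (sol q u) x - T (sol q u) x') \<le> \<epsilon> * nrm u)"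
      using \<delta>(1) by blast
  qed
qed

text \<open>The cut-off to \<open>\<Gamma> p\<close> makes the result linear at every argument,
  while \<open>reg\<close> gives linearity only on that boundary. The weight is kept apart from r
  because it may be discontinuous.\<close>

definition loc :: "bc \<times> nat \<Rightarrow> (real^2 \<Rightarrow> complex) \<Rightarrow> (fields \<Rightarrow> real^2 \<Rightarrow> complex) \<Rightarrow> fields \<Rightarrow> fields" where
  "loc p c r u p' x = (if p' = p \<and> x \<in> \<Gamma> p then c x * r u x else 0)"

text \<open>Finite rank approximations come from sampling: the boundary is partitioned into small
  Borel pieces, and on each of them \<open>r u\<close> is replaced by its value at a nearby point, a
  bounded functional of u. For a Cauchy sequence the images under r converge uniformly on the
  boundary, which supplies the limit that \<open>complete_range\<close> asks for.\<close>

lemma loc_compact: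
  assumes p: "p \<in> I" and r: "reg p r" and c: "c \<in> borel_measurable (bdry (\<Omega> p))"
    and b: "\<And>x. x \<in> \<Gamma> p \<Longrightarrow> cmod (c x) \<le> b"
  shows "compact_op (loc p c r)"
proof -
  define B where "B = \<bar>b\<bar> + 1"
  have B: "0 < B" "\<And>x. x \<in> \<Gamma> p \<Longrightarrow> cmod (c x) \<le> B" using b by (force simp: B_def)+
  have rlin: "r (\<lambda>p x. a * u p x + v p x) x = a * r u x + r v x"
    if "u \<in> V" "v \<in> V" "x \<in> \<Gamma> p" for a u v x using r that by (simp add: reg_def)
  obtain C where C: "0 \<le> C" "\<And>u x. u \<in> V \<Longrightarrow> x \<in> \<Gamma> p \<Longrightarrow> cmod (r u x) \<le> C * nrm u"
    using r[unfolded reg_def, THEN conjunct2, THEN conjunct1] by blast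
  have equi: "\<exists>\<delta>>0. \<forall>x\<in>\<Gamma> p. \<forall>x'\<in>\<Gamma> p. dist x x' < \<delta> \<longrightarrow> (\<forall>u\<in>V. cmod (r u x - r u x') \<le> \<epsilon> * nrm u)"
    if "\<epsilon> > 0" for \<epsilon>
    using r[unfolded reg_def, THEN conjunct2, THEN conjunct2, THEN spec, THEN mp, OF that] .
  have cont: "continuous_on (\<Gamma> p) (r u)" if u: "u \<in> V" for u
    unfolding continuous_on_iff
  proof (intro ballI allI impI)
    fix x and e :: real assume x: "x \<in> \<Gamma> p" and e: "0 < e"
    define e' where "e' = e / (nrm u + 1)"
    have n: "0 < nrm u + 1" using nrm_nonneg[of u] by linarith
    then have e': "e' > 0" using e by (simp add: e'_def)
    obtain \<delta> where \<delta>: "\<delta> > 0" "\<And>x x'. x \<in> \<Gamma> p \<Longrightarrow> x' \<in> \<Gamma> p \<Longrightarrow> dist x x' < \<delta> \<Longrightarrow> cmod (r u x - r u x') \<le> e' * nrm u"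
      using equi[OF e'] u by blast
    have "e' * nrm u < e' * (nrm u + 1)" using e' by (intro mult_strict_left_mono) auto
    also have "\<dots> = e" using n by (simp add: e'_def)
    finally have lt: "e' * nrm u < e" .
    show "\<exists>d>0. \<forall>x'\<in>\<Gamma> p. dist x' x < d \<longrightarrow> dist (r u x') (r u x) < e"
      using \<delta> x lt by (intro exI[of _ \<delta>]) (auto simp: dist_norm intro: le_less_trans)
  qed
  have mem: "(\<lambda>p' x. if p' = p \<and> x \<in> \<Gamma> p then g x else 0) \<in> V"
    "nrm (\<lambda>p' x. if p' = p \<and> x \<in> \<Gamma> p then g x else 0) \<le> k * mass"
    if g: "g \<in> borel_measurable (bdry (\<Omega> p))" and k: "\<And>x. x \<in> \<Gamma> p \<Longrightarrow> cmod (g x) \<le> k" "0 \<le> k" for g k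
  proof -
    have m: "(\<lambda>x. if p' = p \<and> x \<in> \<Gamma> p then g x else 0) \<in> borel_measurable (bdry (\<Omega> p'))" for p'
    proof (cases "p' = p")
      case True
      then show ?thesis by (subst measurable_cong[of _ _ g]) (auto simp: g)
    qed simp
    show "(\<lambda>p' x. if p' = p \<and> x \<in> \<Gamma> p then g x else 0) \<in> V"
      "nrm (\<lambda>p' x. if p' = p \<and> x \<in> \<Gamma> p then g x else 0) \<le> k * mass"
      using k by (intro bounded_mem m; auto)+
  qed
  have meas: "(\<lambda>x. c x * r u x) \<in> borel_measurable (bdry (\<Omega> p))" if "u \<in> V" for u
    using continuous_measurable_bdry[OF cont[OF that]] c by (rule borel_measurable_times[rotated])
  have bnd: "cmod (c x * r u x) \<le> B * C * nrm u" if "u \<in> V" "x \<in> \<Gamma> p" for u x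
  proof -
    have "cmod (c x) * cmod (r u x) \<le> B * (C * nrm u)"
      using B C that by (intro mult_mono) (auto simp: nrm_nonneg)
    then show ?thesis by (simp add: norm_mult)
  qed
  have loc_eq: "loc p c r u = (\<lambda>p' x. if p' = p \<and> x \<in> \<Gamma> p then c x * r u x else 0)" for u
    by (simp add: loc_def fun_eq_iff)
  have 1: "lin_op (loc p c r)"
    unfolding lin_op_def
  proof (intro conjI ballI allI)
    fix u assume "u \<in> V"
    then show "loc p c r u \<in> V"
      unfolding loc_eq using B C by (intro mem(1)[of _ "B * C * nrm u"] meas bnd) (auto simp: nrm_nonneg)
  next
    fix u v a assume "u \<in> V" "v \<in> V"
    then show "loc p c r (\<lambda>p x. a * u p x + v p x) = (\<lambda>p' x. a * loc p c r u p' x + loc p c r v p' x)"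
      by (simp add: loc_def fun_eq_iff rlin distrib_left mult.left_commute)
  qed
  have 2: "bounded_op (loc p c r)"
    unfolding bounded_op_def
  proof (intro exI[of _ "B * C * mass"] conjI ballI)
    show "0 \<le> B * C * mass" using B C mass_nonneg by simp
    fix u assume "u \<in> V"
    then have "nrm (loc p c r u) \<le> (B * C * nrm u) * mass"
      unfolding loc_eq using B C by (intro mem(2) meas bnd) (auto simp: nrm_nonneg)
    then show "nrm (loc p c r u) \<le> B * C * mass * nrm u" by (simp add: mult_ac)
  qed
  have 3: "approximable (loc p c r)"
    unfolding approximable_def
  proof (intro allI impI)
    fix \<epsilon> :: real assume \<epsilon>: "\<epsilon> > 0"
    \<comment> \<open>The summand 1 guards against \<open>mass = 0\<close>.\<close>
    define e where "e = \<epsilon> / (B * mass + 1)"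
    have den: "0 < B * mass + 1" using B mass_nonneg by (simp add: add_nonneg_pos)
    then have e: "e > 0" using \<epsilon> by (simp add: e_def)
    have e2: "B * e * mass \<le> \<epsilon>"
      using den \<epsilon> by (simp add: e_def field_simps)
    obtain \<delta> where \<delta>: "\<delta> > 0" "\<And>x x' u. x \<in> \<Gamma> p \<Longrightarrow> x' \<in> \<Gamma> p \<Longrightarrow> dist x x' < \<delta> \<Longrightarrow> u \<in> V \<Longrightarrow>
        cmod (r u x - r u x') \<le> e * nrm u"
      using equi[OF e] by blast
    have cov: "\<Gamma> p \<subseteq> (\<Union>x\<in>\<Gamma> p. ball x \<delta>)" using \<delta>(1) by auto
    obtain X where X: "X \<subseteq> \<Gamma> p" "finite X" "\<Gamma> p \<subseteq> (\<Union>x\<in>X. ball x \<delta>)"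
      by (rule compactE_image[OF compact_\<Gamma>[OF p] _ cov]) auto
    obtain xs where xs: "set xs = X" using finite_list[OF X(2)] by blast
    define n where "n = length xs"
    define A where "A i = ball (xs ! i) \<delta>" for i
    \<comment> \<open>Making the balls disjoint assigns exactly one sample point to every x; a
      centre need not lie in its own piece.\<close>
    define D where "D = disjointed A"
    have xsi: "xs ! i \<in> \<Gamma> p" if "i < n" for i
      using that X xs nth_mem[of i xs] unfolding n_def by blast
    have Dsub: "D i \<subseteq> ball (xs ! i) \<delta>" for i
      using disjointed_subset[of A i] by (simp add: D_def A_def)
    have Dborel: "D i \<in> sets borel" for i
      unfolding D_def disjointed_def A_def by auto
    have Dex: "\<exists>i<n. x \<in> D i" if "x \<in> \<Gamma> p" for x
    proof -
      have "x \<in> (\<Union>y\<in>X. ball y \<delta>)" using X that by blast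
      then obtain y where "y \<in> set xs" "x \<in> ball y \<delta>" using xs by blast
      then have "x \<in> (\<Union>i\<in>{0..<n}. A i)" by (auto simp: in_set_conv_nth n_def A_def)
      then have "x \<in> (\<Union>i\<in>{0..<n}. disjointed A i)" by (simp only: finite_UN_disjointed_eq)
      then show ?thesis by (auto simp: D_def)
    qed
    have Duniq: "i = j" if "x \<in> D i" "x \<in> D j" for i j x
      using that disjoint_family_disjointed[of A] unfolding D_def disjoint_family_on_def by blast
    define a where "a i = (\<lambda>p' x. if p' = p \<and> x \<in> \<Gamma> p then indicator (D i) x * c x else 0 :: complex)" for i
    define as where "as = map (\<lambda>i. (a i, \<lambda>u. r u (xs ! i))) [0..<n]"
    have rank: "rank_list as"
      unfolding rank_list_def
    proof (clarsimp simp: as_def, intro conjI)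
      fix i assume i: "i < n"
      show "a i \<in> V"
        unfolding a_def
      proof (rule mem(1)[of _ B])
        show "(\<lambda>x. indicator (D i) x * c x) \<in> borel_measurable (bdry (\<Omega> p))"
          using Dborel[of i] by (intro borel_measurable_times c borel_measurable_bdry) simp
        show "cmod (indicator (D i) x * c x) \<le> B" if "x \<in> \<Gamma> p" for x
          using B that by (auto simp: indicator_def)
      qed (use B in auto)
      show "functional (\<lambda>u. r u (xs ! i))"
        unfolding functional_def using rlin xsi[OF i] C by (intro conjI exI[of _ C]) auto
    qed
    have "nrm (\<lambda>p' x. loc p c r u p' x - (\<Sum>(a, \<beta>)\<leftarrow>as. \<beta> u * a p' x)) \<le> \<epsilon> * nrm u" if u: "u \<in> V" for u
    proof -
      define g where "g x = c x * r u x - (\<Sum>i<n. r u (xs ! i) * (indicator (D i) x * c x))" for x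
      have eq: "(\<lambda>p' x. loc p c r u p' x - (\<Sum>(a, \<beta>)\<leftarrow>as. \<beta> u * a p' x)) =
          (\<lambda>p' x. if p' = p \<and> x \<in> \<Gamma> p then g x else 0)"
        by (auto simp: fun_eq_iff loc_def as_def a_def g_def o_def interv_sum_list_conv_sum_set_nat atLeast0LessThan)
      have gm: "g \<in> borel_measurable (bdry (\<Omega> p))"
        unfolding g_def using Dborel
        by (intro borel_measurable_diff meas u borel_measurable_sum borel_measurable_times c
            borel_measurable_const borel_measurable_bdry) simp
      have gb: "cmod (g x) \<le> B * e * nrm u" if x: "x \<in> \<Gamma> p" for x
      proof -
        obtain i where i: "i < n" "x \<in> D i" using Dex[OF x] by blast
        have ind: "indicator (D j) x = (if j = i then 1 else 0 :: complex)" for j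
        proof (cases "j = i")
          case False
          then have "x \<notin> D j" using Duniq[OF i(2)] by blast
          then show ?thesis using False by simp
        qed (use i in simp)
        have "(\<Sum>j<n. r u (xs ! j) * (indicator (D j) x * c x)) = (\<Sum>j<n. if j = i then r u (xs ! i) * c x else 0)"
          by (intro sum.cong refl) (simp add: ind)
        also have "\<dots> = r u (xs ! i) * c x" using i(1) by simp
        finally have "g x = c x * (r u x - r u (xs ! i))" by (simp add: g_def algebra_simps)
        moreover have "dist x (xs ! i) < \<delta>" using Dsub[of i] i(2) by (auto simp: dist_commute)
        then have "cmod (r u x - r u (xs ! i)) \<le> e * nrm u" using x xsi[OF i(1)] u by (intro \<delta>(2))
        then have "cmod (c x) * cmod (r u x - r u (xs ! i)) \<le> B * (e * nrm u)"
          using B x by (intro mult_mono) auto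
        ultimately show ?thesis by (simp add: norm_mult)
      qed
      have "nrm (\<lambda>p' x. if p' = p \<and> x \<in> \<Gamma> p then g x else 0) \<le> B * e * nrm u * mass"
        using B e by (intro mem(2) gm gb) (auto simp: nrm_nonneg)
      also have "\<dots> = (B * e * mass) * nrm u" by simp
      also have "\<dots> \<le> \<epsilon> * nrm u" using e2 by (intro mult_right_mono nrm_nonneg)
      finally show ?thesis unfolding eq .
    qed
    then show "\<exists>as. rank_list as \<and>
        (\<forall>u\<in>V. nrm (\<lambda>p' x. loc p c r u p' x - (\<Sum>(a, \<beta>)\<leftarrow>as. \<beta> u * a p' x)) \<le> \<epsilon> * nrm u)"
      using rank by blast
  qed
  have 4: "complete_range (loc p c r)"
    unfolding complete_range_def
  proof (intro allI impI, elim conjE)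
    fix w :: "nat \<Rightarrow> fields" assume w: "\<forall>n. w n \<in> V"
      and cau: "\<forall>e>0. \<exists>N. \<forall>n\<ge>N. \<forall>j. nrm (\<lambda>p x. w (n + j) p x - w n p x) < e"
    have diff: "cmod (r (w (n + j)) x - r (w n) x) \<le> C * nrm (\<lambda>p x. w (n + j) p x - w n p x)"
      if x: "x \<in> \<Gamma> p" for n j x
    proof -
      have "r (\<lambda>p x. (- 1) * w n p x + w (n + j) p x) x = - 1 * r (w n) x + r (w (n + j)) x"
        using w x by (intro rlin) auto
      then have "r (w (n + j)) x - r (w n) x = r (\<lambda>p x. w (n + j) p x - w n p x) x" by simp
      then show ?thesis using C(2)[OF diff_mem x] w by simp
    qed
    have cau': "\<exists>N. \<forall>n\<ge>N. \<forall>j. \<forall>x\<in>\<Gamma> p. cmod (r (w (n + j)) x - r (w n) x) \<le> e" if e: "e > 0" for e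
    proof -
      have "e / (C + 1) > 0" using e C by simp
      then obtain N where N: "\<And>n j. n \<ge> N \<Longrightarrow> nrm (\<lambda>p x. w (n + j) p x - w n p x) < e / (C + 1)"
        using cau by blast
      have "cmod (r (w (n + j)) x - r (w n) x) \<le> e" if "n \<ge> N" "x \<in> \<Gamma> p" for n j x
      proof -
        have "C * nrm (\<lambda>p x. w (n + j) p x - w n p x) \<le> (C + 1) * (e / (C + 1))"
          using N[OF that(1), of j] C e by (intro mult_mono) (auto simp: nrm_nonneg)
        also have "\<dots> = e" using C by simp
        finally show ?thesis using diff[OF that(2), of n j] by simp
      qed
      then show ?thesis by blast
    qed
    define g where "g x = lim (\<lambda>n. r (w n) x)" for x
    have lim: "(\<lambda>n. r (w n) x) \<longlonglongrightarrow> g x" if x: "x \<in> \<Gamma> p" for x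
    proof -
      have "Cauchy (\<lambda>n. r (w n) x)"
      proof (rule metric_CauchyI)
        fix e :: real assume "e > 0"
        then have "e / 3 > 0" by simp
        then obtain N where N: "\<And>n j. n \<ge> N \<Longrightarrow> cmod (r (w (n + j)) x - r (w n) x) \<le> e / 3"
          using cau' x by blast
        have "dist (r (w k) x) (r (w l) x) < e" if "k \<ge> N" "l \<ge> N" for k l
        proof -
          have "dist (r (w k) x) (r (w N) x) \<le> e / 3" "dist (r (w l) x) (r (w N) x) \<le> e / 3"
            using N[of N "k - N"] N[of N "l - N"] that by (auto simp: dist_norm)
          then show ?thesis
            using dist_triangle2[of "r (w k) x" "r (w l) x" "r (w N) x"] \<open>e > 0\<close> by linarith
        qed
        then show "\<exists>M. \<forall>k\<ge>M. \<forall>l\<ge>M. dist (r (w k) x) (r (w l) x) < e" by blast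
      qed
      then show ?thesis by (simp add: g_def Cauchy_convergent_iff convergent_LIMSEQ_iff)
    qed
    have unif: "\<exists>N. \<forall>n\<ge>N. \<forall>x\<in>\<Gamma> p. cmod (r (w n) x - g x) \<le> e" if e: "e > 0" for e
    proof -
      obtain N where N: "\<And>n j x. n \<ge> N \<Longrightarrow> x \<in> \<Gamma> p \<Longrightarrow> cmod (r (w (n + j)) x - r (w n) x) \<le> e"
        using cau'[OF e] by blast
      have "cmod (r (w n) x - g x) \<le> e" if "n \<ge> N" "x \<in> \<Gamma> p" for n x
      proof -
        have "(\<lambda>j. r (w (j + n)) x) \<longlonglongrightarrow> g x"
          by (rule LIMSEQ_ignore_initial_segment[OF lim[OF that(2)]])
        then have "(\<lambda>j. cmod (r (w (j + n)) x - r (w n) x)) \<longlonglongrightarrow> cmod (g x - r (w n) x)"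
          by (intro tendsto_intros)
        then have "cmod (g x - r (w n) x) \<le> e"
          by (rule LIMSEQ_le_const2) (use N[OF that] in \<open>auto simp: add.commute\<close>)
        then show ?thesis by (simp add: norm_minus_commute)
      qed
      then show ?thesis by blast
    qed
    have gm: "(\<lambda>x. c x * g x) \<in> borel_measurable (bdry (\<Omega> p))"
    proof -
      have "g \<in> borel_measurable (bdry (\<Omega> p))"
        by (rule borel_measurable_LIMSEQ_metric[where f = "\<lambda>n. r (w n)"])
           (use w lim cont in \<open>auto intro: continuous_measurable_bdry\<close>)
      then show ?thesis using c by (intro borel_measurable_times)
    qed
    define v where "v = (\<lambda>p' x. if p' = p \<and> x \<in> \<Gamma> p then c x * g x else 0)"
    \<comment> \<open>One member of the sequence at uniform distance at most 1 from the limit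
      suffices to bound the limit.\<close>
    obtain N1 where N1: "\<And>x. x \<in> \<Gamma> p \<Longrightarrow> cmod (r (w N1) x - g x) \<le> 1"
      using unif[of 1] by auto
    have gb: "cmod (c x * g x) \<le> B * (C * nrm (w N1) + 1)" if x: "x \<in> \<Gamma> p" for x
    proof -
      have "cmod (g x) \<le> C * nrm (w N1) + 1"
        using N1[OF x] C(2)[of "w N1" x] w x norm_triangle_ineq4[of "r (w N1) x" "r (w N1) x - g x"] by auto
      then show ?thesis using B x by (auto simp: norm_mult intro!: mult_mono)
    qed
    have v: "v \<in> V"
      unfolding v_def using B C by (intro mem(1)[OF gm gb]) (auto simp: nrm_nonneg)
    have "(\<lambda>n. nrm (\<lambda>p' x. loc p c r (w n) p' x - v p' x)) \<longlonglongrightarrow> 0"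
    proof (rule LIMSEQ_I)
      fix \<epsilon> :: real assume \<epsilon>: "0 < \<epsilon>"
      define e where "e = \<epsilon> / (B * mass + 1)"
      have den: "0 < B * mass + 1" using B mass_nonneg by (simp add: add_nonneg_pos)
      then have e: "e > 0" using \<epsilon> by (simp add: e_def)
      have "B * e * mass < e * (B * mass + 1)" using e by (simp add: algebra_simps)
      also have "\<dots> = \<epsilon>" using den by (simp add: e_def)
      finally have e2: "B * e * mass < \<epsilon>" .
      obtain N where N: "\<And>n x. n \<ge> N \<Longrightarrow> x \<in> \<Gamma> p \<Longrightarrow> cmod (r (w n) x - g x) \<le> e"
        using unif[OF e] by blast
      have "nrm (\<lambda>p' x. loc p c r (w n) p' x - v p' x) < \<epsilon>" if n: "n \<ge> N" for n
      proof -
        have eq: "(\<lambda>p' x. loc p c r (w n) p' x - v p' x) =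
            (\<lambda>p' x. if p' = p \<and> x \<in> \<Gamma> p then c x * r (w n) x - c x * g x else 0)"
          by (auto simp: fun_eq_iff loc_def v_def)
        have "cmod (c x * r (w n) x - c x * g x) \<le> B * e" if x: "x \<in> \<Gamma> p" for x
        proof -
          have "cmod (c x) * cmod (r (w n) x - g x) \<le> B * e"
            using B N[OF n x] x by (intro mult_mono) auto
          then show ?thesis by (simp add: norm_mult[symmetric] right_diff_distrib)
        qed
        then have "nrm (\<lambda>p' x. loc p c r (w n) p' x - v p' x) \<le> B * e * mass"
          unfolding eq using w gm B e by (intro mem(2) borel_measurable_diff meas) auto
        then show ?thesis using e2 by simp
      qed
      then show "\<exists>N. \<forall>n\<ge>N. norm (nrm (\<lambda>p' x. loc p c r (w n) p' x - v p' x) - 0) < \<epsilon>"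
        by (intro exI[of _ N]) (simp add: nrm_nonneg)
    qed
    then show "\<exists>v\<in>V. (\<lambda>n. nrm (\<lambda>p' x. loc p c r (w n) p' x - v p' x)) \<longlonglongrightarrow> 0" using v by blast
  qed
  show ?thesis using 1 2 3 4 by (simp add: compact_op_def)
qed

section \<open>The coupling operator as a sum of localised operators\<close>

definition pot :: "bc \<times> nat \<Rightarrow> fields \<Rightarrow> real^2 \<Rightarrow> complex" where
  "pot p u x = (\<Sum>q\<in>I - {p}. mixed_potential \<kappa> \<eta> (fst q) (\<Omega> q) (sol q u) x)"

definition dpot :: "bc \<times> nat \<Rightarrow> fields \<Rightarrow> real^2 \<Rightarrow> complex" where
  "dpot p u x = (\<Sum>q\<in>I - {p}.
     dir_deriv (mixed_potential \<kappa> \<eta> (fst q) (\<Omega> q) (sol q u)) x (outward_normal (\<Omega> p) x))"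

text \<open>Every boundary operator is a combination of the trace and the normal derivative. The
  function h is confined to the weight: it is only measurable and bounded, so it could not be part
  of an equicontinuous map.\<close>

definition pot_weight :: "bc \<times> nat \<Rightarrow> real^2 \<Rightarrow> complex" where
  "pot_weight p x = (case fst p of Dirichlet \<Rightarrow> 1 | Neumann \<Rightarrow> 0 | Robin \<Rightarrow> h x)"

definition dpot_weight :: "bc \<times> nat \<Rightarrow> real^2 \<Rightarrow> complex" where
  "dpot_weight p x = (case fst p of Dirichlet \<Rightarrow> 0 | Neumann \<Rightarrow> 1 | Robin \<Rightarrow> 1)"

text \<open>Agrees with \<open>coupling_op\<close> on the boundaries, and is linear there pointwise, not only
  almost everywhere: potentials do not see changes of the density on null sets.\<close>

definition Kop :: "fields \<Rightarrow> fields" where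
  "Kop u p' x = (\<Sum>p\<in>I. loc p (pot_weight p) (pot p) u p' x + loc p (dpot_weight p) (dpot p) u p' x)"

lemma reg_pot: "p \<in> I \<Longrightarrow> reg p (pot p)"
  and reg_dpot: "p \<in> I \<Longrightarrow> reg p (dpot p)"
proof -
  assume p: "p \<in> I"
  have fin: "finite (I - {p})" by (simp add: finite_scatterers)
  have 1: "reg p (\<lambda>u x. mixed_potential \<kappa> \<eta> (fst q) (\<Omega> q) (sol q u) x)" if q: "q \<in> I - {p}" for q
  proof -
    have q: "q \<in> I" "p \<noteq> q" using q by auto
    show ?thesis
      by (rule reg_solution_op[OF q(1)], rule obstacle.regular_op_mixed_potential[OF obstacle[OF q(1)]])
         (use compact_\<Gamma>[OF p] disjoint_\<Gamma>[OF p q] in auto)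
  qed
  have 2: "reg p (\<lambda>u x. dir_deriv (mixed_potential \<kappa> \<eta> (fst q) (\<Omega> q) (sol q u)) x (outward_normal (\<Omega> p) x))"
    if q: "q \<in> I - {p}" for q
  proof -
    have q: "q \<in> I" "p \<noteq> q" using q by auto
    show ?thesis
      by (rule reg_solution_op[OF q(1)
            obstacle.regular_op_dir_deriv_mixed_potential[OF obstacle[OF q(1)], where v = "outward_normal (\<Omega> p)"]])
         (use compact_\<Gamma>[OF p] disjoint_\<Gamma>[OF p q] scatterer[OF p] in \<open>auto intro!: continuous_on_outward_normal\<close>)
  qed
  show "reg p (pot p)"
    using reg_sum[OF fin 1] unfolding pot_def[abs_def] by simp
  show "reg p (dpot p)"
    using reg_sum[OF fin 2] unfolding dpot_def[abs_def] by simp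
qed

lemma Kop_compact: "compact_op Kop"
proof -
  have w: "pot_weight p \<in> borel_measurable (bdry (\<Omega> p))" "\<exists>b. \<forall>x\<in>\<Gamma> p. cmod (pot_weight p x) \<le> b"
    if p: "p \<in> I" for p
  proof (atomize (full), cases "fst p")
    case Robin
    then obtain j where j: "p = (Robin, j)" by (cases p) auto
    have eq: "pot_weight p = h" by (auto simp: pot_weight_def j)
    have hp: "h \<in> borel_measurable (bdry (\<Omega> p))" "bounded (h ` \<Gamma> p)"
      using h_measurable[of j] h_bounded[of j] p by (simp_all add: j)
    show "pot_weight p \<in> borel_measurable (bdry (\<Omega> p)) \<and> (\<exists>b. \<forall>x\<in>\<Gamma> p. cmod (pot_weight p x) \<le> b)"
      using hp by (auto simp: eq bounded_iff)
  qed (auto simp: pot_weight_def[abs_def] intro: exI[of _ "1::real"])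
  have "compact_op (\<lambda>u p' x. loc p (pot_weight p) (pot p) u p' x + loc p (dpot_weight p) (dpot p) u p' x)"
    if p: "p \<in> I" for p
  proof (rule compact_op_add)
    obtain b where "\<forall>x\<in>\<Gamma> p. cmod (pot_weight p x) \<le> b" using w(2)[OF p] by blast
    then show "compact_op (loc p (pot_weight p) (pot p))"
      using p by (intro loc_compact[where b = b] reg_pot w(1)) auto
    have "dpot_weight p = (\<lambda>x. 0) \<or> dpot_weight p = (\<lambda>x. 1)"
      by (cases "fst p") (auto simp: dpot_weight_def fun_eq_iff)
    then show "compact_op (loc p (dpot_weight p) (dpot p))"
      using p by (intro loc_compact[where b = 1] reg_dpot) auto
  qed
  then have "compact_op (\<lambda>u p' x. \<Sum>p\<in>I. loc p (pot_weight p) (pot p) u p' x + loc p (dpot_weight p) (dpot p) u p' x)"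
    by (rule compact_op_sum)
  then show ?thesis by (simp add: Kop_def[abs_def])
qed

sublocale compact_operator V nrm Kop
  using Kop_compact by unfold_locales (auto simp: compact_op_def)

lemma Kop_eq:
  assumes p: "p \<in> I" and x: "x \<in> \<Gamma> p"
  shows "Kop u p x = coupling_op m \<Omega> \<kappa> \<eta> h u p x"
proof -
  have "Kop u p x = (\<Sum>p'\<in>I. if p = p' then pot_weight p x * pot p u x + dpot_weight p x * dpot p u x else 0)"
    unfolding Kop_def using x by (intro sum.cong) (auto simp: loc_def)
  also have "\<dots> = pot_weight p x * pot p u x + dpot_weight p x * dpot p u x"
    using p finite_scatterers by simp
  also have "\<dots> = coupling_op m \<Omega> \<kappa> \<eta> h u p x"
    by (cases "fst p")
       (auto simp: coupling_op_def pot_weight_def dpot_weight_def pot_def dpot_def sum.distrib sum_distrib_left)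
  finally show ?thesis .
qed

text \<open>Fields also carry values away from their boundaries, where \<open>A\<close> and its
  linear substitute differ. This relation disregards those values but, unlike
  \<open>prod_eq\<close>, demands equality at every boundary point.\<close>

definition agree :: "fields \<Rightarrow> fields \<Rightarrow> bool" where
  "agree u v \<longleftrightarrow> (\<forall>p\<in>I. \<forall>x\<in>\<Gamma> p. u p x = v p x)"

lemma agree_mem: "agree u v \<Longrightarrow> u \<in> V \<longleftrightarrow> v \<in> V"
proof -
  assume a: "agree u v"
  have "u p \<in> L2 (bdry (\<Omega> p)) \<longleftrightarrow> v p \<in> L2 (bdry (\<Omega> p))" if "p \<in> I" for p
  proof -
    have eq: "\<And>x. x \<in> space (bdry (\<Omega> p)) \<Longrightarrow> u p x = v p x" using a that by (auto simp: agree_def)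
    show ?thesis
      unfolding L2_def mem_Collect_eq
      by (intro conj_cong measurable_cong Bochner_Integration.integrable_cong refl) (simp_all only: eq)
  qed
  then show ?thesis by (simp add: prod_L2_def)
qed

lemma agree_nrm: "agree u v \<Longrightarrow> nrm u = nrm v"
  unfolding prod_norm_eq
  by (intro arg_cong[where f = sqrt] sum.cong Bochner_Integration.integral_cong refl) (simp add: agree_def)

lemma boundary_eq_cong: "W x = W' x \<Longrightarrow> boundary_eq \<kappa> \<eta> h i \<Omega>' \<phi> W x = boundary_eq \<kappa> \<eta> h i \<Omega>' \<phi> W' x"
  by (cases i) auto

text \<open>The boundary integral equation reads its right-hand side on the boundary only, so both
  data define the same predicate on densities, and the choice operator returns the same density for
  both.\<close>

lemma agree_coupling_op:
  assumes "agree u v" shows "coupling_op m \<Omega> \<kappa> \<eta> h u = coupling_op m \<Omega> \<kappa> \<eta> h v"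
proof -
  have "sol q u = sol q v" if q: "q \<in> I" for q
  proof -
    have "solves_bie \<kappa> \<eta> h (fst q) (\<Omega> q) (u q) = solves_bie \<kappa> \<eta> h (fst q) (\<Omega> q) (v q)"
      unfolding solves_bie_def
    proof (intro ext conj_cong refl AE_cong)
      fix \<phi> x assume "x \<in> space (bdry (\<Omega> q))"
      then have "u q x = v q x" using assms q by (auto simp: agree_def)
      then show "boundary_eq \<kappa> \<eta> h (fst q) (\<Omega> q) \<phi> (u q) x = boundary_eq \<kappa> \<eta> h (fst q) (\<Omega> q) \<phi> (v q) x"
        by (rule boundary_eq_cong)
    qed
    then show ?thesis by (simp add: solution_op_def)
  qed
  then show ?thesis
    unfolding coupling_op_def[abs_def] by (intro ext sum.cong refl) auto
qed

section \<open>Spectrum and GMRES residuals of the full operator\<close>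

abbreviation "A \<equiv> scattering_op m \<Omega> \<kappa> \<eta> h"

text \<open>Linear at every argument. The computations in Krylov spaces are carried out with it and
  transferred to \<open>A\<close> by \<open>agree\<close>.\<close>

definition A' :: "fields \<Rightarrow> fields" where
  "A' = (\<lambda>u p x. u p x + Kop u p x)"

lemma lin_A': "lin_op A'"
proof -
  have "A' (\<lambda>p x. c * v p x + w p x) = (\<lambda>p x. c * A' v p x + A' w p x)" if "v \<in> V" "w \<in> V" for v w c
    using that unfolding A'_def by (simp add: lin_opD(2)[OF lin]) (simp add: algebra_simps)
  then show ?thesis
    unfolding lin_op_def using add_mem[OF _ lin_opD(1)[OF lin]] by (auto simp: A'_def)
qed

lemma agree_A:
  assumes "agree u v" shows "agree (A u) (A' v)"
  using assms agree_coupling_op[OF assms] by (simp add: agree_def A'_def scattering_op_def Kop_eq)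

lemma agree_A_pow: "agree ((A ^^ i) u) ((A' ^^ i) u)"
  by (induction i) (simp add: agree_def, simp add: agree_A)

lemma A_mem: "u \<in> V \<Longrightarrow> A u \<in> V"
  using agree_mem[OF agree_A[of u u]] lin_opD(1)[OF lin_A'] by (simp add: agree_def)

lemma eigenvalues_iff: "z \<in> eigenvalues m \<Omega> A \<longleftrightarrow> eigenvalue Kop (z - 1)"
proof -
  have "\<not> prod_eq m \<Omega> u (\<lambda>p x. 0) \<and> prod_eq m \<Omega> (A u) (\<lambda>p x. z * u p x) \<longleftrightarrow>
      nrm u \<noteq> 0 \<and> nrm (\<lambda>p x. Kop u p x - (z - 1) * u p x) = 0" if u: "u \<in> V" for u
  proof -
    have mem: "(\<lambda>p x. Kop u p x - (z - 1) * u p x) \<in> V" by (rule shift_mem[OF lin u])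
    have "(AE x in bdry (\<Omega> p). A u p x = z * u p x) \<longleftrightarrow> (AE x in bdry (\<Omega> p). Kop u p x - (z - 1) * u p x = 0)"
      if "p \<in> I" for p
      using that by (intro AE_cong) (auto simp: scattering_op_def Kop_eq algebra_simps)
    then show ?thesis
      unfolding prod_norm_zero_iff[OF u] prod_norm_zero_iff[OF mem] by (simp add: prod_eq_def)
  qed
  then show ?thesis unfolding eigenvalues_def eigenvalue_def by blast
qed

lemma residual_mem:
  assumes "b \<in> V" "W \<in> V" shows "residual A b W \<in> V"
  using diff_mem[OF assms(1) A_mem[OF assms(2)]] by (simp add: residual_def[abs_def])

text \<open>GMRES minimises over all polynomials of bounded degree with value 1 at 0. The product of
  the factors \<open>Kop - \<mu>\<close>, as a polynomial in \<open>A\<close>, becomes one of them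
  after division by its value at 0; by \<open>nz\<close> this value is not 0.\<close>

lemma gmres_residual_bound:
  assumes b: "b \<in> V" and W0: "W0 \<in> V" and gm: "gmres_iterates nrm A b W0 W"
    and nz: "- 1 \<notin> set ls"
  shows "nrm (residual A b (W (length ls))) \<le>
    inverse (cmod (\<Prod>\<mu>\<leftarrow>ls. - 1 - \<mu>)) * nrm (prod_op Kop ls (residual A b W0))"
proof -
  define r where "r = residual A b W0"
  define n where "n = length ls"
  have r: "r \<in> V" unfolding r_def using b W0 by (rule residual_mem)
  obtain q where q: "prod_op Kop ls r = (\<lambda>p x. \<Sum>i\<le>n. q i * (A' ^^ i) r p x)"
    and q0: "q 0 = (\<Prod>\<mu>\<leftarrow>ls. - 1 - \<mu>)"
    using prod_op_polynomial[OF lin r, of ls] by (auto simp: n_def A'_def)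
  have q0nz: "q 0 \<noteq> 0" unfolding q0 using nz by (induction ls) auto
  \<comment> \<open>Chosen so that r - A \<Sum> c_i A^i r equals q(A) r / q(0): the nonconstant
    terms of q, divided by A and by -q(0).\<close>
  define c where "c i = - q (Suc i) / q 0" for i
  define X where "X = (\<lambda>p x. W0 p x + (\<Sum>i<n. c i * (A ^^ i) r p x))"
  define X' where "X' = (\<lambda>p x. W0 p x + (\<Sum>i<n. c i * (A' ^^ i) r p x))"
  have "X \<in> krylov_affine A b W0 n"
    unfolding krylov_affine_def X_def r_def by blast
  then have le: "nrm (residual A b (W n)) \<le> nrm (residual A b X)"
    using gm by (simp add: gmres_iterates_def)
  have sm: "(\<lambda>p x. \<Sum>i<n. c i * (A' ^^ i) r p x) \<in> V"
    using r by (intro sum_mem funpow_mem lin_A')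
  have "agree X X'"
    using agree_A_pow[of _ r] by (simp add: agree_def X_def X'_def)
  then have aX: "agree (A X) (A' X')" by (rule agree_A)
  have AX': "A' X' = (\<lambda>p x. A' W0 p x + (\<Sum>i<n. c i * (A' ^^ Suc i) r p x))"
  proof -
    have "A' X' = A' (\<lambda>p x. 1 * W0 p x + (\<Sum>i<n. c i * (A' ^^ i) r p x))" by (simp add: X'_def)
    also have "\<dots> = (\<lambda>p x. 1 * A' W0 p x + A' (\<lambda>p x. \<Sum>i<n. c i * (A' ^^ i) r p x) p x)"
      using W0 sm by (rule lin_opD(2)[OF lin_A'])
    also have "A' (\<lambda>p x. \<Sum>i<n. c i * (A' ^^ i) r p x) = (\<lambda>p x. \<Sum>i<n. c i * A' ((A' ^^ i) r) p x)"
      using r by (intro lin_op_sum funpow_mem lin_A')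
    finally show ?thesis by simp
  qed
  have a0: "agree (A W0) (A' W0)" by (rule agree_A) (simp add: agree_def)
  have pt: "r p x - (\<Sum>i<n. c i * (A' ^^ Suc i) r p x) = inverse (q 0) * prod_op Kop ls r p x" for p x
  proof -
    have "prod_op Kop ls r p x = q 0 * r p x + (\<Sum>i<n. q (Suc i) * (A' ^^ Suc i) r p x)"
      unfolding q lessThan_Suc_atMost[symmetric] by (simp only: sum.lessThan_Suc_shift) simp
    then show ?thesis
      using q0nz by (simp add: c_def distrib_left sum_distrib_left sum_negf field_simps)
  qed
  have "agree (residual A b X) (\<lambda>p x. inverse (q 0) * prod_op Kop ls r p x)"
    unfolding agree_def
  proof (intro ballI)
    fix p x assume "p \<in> I" "x \<in> \<Gamma> p"
    then have AX: "A X p x = A W0 p x + (\<Sum>i<n. c i * (A' ^^ Suc i) r p x)"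
      using aX a0 unfolding AX' by (simp add: agree_def)
    have rp: "r p x = b p x - A W0 p x" by (simp add: r_def residual_def)
    have "residual A b X p x = r p x - (\<Sum>i<n. c i * (A' ^^ Suc i) r p x)"
      unfolding residual_def[of A b X] AX rp by simp
    then show "residual A b X p x = inverse (q 0) * prod_op Kop ls r p x" by (simp only: pt)
  qed
  then have "nrm (residual A b X) = nrm (\<lambda>p x. inverse (q 0) * prod_op Kop ls r p x)" by (rule agree_nrm)
  also have "\<dots> = cmod (inverse (q 0)) * nrm (prod_op Kop ls r)"
    using r by (intro nrm_scale prod_op_mem lin)
  finally show ?thesis using le by (simp add: n_def r_def q0 norm_inverse)
qed

text \<open>Padding \<open>ms\<close> with k zeros inserts the k-th power of \<open>Kop\<close>,
  while each zero contributes -1 - 0, of modulus 1, to the normalisation. Hence the constant does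
  not depend on k.\<close>

lemma gmres_decay:
  assumes dec: "root_decay Kop ms \<rho>" and nz: "- 1 \<notin> set ms"
  shows "\<exists>C. \<forall>b\<in>V. \<forall>W0\<in>V. \<forall>W. gmres_iterates nrm A b W0 W \<longrightarrow>
    (\<forall>k. nrm (residual A b (W (length ms + k))) \<le> C * \<rho> ^ k * nrm (residual A b W0))"
proof -
  obtain C where C: "0 \<le> C" "\<And>u k. u \<in> V \<Longrightarrow> nrm ((Kop ^^ k) (prod_op Kop ms u)) \<le> C * \<rho> ^ k * nrm u"
    using dec by (auto simp: root_decay_def)
  define c where "c = inverse (cmod (\<Prod>\<mu>\<leftarrow>ms. - 1 - \<mu>))"
  have c: "0 \<le> c" by (simp add: c_def)
  have "nrm (residual A b (W (length ms + k))) \<le> c * C * \<rho> ^ k * nrm (residual A b W0)"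
    if b: "b \<in> V" and W0: "W0 \<in> V" and gm: "gmres_iterates nrm A b W0 W" for b W0 W k
  proof -
    define r where "r = residual A b W0"
    have r: "r \<in> V" unfolding r_def using b W0 by (rule residual_mem)
    have "- 1 \<notin> set (replicate k 0 @ ms)" using nz by auto
    from gmres_residual_bound[OF b W0 gm this]
    have "nrm (residual A b (W (length ms + k))) \<le> c * nrm ((Kop ^^ k) (prod_op Kop ms r))"
      by (simp add: prod_op_zeros r_def c_def add.commute norm_mult norm_power)
    also have "\<dots> \<le> c * (C * \<rho> ^ k * nrm r)" using C(2)[OF r] c by (intro mult_left_mono)
    finally show ?thesis by (simp add: r_def mult_ac)
  qed
  then show ?thesis by blast
qed

lemma finite_outliers: "0 < r \<Longrightarrow> finite {z \<in> eigenvalues m \<Omega> A. r < cmod (z - 1)}"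
proof -
  assume "0 < r"
  have "{z \<in> eigenvalues m \<Omega> A. r < cmod (z - 1)} \<subseteq> (\<lambda>\<mu>. \<mu> + 1) ` {\<mu>. eigenvalue Kop \<mu> \<and> r < cmod \<mu>}"
  proof
    fix z assume "z \<in> {z \<in> eigenvalues m \<Omega> A. r < cmod (z - 1)}"
    then show "z \<in> (\<lambda>\<mu>. \<mu> + 1) ` {\<mu>. eigenvalue Kop \<mu> \<and> r < cmod \<mu>}"
      by (intro image_eqI[of _ _ "z - 1"]) (auto simp: eigenvalues_iff)
  qed
  then show ?thesis using finite_eigenvalues[OF \<open>0 < r\<close>] by (meson finite_imageI finite_subset)
qed

text \<open>Near a point other than 1 all eigenvalues keep a fixed positive distance from 1, and
  there are only finitely many of those.\<close>

lemma islimpt_eigenvalues: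
  assumes z: "z islimpt eigenvalues m \<Omega> A" shows "z = 1"
proof (rule ccontr)
  assume "z \<noteq> 1"
  define r where "r = cmod (z - 1) / 2"
  have r: "0 < r" "r < cmod (z - 1)" using \<open>z \<noteq> 1\<close> by (auto simp: r_def)
  have "open {w. r < cmod (w - 1)}" by (intro open_Collect_less continuous_intros)
  then have "z islimpt (eigenvalues m \<Omega> A \<inter> {w. r < cmod (w - 1)})"
    unfolding islimpt_def
  proof (intro allI impI)
    fix T assume T: "z \<in> T" "open T"
    have U: "open (T \<inter> {w. r < cmod (w - 1)})" "z \<in> T \<inter> {w. r < cmod (w - 1)}"
      using T r \<open>open {w. r < cmod (w - 1)}\<close> by auto
    obtain y where "y \<in> eigenvalues m \<Omega> A" "y \<in> T \<inter> {w. r < cmod (w - 1)}" "y \<noteq> z"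
      by (rule islimptE[OF z U(2,1)])
    then show "\<exists>y\<in>eigenvalues m \<Omega> A \<inter> {w. r < cmod (w - 1)}. y \<in> T \<and> y \<noteq> z"
      by (intro bexI[of _ y]) simp_all
  qed
  moreover have "eigenvalues m \<Omega> A \<inter> {w. r < cmod (w - 1)} = {z \<in> eigenvalues m \<Omega> A. r < cmod (z - 1)}" by auto
  then have "finite (eigenvalues m \<Omega> A \<inter> {w. r < cmod (w - 1)})" using finite_outliers[OF r(1)] by simp
  ultimately show False using islimpt_finite by blast
qed

lemma gmres_uniform_degree:
  obtains deg :: "complex set \<Rightarrow> nat" where
    "\<And>S \<rho>. 0 < \<rho> \<Longrightarrow> (\<And>z. z \<in> S \<Longrightarrow> z \<noteq> 0 \<and> \<rho> < cmod (z - 1)) \<Longrightarrow>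
      (\<And>z. z \<in> eigenvalues m \<Omega> A \<Longrightarrow> z \<notin> S \<Longrightarrow> cmod (z - 1) < \<rho>) \<Longrightarrow>
      \<exists>C. \<forall>b\<in>V. \<forall>W0\<in>V. \<forall>W. gmres_iterates nrm A b W0 W \<longrightarrow>
        (\<forall>k. nrm (residual A b (W (deg S + k))) \<le> C * \<rho> ^ k * nrm (residual A b W0))"
proof -
  obtain deg where deg: "\<And>S r. separates S r \<Longrightarrow> \<exists>ms. set ms \<subseteq> S \<and> length ms = deg S \<and> root_decay Kop ms r"
    using uniform_degree by blast
  show thesis
  proof (rule that[of "\<lambda>S. deg ((\<lambda>z. z - 1) ` S)"])
    fix S \<rho> assume \<rho>: "0 < \<rho>" and out: "\<And>z. z \<in> S \<Longrightarrow> z \<noteq> 0 \<and> \<rho> < cmod (z - 1)"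
      and clu: "\<And>z. z \<in> eigenvalues m \<Omega> A \<Longrightarrow> z \<notin> S \<Longrightarrow> cmod (z - 1) < \<rho>"
    define S' where "S' = (\<lambda>z. z - 1) ` S"
    have "cmod \<mu> < \<rho>" if "eigenvalue Kop \<mu>" "\<mu> \<notin> S'" for \<mu>
    proof -
      have "\<mu> + 1 \<notin> S" using that(2) by (force simp: S'_def)
      then show ?thesis using clu[of "\<mu> + 1"] that(1) by (simp add: eigenvalues_iff)
    qed
    then have "separates S' \<rho>" using \<rho> out by (auto simp: separates_def S'_def)
    then obtain ms where ms: "set ms \<subseteq> S'" "length ms = deg S'" "root_decay Kop ms \<rho>"
      using deg by blast
    \<comment> \<open>The outliers differ from 0, so the shifted ones differ from -1.\<close>
    have "- 1 \<notin> set ms" using ms(1) out by (auto simp: S'_def)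
    from gmres_decay[OF ms(3) this] show "\<exists>C. \<forall>b\<in>V. \<forall>W0\<in>V. \<forall>W. gmres_iterates nrm A b W0 W \<longrightarrow>
        (\<forall>k. nrm (residual A b (W (deg ((\<lambda>z. z - 1) ` S) + k))) \<le> C * \<rho> ^ k * nrm (residual A b W0))"
      unfolding ms(2) S'_def .
  qed
qed

end

section \<open>Convergence of GMRES\<close>

theorem mainTheorem4:
  fixes m :: "bc \<Rightarrow> nat"
    and \<Omega> :: "bc \<times> nat \<Rightarrow> (real^2) set"
    and \<kappa> :: complex and \<eta> :: real and h :: "real^2 \<Rightarrow> complex"
    and A :: "fields \<Rightarrow> fields" and E :: "complex set"
  assumes scatterer: "\<And>p. p \<in> scatterers m \<Longrightarrow> open (\<Omega> p) \<and> bounded (\<Omega> p) \<and> C2_boundary (\<Omega> p)"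
    and separated: "\<And>p q. p \<in> scatterers m \<Longrightarrow> q \<in> scatterers m \<Longrightarrow> p \<noteq> q \<Longrightarrow>
                      closure (\<Omega> p) \<inter> closure (\<Omega> q) = {}"
    and wave_number: "\<kappa> \<noteq> 0" "Im \<kappa> \<ge> 0"
    and h_measurable: "\<And>j. (Robin, j) \<in> scatterers m \<Longrightarrow> h \<in> borel_measurable (bdry (\<Omega> (Robin, j)))"
    and h_bounded: "\<And>j. (Robin, j) \<in> scatterers m \<Longrightarrow> bounded (h ` frontier (\<Omega> (Robin, j)))"
    and h_sign: "\<And>j x. (Robin, j) \<in> scatterers m \<Longrightarrow> x \<in> frontier (\<Omega> (Robin, j)) \<Longrightarrow>
                   Im (cnj \<kappa> * h x) \<ge> 0"
    and eta_sign: "\<eta> * Re \<kappa> \<ge> 0"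
    and solvable: "\<And>p. p \<in> scatterers m \<Longrightarrow> bounded_solution_op \<kappa> \<eta> h (fst p) (\<Omega> p)"
    and A_def: "A = scattering_op m \<Omega> \<kappa> \<eta> h"
    and E_def: "E = eigenvalues m \<Omega> A"
  shows "(\<forall>W \<in> prod_L2 m \<Omega>. A W \<in> prod_L2 m \<Omega>) \<and>
    countable E \<and> (\<forall>z. z islimpt E \<longrightarrow> z = 1) \<and>
    (\<forall>\<rho>::real. 0 < \<rho> \<and> \<rho> < 1 \<longrightarrow> finite {z \<in> E. cmod (z - 1) > \<rho>}) \<and>
    (\<exists>N \<Lambda>. eigenvalue_numbering E N \<Lambda>) \<and>
    (\<exists>deg :: complex set \<Rightarrow> nat.
      \<forall>N \<Lambda> (\<rho>::real) (M::nat) (d::nat) (\<delta>::real).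
        eigenvalue_numbering E N \<Lambda> \<and> 0 < \<rho> \<and> enat M \<le> N \<and>
        (\<forall>j. 1 \<le> j \<and> j \<le> M \<longrightarrow> \<Lambda> j \<noteq> 0 \<and> cmod (\<Lambda> j - 1) > \<rho>) \<and>
        (\<forall>j. M + 1 \<le> j \<and> enat j \<le> N \<longrightarrow> cmod (\<Lambda> j - 1) < \<rho>) \<and>
        \<delta> = (SUP z\<in>sphere 1 \<rho>. MAX j\<in>{1..M}. cmod (\<Lambda> j - z) / cmod (\<Lambda> j)) \<and>
        d = deg (\<Lambda> ` {1..M}) \<longrightarrow>
        (\<exists>C\<^sub>\<delta>::real. \<forall>b \<in> prod_L2 m \<Omega>. \<forall>W0 \<in> prod_L2 m \<Omega>. \<forall>W.
           gmres_iterates (prod_norm m \<Omega>) A b W0 W \<longrightarrow>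
           (\<forall>k. prod_norm m \<Omega> (residual A b (W (d + k)))
                  \<le> C\<^sub>\<delta> * \<rho> ^ k * prod_norm m \<Omega> (residual A b W0))))"
proof -
  obtain F F1 F2 :: "real \<Rightarrow> complex" where F:
    "\<And>s. 0 < s \<Longrightarrow> (F has_vector_derivative F1 s) (at s)"
    "\<And>s. 0 < s \<Longrightarrow> (F1 has_vector_derivative F2 s) (at s)"
    "continuous_on {0<..} F2"
    "\<And>x y. x \<noteq> y \<Longrightarrow> green \<kappa> x y = F ((dist x y)\<^sup>2)"
    using green_radial[OF wave_number(1)] by blast
  interpret S: scattering \<kappa> F F1 F2 m \<Omega> \<eta> h
    by (intro scattering.intro radial_kernel.intro scattering_axioms.intro F
        scatterer separated h_measurable h_bounded solvable)
  obtain deg where deg: "\<And>S \<rho>. 0 < \<rho> \<Longrightarrow> (\<And>z. z \<in> S \<Longrightarrow> z \<noteq> 0 \<and> \<rho> < cmod (z - 1)) \<Longrightarrow>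
      (\<And>z. z \<in> E \<Longrightarrow> z \<notin> S \<Longrightarrow> cmod (z - 1) < \<rho>) \<Longrightarrow>
      \<exists>C. \<forall>b\<in>prod_L2 m \<Omega>. \<forall>W0\<in>prod_L2 m \<Omega>. \<forall>W. gmres_iterates (prod_norm m \<Omega>) A b W0 W \<longrightarrow>
        (\<forall>k. prod_norm m \<Omega> (residual A b (W (deg S + k))) \<le>
          C * \<rho> ^ k * prod_norm m \<Omega> (residual A b W0))"
    using S.gmres_uniform_degree unfolding E_def A_def by blast
  have fin: "finite {z \<in> E. r < cmod (z - 1)}" if "0 < r" for r
    using S.finite_outliers[OF that] by (simp add: E_def A_def)
  have bound: "\<exists>C. \<forall>b\<in>prod_L2 m \<Omega>. \<forall>W0\<in>prod_L2 m \<Omega>. \<forall>W. gmres_iterates (prod_norm m \<Omega>) A b W0 W \<longrightarrow>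
      (\<forall>k. prod_norm m \<Omega> (residual A b (W (deg (\<Lambda> ` {1..M}) + k))) \<le>
        C * \<rho> ^ k * prod_norm m \<Omega> (residual A b W0))"
    if num: "eigenvalue_numbering E N \<Lambda>" and \<rho>: "0 < \<rho>"
      and out: "\<forall>j. 1 \<le> j \<and> j \<le> M \<longrightarrow> \<Lambda> j \<noteq> 0 \<and> cmod (\<Lambda> j - 1) > \<rho>"
      and clu: "\<forall>j. M + 1 \<le> j \<and> enat j \<le> N \<longrightarrow> cmod (\<Lambda> j - 1) < \<rho>"
    for N :: enat and \<Lambda> :: "nat \<Rightarrow> complex" and \<rho> :: real and M :: nat
  proof (rule deg[OF \<rho>])
    show "z \<noteq> 0 \<and> \<rho> < cmod (z - 1)" if "z \<in> \<Lambda> ` {1..M}" for z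
      using out that by auto
    show "cmod (z - 1) < \<rho>" if z: "z \<in> E" "z \<notin> \<Lambda> ` {1..M}" for z
    \<comment> \<open>The eigenvalue 1 may be missing from the numbering, but it is the centre of
      the cluster disc.\<close>
    proof (cases "z = 1")
      case False
      have "E - {1} \<subseteq> \<Lambda> ` {j. 1 \<le> j \<and> enat j \<le> N}"
        using num by (simp add: eigenvalue_numbering_def)
      then obtain j where "1 \<le> j" "enat j \<le> N" "z = \<Lambda> j" using z(1) False by blast
      moreover from this have "\<not> j \<le> M" using z(2) by auto
      ultimately show ?thesis using clu by auto
    qed (simp add: \<rho>)
  qed
  show ?thesis
  proof (intro conjI)
    show "\<forall>W\<in>prod_L2 m \<Omega>. A W \<in> prod_L2 m \<Omega>" using S.A_mem by (simp add: A_def)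
    show "countable E" "\<exists>N \<Lambda>. eigenvalue_numbering E N \<Lambda>"
      using eigenvalue_numbering_exists[OF fin] by auto
    show "\<forall>z. z islimpt E \<longrightarrow> z = 1" using S.islimpt_eigenvalues by (simp add: E_def A_def)
    show "\<forall>\<rho>::real. 0 < \<rho> \<and> \<rho> < 1 \<longrightarrow> finite {z \<in> E. cmod (z - 1) > \<rho>}" using fin by simp
    show "\<exists>deg :: complex set \<Rightarrow> nat.
      \<forall>N \<Lambda> (\<rho>::real) (M::nat) (d::nat) (\<delta>::real).
        eigenvalue_numbering E N \<Lambda> \<and> 0 < \<rho> \<and> enat M \<le> N \<and>
        (\<forall>j. 1 \<le> j \<and> j \<le> M \<longrightarrow> \<Lambda> j \<noteq> 0 \<and> cmod (\<Lambda> j - 1) > \<rho>) \<and>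
        (\<forall>j. M + 1 \<le> j \<and> enat j \<le> N \<longrightarrow> cmod (\<Lambda> j - 1) < \<rho>) \<and>
        \<delta> = (SUP z\<in>sphere 1 \<rho>. MAX j\<in>{1..M}. cmod (\<Lambda> j - z) / cmod (\<Lambda> j)) \<and>
        d = deg (\<Lambda> ` {1..M}) \<longrightarrow>
        (\<exists>C\<^sub>\<delta>::real. \<forall>b \<in> prod_L2 m \<Omega>. \<forall>W0 \<in> prod_L2 m \<Omega>. \<forall>W.
           gmres_iterates (prod_norm m \<Omega>) A b W0 W \<longrightarrow>
           (\<forall>k. prod_norm m \<Omega> (residual A b (W (d + k)))
                  \<le> C\<^sub>\<delta> * \<rho> ^ k * prod_norm m \<Omega> (residual A b W0)))"
      by (intro exI[of _ deg] allI impI, elim conjE) (simp only: bound)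
  qed
qed

end
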